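(* Let $p\ge 2$ be an integer. There is a finite simplicial complex $K$ whose geometric realization is homeomorphic to the $2$-dimensional mod $p$ Moore space $S^1\cup_p e^2$ (the space obtained by attaching a $2$-cell to the circle $S^1$ by a map of degree $p$, namely $z\mapsto z^p$) such that $K$ is Golod over $\mathbb{Q}$ but is not Golod over $\mathbb{Z}/p$.
   Context: For a simplicial complex $K$ on the vertex set $[m]=\{1,\ldots,m\}$ and a commutative ring $\Bbbk$, the Stanley-Reisner ring is $\Bbbk[K]=\Bbbk[v_1,\ldots,v_m]/(v_{i_1}\cdots v_{i_k} : \{i_1,\ldots,i_k\}\notin K)$, with $|v_i|=2$. $K$ is Golod over $\Bbbk$ if all products and all (higher) Massey products in $\mathrm{Tor}^+_{\Bbbk[v_1,\ldots,v_m]}(\Bbbk[K],\Bbbk)$ (the positive-degree part) are trivial, where the multiplicative structure is induced from the Koszul resolution of $\Bbbk$ over $\Bbbk[v_1,\ldots,v_m]$ (i.e. Tor is the homology of the differential graded algebra $\Lambda(u_1,\ldots,u_m)\otimes\Bbbk[K]$, $du_i=v_i$). *)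

theory Defs
  imports
    "HOL-Analysis.Analysis"
    "HOL-Library.Poly_Mapping"
    "HOL-Algebra.QuotRing"
    "Berlekamp_Zassenhaus.Finite_Field"
begin

section \<open>Simplicial complexes and their realizations\<close>

text \<open>Every element of the vertex set is a vertex, i.e. there are no ghost vertices.\<close>

definition simplicial_complex_on :: "nat \<Rightarrow> nat set set \<Rightarrow> bool" where
  "simplicial_complex_on m K \<longleftrightarrow>
     K \<subseteq> Pow {1..m} \<and> {} \<in> K \<and> (\<forall>i\<in>{1..m}. {i} \<in> K) \<and> (\<forall>\<sigma>\<in>K. \<forall>\<tau>. \<tau> \<subseteq> \<sigma> \<longrightarrow> \<tau> \<in> K)"

text \<open>Points are given by their barycentric coordinates.\<close>

definition geometric_realization :: "nat \<Rightarrow> nat set set \<Rightarrow> (nat \<Rightarrow> real) topology" where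
  "geometric_realization m K =
     subtopology (powertop_real UNIV)
       {x. (\<forall>i. 0 \<le> x i) \<and> {i. x i \<noteq> 0} \<in> K \<and> (\<Sum>i\<in>{1..m}. x i) = 1}"

definition quotient_topology :: "'a topology \<Rightarrow> ('a \<times> 'a) set \<Rightarrow> 'a set topology" where
  "quotient_topology X r =
     topology (\<lambda>U. U \<subseteq> topspace X // r \<and> openin X {x \<in> topspace X. r `` {x} \<in> U})"

lemma openin_quotient_topology:
  "openin (quotient_topology X r) U \<longleftrightarrow>
     U \<subseteq> topspace X // r \<and> openin X {x \<in> topspace X. r `` {x} \<in> U}"
proof -
  have "istopology (\<lambda>U. U \<subseteq> topspace X // r \<and> openin X {x \<in> topspace X. r `` {x} \<in> U})"
    unfolding istopology_def
  proof (rule conjI; clarify)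
    fix S T
    assume "openin X {x \<in> topspace X. r `` {x} \<in> S}" "openin X {x \<in> topspace X. r `` {x} \<in> T}"
    moreover have "{x \<in> topspace X. r `` {x} \<in> S \<inter> T} =
        {x \<in> topspace X. r `` {x} \<in> S} \<inter> {x \<in> topspace X. r `` {x} \<in> T}" by blast
    ultimately show "S \<subseteq> topspace X // r \<Longrightarrow> T \<subseteq> topspace X // r \<Longrightarrow>
       S \<inter> T \<subseteq> topspace X // r \<and> openin X {x \<in> topspace X. r `` {x} \<in> S \<inter> T}" by auto
  next
    fix \<K>
    assume *: "\<forall>k\<in>\<K>. k \<subseteq> topspace X // r \<and> openin X {x \<in> topspace X. r `` {x} \<in> k}"
    have "{x \<in> topspace X. r `` {x} \<in> \<Union>\<K>} = (\<Union>k\<in>\<K>. {x \<in> topspace X. r `` {x} \<in> k})" by blast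
    with * show "\<Union>\<K> \<subseteq> topspace X // r \<and> openin X {x \<in> topspace X. r `` {x} \<in> \<Union>\<K>}" by auto
  qed
  then show ?thesis unfolding quotient_topology_def by (simp add: topology_inverse')
qed

text \<open>The Moore space is the quotient of the disjoint union of the closed unit disc (index
  \<open>True\<close>) and the unit circle (index \<open>False\<close>) which glues a boundary point \<open>z\<close> of the disc to the
  point \<open>z ^ p\<close> of the circle.\<close>

definition disc_plus_circle :: "(bool \<times> complex) topology" where
  "disc_plus_circle =
     sum_topology (\<lambda>b. if b then top_of_set (cball 0 1) else top_of_set (sphere 0 1)) UNIV"

definition moore_space :: "nat \<Rightarrow> (bool \<times> complex) set topology" where
  "moore_space p =
     quotient_topology disc_plus_circle
       {(x, y). x \<in> topspace disc_plus_circle \<and> y \<in> topspace disc_plus_circle \<and>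
          equivclp (\<lambda>x y. \<exists>z\<in>sphere 0 1. x = (True, z) \<and> y = (False, z ^ p)) x y}"


section \<open>Differential graded algebras and Massey products\<close>

text \<open>The grading is cohomological: the differential raises the degree by one.\<close>

record 'a dga = "'a ring" +
  gr :: "int \<Rightarrow> 'a set"
  dff :: "'a \<Rightarrow> 'a"

definition cocycles :: "('a, 'b) dga_scheme \<Rightarrow> int \<Rightarrow> 'a set" where
  "cocycles A n = {x \<in> gr A n. dff A x = \<zero>\<^bsub>A\<^esub>}"

definition coboundaries :: "('a, 'b) dga_scheme \<Rightarrow> int \<Rightarrow> 'a set" where
  "coboundaries A n = dff A ` gr A (n - 1)"

definition hclass :: "('a, 'b) dga_scheme \<Rightarrow> int \<Rightarrow> 'a \<Rightarrow> 'a set" where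
  "hclass A n x = coboundaries A n +>\<^bsub>A\<^esub> x"

definition homology :: "('a, 'b) dga_scheme \<Rightarrow> int \<Rightarrow> 'a set set" where
  "homology A n = hclass A n ` cocycles A n"

text \<open>With \<open>s = deg a + 1\<close> this is the usual sign twist \<open>(-1)^(1 + deg a) a\<close> of Massey products.\<close>

definition signed :: "('a, 'b) dga_scheme \<Rightarrow> int \<Rightarrow> 'a \<Rightarrow> 'a" where
  "signed A s x = (if even s then x else \<ominus>\<^bsub>A\<^esub> x)"

definition massey_deg :: "(nat \<Rightarrow> int) \<Rightarrow> nat \<Rightarrow> nat \<Rightarrow> int" where
  "massey_deg e i j = (\<Sum>k=i..j. e k) - (int j - int i)"

definition massey_sum ::
  "('a, 'b) dga_scheme \<Rightarrow> (nat \<Rightarrow> int) \<Rightarrow> (nat \<Rightarrow> nat \<Rightarrow> 'a) \<Rightarrow> nat \<Rightarrow> nat \<Rightarrow> 'a" where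
  "massey_sum A e a i j =
     (\<Oplus>\<^bsub>A\<^esub>r\<in>{i..<j}. signed A (massey_deg e i r + 1) (a i r) \<otimes>\<^bsub>A\<^esub> a (Suc r) j)"

text \<open>Here \<open>\<alpha> 1, \<dots>, \<alpha> n\<close> are homology classes of degrees \<open>e 1, \<dots>, e n\<close>.\<close>

definition defining_system ::
  "('a, 'b) dga_scheme \<Rightarrow> nat \<Rightarrow> (nat \<Rightarrow> int) \<Rightarrow> (nat \<Rightarrow> 'a set) \<Rightarrow> (nat \<Rightarrow> nat \<Rightarrow> 'a) \<Rightarrow> bool" where
  "defining_system A n e \<alpha> a \<longleftrightarrow>
     (\<forall>i\<in>{1..n}. a i i \<in> \<alpha> i) \<and>
     (\<forall>i j. 1 \<le> i \<and> i < j \<and> j \<le> n \<and> (i, j) \<noteq> (1, n) \<longrightarrow>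
        a i j \<in> gr A (massey_deg e i j) \<and> dff A (a i j) = massey_sum A e a i j)"

definition massey_product ::
  "('a, 'b) dga_scheme \<Rightarrow> nat \<Rightarrow> (nat \<Rightarrow> int) \<Rightarrow> (nat \<Rightarrow> 'a set) \<Rightarrow> 'a set set" where
  "massey_product A n e \<alpha> =
     {hclass A (massey_deg e 1 n + 1) (massey_sum A e a 1 n) | a. defining_system A n e \<alpha> a}"

text \<open>A Massey product is a set of homology classes, empty if the product is not defined. It is
  trivial if it contains the zero class. The zero class of degree \<open>n\<close> is \<open>coboundaries A n\<close>.\<close>

definition trivial_products :: "('a, 'b) dga_scheme \<Rightarrow> bool" where
  "trivial_products A \<longleftrightarrow>
     (\<forall>i j. \<forall>\<alpha> \<in> homology A i. \<forall>\<beta> \<in> homology A j. 0 < i \<and> 0 < j \<longrightarrow>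
        (\<forall>x\<in>\<alpha>. \<forall>y\<in>\<beta>. hclass A (i + j) (x \<otimes>\<^bsub>A\<^esub> y) = coboundaries A (i + j)))"

definition trivial_massey_products :: "('a, 'b) dga_scheme \<Rightarrow> bool" where
  "trivial_massey_products A \<longleftrightarrow>
     (\<forall>n e \<alpha>. 3 \<le> n \<and> (\<forall>k\<in>{1..n}. 0 < e k \<and> \<alpha> k \<in> homology A (e k)) \<and>
        massey_product A n e \<alpha> \<noteq> {} \<longrightarrow>
        coboundaries A (massey_deg e 1 n + 1) \<in> massey_product A n e \<alpha>)"


section \<open>Stanley-Reisner rings and the Koszul algebra\<close>

type_synonym 'k mpoly = "(nat \<Rightarrow>\<^sub>0 nat) \<Rightarrow>\<^sub>0 'k"

definition poly_ring :: "nat \<Rightarrow> 'k::comm_ring_1 mpoly ring" where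
  "poly_ring m =
     \<lparr>carrier = {f. \<forall>a\<in>Poly_Mapping.keys f. Poly_Mapping.keys a \<subseteq> {1..m}},
      monoid.mult = (*), one = 1, zero = 0, add = (+)\<rparr>"

lemma cring_poly_ring: "cring (poly_ring m :: 'k::comm_ring_1 mpoly ring)"
proof (rule cringI)
  show "abelian_group (poly_ring m :: 'k mpoly ring)"
  proof (rule abelian_groupI)
    fix f :: "'k mpoly" assume "f \<in> carrier (poly_ring m)"
    then show "\<exists>g\<in>carrier (poly_ring m). g \<oplus>\<^bsub>poly_ring m\<^esub> f = \<zero>\<^bsub>poly_ring m\<^esub>"
      by (intro bexI[of _ "- f"]) (auto simp: poly_ring_def)
  qed (auto simp: poly_ring_def add.assoc add.commute dest!: subsetD[OF keys_add])
  show "comm_monoid (poly_ring m :: 'k mpoly ring)"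
  proof (rule comm_monoidI)
    fix f g :: "'k mpoly" assume "f \<in> carrier (poly_ring m)" "g \<in> carrier (poly_ring m)"
    then show "f \<otimes>\<^bsub>poly_ring m\<^esub> g \<in> carrier (poly_ring m)"
      by (auto simp: poly_ring_def dest!: subsetD[OF keys_mult] subsetD[OF keys_add])
  qed (auto simp: poly_ring_def mult.assoc mult.commute)
qed (auto simp: poly_ring_def distrib_right)

definition var :: "nat \<Rightarrow> 'k::comm_ring_1 mpoly" where
  "var i = Poly_Mapping.single (Poly_Mapping.single i 1) 1"

text \<open>Homogeneous polynomials, where every variable has degree 2.\<close>

definition poly_gr :: "nat \<Rightarrow> int \<Rightarrow> 'k::comm_ring_1 mpoly set" where
  "poly_gr m n =
     {f \<in> carrier (poly_ring m).
        \<forall>a\<in>Poly_Mapping.keys f. int (\<Sum>i\<in>{1..m}. 2 * Poly_Mapping.lookup a i) = n}"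

definition sr_ideal :: "nat \<Rightarrow> nat set set \<Rightarrow> 'k::comm_ring_1 mpoly set" where
  "sr_ideal m K = Idl\<^bsub>poly_ring m\<^esub> {\<Prod>i\<in>\<sigma>. var i | \<sigma>. \<sigma> \<subseteq> {1..m} \<and> \<sigma> \<notin> K}"

lemma ideal_sr_ideal: "ideal (sr_ideal m K :: 'k::comm_ring_1 mpoly set) (poly_ring m)"
proof -
  have "(\<Prod>i\<in>\<sigma>. var i :: 'k mpoly) \<in> carrier (poly_ring m)" if "\<sigma> \<subseteq> {1..m}" for \<sigma>
  proof -
    have "finite \<sigma>" using that finite_subset by blast
    then show ?thesis using that
    proof (induction \<sigma>)
      case empty
      then show ?case by (auto simp: poly_ring_def)
    next
      case (insert i \<sigma>)
      have "var i \<in> carrier (poly_ring m :: 'k mpoly ring)"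
        using insert.prems by (auto simp: poly_ring_def var_def)
      then have "var i * (\<Prod>i\<in>\<sigma>. var i :: 'k mpoly) \<in> carrier (poly_ring m)"
        using insert cring.cring_simprules(5)[OF cring_poly_ring, of "var i" m "\<Prod>i\<in>\<sigma>. var i :: 'k mpoly"]
        by (simp add: poly_ring_def)
      then show ?case using insert by simp
    qed
  qed
  then show ?thesis
    unfolding sr_ideal_def
    by (intro ring.genideal_ideal cring.axioms(1) cring_poly_ring) auto
qed

definition sr_ring :: "nat \<Rightarrow> nat set set \<Rightarrow> 'k::comm_ring_1 mpoly set ring" where
  "sr_ring m K = poly_ring m Quot sr_ideal m K"

lemma cring_sr_ring: "cring (sr_ring m K :: 'k::comm_ring_1 mpoly set ring)"
  unfolding sr_ring_def by (intro ideal.quotient_is_cring ideal_sr_ideal cring_poly_ring)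

definition sr_class :: "nat \<Rightarrow> nat set set \<Rightarrow> 'k::comm_ring_1 mpoly \<Rightarrow> 'k mpoly set" where
  "sr_class m K f = sr_ideal m K +>\<^bsub>poly_ring m\<^esub> f"

definition sr_gr :: "nat \<Rightarrow> nat set set \<Rightarrow> int \<Rightarrow> 'k::comm_ring_1 mpoly set set" where
  "sr_gr m K n = sr_class m K ` poly_gr m n"

text \<open>The Koszul algebra \<open>\<Lambda>(u\<^sub>1, \<dots>, u\<^sub>m) \<otimes> k[K]\<close> is the free \<open>k[K]\<close>-module on the monomials
  \<open>u\<^sub>L = u\<^sub>i \<and> \<dots> \<and> u\<^sub>j\<close>, where \<open>L = {i < \<dots> < j}\<close> is a subset of \<open>{1..m}\<close>. An element is the
  function sending \<open>L\<close> to the coefficient of \<open>u\<^sub>L\<close>. We have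
  \<open>u\<^sub>I u\<^sub>J = shuffle_sign I J \<cdot> u\<^sub>I\<^sub>\<union>\<^sub>J\<close> for disjoint \<open>I\<close> and \<open>J\<close>, the degree of \<open>u\<^sub>i\<close> is 1, and the
  differential is the \<open>k[K]\<close>-linear antiderivation with \<open>u\<^sub>i \<mapsto> v\<^sub>i\<close>.\<close>

definition ring_sign :: "('a, 'b) ring_scheme \<Rightarrow> nat \<Rightarrow> 'a" where
  "ring_sign R s = (if even s then \<one>\<^bsub>R\<^esub> else \<ominus>\<^bsub>R\<^esub> \<one>\<^bsub>R\<^esub>)"

definition shuffle_sign :: "('a, 'b) ring_scheme \<Rightarrow> nat set \<Rightarrow> nat set \<Rightarrow> 'a" where
  "shuffle_sign R I J = ring_sign R (card {(i, j). i \<in> I \<and> j \<in> J \<and> j < i})"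

definition koszul_dga ::
  "nat \<Rightarrow> nat set set \<Rightarrow> (nat set \<Rightarrow> 'k::comm_ring_1 mpoly set) dga" where
  "koszul_dga m K =
     (let R = sr_ring m K in
      \<lparr>carrier = Pow {1..m} \<rightarrow>\<^sub>E carrier R,
       monoid.mult = (\<lambda>f g. \<lambda>L\<in>Pow {1..m}.
          \<Oplus>\<^bsub>R\<^esub>I\<in>Pow L. shuffle_sign R I (L - I) \<otimes>\<^bsub>R\<^esub> (f I \<otimes>\<^bsub>R\<^esub> g (L - I))),
       one = (\<lambda>L\<in>Pow {1..m}. if L = {} then \<one>\<^bsub>R\<^esub> else \<zero>\<^bsub>R\<^esub>),
       zero = (\<lambda>L\<in>Pow {1..m}. \<zero>\<^bsub>R\<^esub>),
       add = (\<lambda>f g. \<lambda>L\<in>Pow {1..m}. f L \<oplus>\<^bsub>R\<^esub> g L),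
       gr = (\<lambda>n. {f \<in> Pow {1..m} \<rightarrow>\<^sub>E carrier R. \<forall>L\<in>Pow {1..m}. f L \<in> sr_gr m K (n - int (card L))}),
       dff = (\<lambda>f. \<lambda>L\<in>Pow {1..m}.
          \<Oplus>\<^bsub>R\<^esub>i\<in>{1..m} - L.
            shuffle_sign R {i} L \<otimes>\<^bsub>R\<^esub> (sr_class m K (var i) \<otimes>\<^bsub>R\<^esub> f (insert i L)))\<rparr>)"

text \<open>The first argument fixes the coefficient ring. The homology of the Koszul algebra is
  \<open>Tor\<close>, graded by total degree.\<close>

definition golod :: "'k::comm_ring_1 itself \<Rightarrow> nat \<Rightarrow> nat set set \<Rightarrow> bool" where
  "golod (_ :: 'k itself) m K \<longleftrightarrow>
     trivial_products (koszul_dga m K :: (nat set \<Rightarrow> 'k mpoly set) dga) \<and>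
     trivial_massey_products (koszul_dga m K :: (nat set \<Rightarrow> 'k mpoly set) dga)"

end

theory Submission
  imports Defs
begin

text \<open>Put \<open>n = 2 p + 1\<close>. Divide a disc with \<open>p n\<close> boundary vertices into
  \<open>n\<close> sectors, each cut into one triangle at the centre \<open>c\<close> and a fan of
  \<open>p - 1\<close> further triangles. Labelling the boundary vertices modulo \<open>n\<close> gives a
  triangulation \<open>K0\<close> of the Moore space in which any two vertices are joined by an edge. The
  complex \<open>K\<close> arises from it by subdividing one triangle \<open>c, V 0, V p\<close> at its
  barycentre \<open>a\<close>, so that every missing edge of \<open>K\<close> contains \<open>a\<close>.

  The squarefree part of the Koszul complex in the top multidegree computes the cohomology of
  \<open>K\<close>. The oriented sum of the facets has as its boundary \<open>p\<close> times the circle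
  of the Moore space, hence is a cycle modulo \<open>p\<close>. It does not vanish on the product of the
  class of the disconnected full subcomplex on \<open>a\<close> and the vertices outside the triangle
  with the class of the empty triangle \<open>c, V 0, V p\<close>, so this product is not zero.

  If \<open>p\<close> is invertible, every 2-cochain of \<open>K\<close> and of its full subcomplexes is
  a coboundary. Filter the Koszul algebra by polynomial degree. Every class of positive degree is
  represented by a cocycle whose terms have degree at least 2, or degree 1 and exterior factor
  \<open>u\<^sub>a\<close>. Products of such cocycles have degree at least 3, and cocycles of degree at
  least 3 bound elements of degree at least 2. Recursively, defining systems of Massey products can be
  chosen with all later entries of degree at least 2, and then the Massey products vanish.\<close>

section \<open>The Koszul algebra of the polynomial ring\<close>

text \<open>The subdivision is what separates the two rings. In \<open>K0\<close> every nonempty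
  full subcomplex is connected. A product of positive-degree classes combines the cohomology of full
  subcomplexes on disjoint vertex sets and raises the degree by one more, so in \<open>K0\<close> it
  would land in degree at least 3 and vanishes over every ring. The vertex \<open>a\<close> makes
  room for a product of degrees 0 and 1, with values in H^2 of \<open>K\<close>, which is 0 over the
  rationals and Z/p over Z/p. That all missing edges share \<open>a\<close> keeps the rational side
  under control: two monomials with exterior factor \<open>u_a\<close> multiply to 0, so products of
  two terms of degree 1 disappear. The number n = 2p + 1 serves twice. The differences 1, ..., p and
  their negatives are exactly the nonzero residues modulo n, so all chords occur. And 2p = -1 makes
  p a unit modulo n, so the sectors, which start at the multiples of p, meet every residue
  once.\<close>

definition sgn_shuffle :: "nat set \<Rightarrow> nat set \<Rightarrow> 'a::comm_ring_1" where
  "sgn_shuffle I J = (- 1) ^ card {(i, j). i \<in> I \<and> j \<in> J \<and> j < i}"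

lemma sgn_shuffle_sq [simp]:
  "sgn_shuffle I J * sgn_shuffle I J = 1" "sgn_shuffle I J * (sgn_shuffle I J * x) = x"
  by (simp_all add: sgn_shuffle_def flip: power_add mult.assoc)

lemma sgn_shuffle_Un_left:
  assumes "finite I" "finite I'" "finite J" "I \<inter> I' = {}"
  shows "sgn_shuffle (I \<union> I') J = sgn_shuffle I J * sgn_shuffle I' J"
proof -
  have "finite {(i, j). i \<in> X \<and> j \<in> J \<and> j < i}" if "finite X" for X :: "nat set"
    by (rule finite_subset[of _ "X \<times> J"]) (use that assms in auto)
  moreover have "{(i, j). i \<in> I \<union> I' \<and> j \<in> J \<and> j < i} =
      {(i, j). i \<in> I \<and> j \<in> J \<and> j < i} \<union> {(i, j). i \<in> I' \<and> j \<in> J \<and> j < i}" by auto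
  moreover have "{(i, j). i \<in> I \<and> j \<in> J \<and> j < i} \<inter> {(i, j). i \<in> I' \<and> j \<in> J \<and> j < i} = {}"
    using assms by auto
  ultimately show ?thesis
    using assms by (simp add: sgn_shuffle_def power_add card_Un_disjoint)
qed

lemma sgn_shuffle_Un_right:
  assumes "finite I" "finite J" "finite J'" "J \<inter> J' = {}"
  shows "sgn_shuffle I (J \<union> J') = sgn_shuffle I J * sgn_shuffle I J'"
proof -
  have "finite {(i, j). i \<in> I \<and> j \<in> X \<and> j < i}" if "finite X" for X :: "nat set"
    by (rule finite_subset[of _ "I \<times> X"]) (use that assms in auto)
  moreover have "{(i, j). i \<in> I \<and> j \<in> J \<union> J' \<and> j < i} =
      {(i, j). i \<in> I \<and> j \<in> J \<and> j < i} \<union> {(i, j). i \<in> I \<and> j \<in> J' \<and> j < i}" by auto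
  moreover have "{(i, j). i \<in> I \<and> j \<in> J \<and> j < i} \<inter> {(i, j). i \<in> I \<and> j \<in> J' \<and> j < i} = {}"
    using assms by auto
  ultimately show ?thesis
    using assms by (simp add: sgn_shuffle_def power_add card_Un_disjoint)
qed

text \<open>Every element of \<open>I\<close> lies either above or below \<open>i\<close>, so it is
  an inversion of exactly one of the two pairs.\<close>

lemma sgn_shuffle_swap:
  assumes "finite I" "i \<notin> I"
  shows "sgn_shuffle I {i} * sgn_shuffle {i} I = (- 1) ^ card I"
proof -
  have "card {(k, j). k \<in> I \<and> j \<in> {i} \<and> j < k} = card {k \<in> I. i < k}"
    by (rule bij_betw_same_card[of fst]) (auto simp: bij_betw_def inj_on_def image_iff)
  moreover have "card {(k, j). k \<in> {i} \<and> j \<in> I \<and> j < k} = card {j \<in> I. j < i}"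
    by (rule bij_betw_same_card[of snd]) (auto simp: bij_betw_def inj_on_def image_iff)
  moreover have "card {k \<in> I. i < k} + card {k \<in> I. k < i} = card ({k \<in> I. i < k} \<union> {k \<in> I. k < i})"
    using assms by (intro card_Un_disjoint[symmetric]) auto
  moreover have "{k \<in> I. i < k} \<union> {k \<in> I. k < i} = I" using assms nat_neq_iff by blast
  ultimately show ?thesis by (simp add: sgn_shuffle_def flip: power_add)
qed

lemma sgn_shuffle_single:
  "sgn_shuffle {i} {j} = (if j < i then - 1 else 1)"
proof -
  have "{(k, l). k \<in> {i} \<and> l \<in> {j} \<and> l < k} = (if j < i then {(i, j)} else {})" by auto
  then show ?thesis by (auto simp: sgn_shuffle_def)
qed

lemma sgn_shuffle_insert_left:
  assumes "finite I" "finite J" "i \<notin> I"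
  shows "sgn_shuffle (insert i I) J = sgn_shuffle {i} J * sgn_shuffle I J"
  using sgn_shuffle_Un_left[of "{i}" I J] assms by simp

lemma sgn_shuffle_insert_right:
  assumes "finite I" "finite J" "i \<notin> J"
  shows "sgn_shuffle I (insert i J) = sgn_shuffle I {i} * sgn_shuffle I J"
  using sgn_shuffle_Un_right[of I "{i}" J] assms by simp

text \<open>Polynomial lifts of elements of the Koszul algebra, as a type so that a type class
  supplies the algebra; the Stanley-Reisner relations enter later as a differential ideal. The index
  \<open>L\<close> runs over all sets of naturals. At an infinite \<open>L\<close> a product is a
  sum over the infinite set \<open>Pow L\<close>, hence 0, so there is no unit and the class is
  \<open>ring\<close> rather than \<open>ring_1\<close>.\<close>

typedef (overloaded) 'k kform = "UNIV :: (nat set \<Rightarrow> 'k mpoly) set" morphisms kcoeff Kform ..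

setup_lifting type_definition_kform

lemma kform_eqI: "(\<And>L. kcoeff f L = kcoeff g L) \<Longrightarrow> f = g"
  by transfer blast

instantiation kform :: (comm_ring_1) ring
begin

lift_definition zero_kform :: "'a kform" is "\<lambda>L. 0" .
lift_definition plus_kform :: "'a kform \<Rightarrow> 'a kform \<Rightarrow> 'a kform" is "\<lambda>f g L. f L + g L" .
lift_definition minus_kform :: "'a kform \<Rightarrow> 'a kform \<Rightarrow> 'a kform" is "\<lambda>f g L. f L - g L" .
lift_definition uminus_kform :: "'a kform \<Rightarrow> 'a kform" is "\<lambda>f L. - f L" .
lift_definition times_kform :: "'a kform \<Rightarrow> 'a kform \<Rightarrow> 'a kform"
  is "\<lambda>f g L. \<Sum>I\<in>Pow L. sgn_shuffle I (L - I) * (f I * g (L - I))" .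

instance
proof
  fix f g h :: "'a kform"
  show "f * g * h = f * (g * h)"
  proof (rule kform_eqI)
    fix L :: "nat set"
    show "kcoeff (f * g * h) L = kcoeff (f * (g * h)) L"
    proof (cases "finite L")
      case True
      have fin: "finite M" if "M \<subseteq> L" for M using True that finite_subset by blast
      have "kcoeff (f * g * h) L =
         (\<Sum>M\<in>Pow L. \<Sum>I\<in>Pow M. sgn_shuffle M (L - M) * sgn_shuffle I (M - I)
            * (kcoeff f I * kcoeff g (M - I) * kcoeff h (L - M)))"
        by (simp add: times_kform.rep_eq sum_distrib_left sum_distrib_right mult_ac)
      also have "\<dots> = (\<Sum>(M, I)\<in>(SIGMA M:Pow L. Pow M). sgn_shuffle M (L - M) * sgn_shuffle I (M - I)
            * (kcoeff f I * kcoeff g (M - I) * kcoeff h (L - M)))"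
        using True fin by (subst sum.Sigma) auto
      \<comment> \<open>Both sides sum over the ordered partitions of \<open>L\<close> into
        \<open>I\<close>, \<open>M - I\<close> and \<open>L - M\<close>; each sign splits into the
        inversion signs of the three pairs of blocks.\<close>
      also have "\<dots> = (\<Sum>(I, J)\<in>(SIGMA I:Pow L. Pow (L - I)). sgn_shuffle I (L - I) * sgn_shuffle J (L - I - J)
            * (kcoeff f I * kcoeff g J * kcoeff h (L - I - J)))"
      proof (rule sum.reindex_bij_witness[of _ "\<lambda>(I, J). (I \<union> J, I)" "\<lambda>(M, I). (I, M - I)"], goal_cases)
        case (5 x)
        then obtain M I where x: "x = (M, I)" "I \<subseteq> M" "M \<subseteq> L" by auto
        have s1: "L - I - (M - I) = L - M" using x by auto
        have s2: "L - I = (M - I) \<union> (L - M)" using x by auto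
        have s3: "M = I \<union> (M - I)" using x by auto
        have 1: "sgn_shuffle I (L - I) = (sgn_shuffle I (M - I) * sgn_shuffle I (L - M) :: 'a mpoly)"
          unfolding s2 by (rule sgn_shuffle_Un_right) (use x fin in auto)
        have 2: "sgn_shuffle M (L - M) = (sgn_shuffle I (L - M) * sgn_shuffle (M - I) (L - M) :: 'a mpoly)"
          by (subst s3, rule sgn_shuffle_Un_left) (use x fin in auto)
        show ?case unfolding x using s1 1 2 by (simp add: mult_ac)
      qed auto
      also have "\<dots> = (\<Sum>I\<in>Pow L. \<Sum>J\<in>Pow (L - I). sgn_shuffle I (L - I) * sgn_shuffle J (L - I - J)
            * (kcoeff f I * kcoeff g J * kcoeff h (L - I - J)))"
        using True fin by (subst sum.Sigma) auto
      also have "\<dots> = kcoeff (f * (g * h)) L"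
        by (simp add: times_kform.rep_eq sum_distrib_left sum_distrib_right mult_ac)
      finally show ?thesis .
    qed (simp add: times_kform.rep_eq)
  qed
  show "(f + g) * h = f * h + g * h" "f * (g + h) = f * g + f * h"
    by (rule kform_eqI, simp add: times_kform.rep_eq plus_kform.rep_eq distrib_left distrib_right sum.distrib)+
  show "f + g + h = f + (g + h)" by (rule kform_eqI) (simp add: plus_kform.rep_eq add.assoc)
  show "f + g = g + f" by (rule kform_eqI) (simp add: plus_kform.rep_eq add.commute)
  show "0 + f = f" by (rule kform_eqI) (simp add: plus_kform.rep_eq zero_kform.rep_eq)
  show "- f + f = 0" by (rule kform_eqI) (simp add: plus_kform.rep_eq zero_kform.rep_eq uminus_kform.rep_eq)
  show "f - g = f + - g"
    by (rule kform_eqI) (simp add: plus_kform.rep_eq minus_kform.rep_eq uminus_kform.rep_eq)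
qed

end

lemmas kform_rep_eqs = zero_kform.rep_eq plus_kform.rep_eq minus_kform.rep_eq uminus_kform.rep_eq

lift_definition kdiff :: "nat \<Rightarrow> 'k::comm_ring_1 kform \<Rightarrow> 'k kform"
  is "\<lambda>m f L. \<Sum>i\<in>{1..m} - L. sgn_shuffle {i} L * (var i * f (insert i L))" .

lemma kdiff_add: "kdiff m (f + g) = kdiff m f + kdiff m g"
  by (rule kform_eqI) (simp add: kdiff.rep_eq kform_rep_eqs algebra_simps sum.distrib)

lemma kdiff_zero [simp]: "kdiff m 0 = 0"
  by (rule kform_eqI) (simp add: kdiff.rep_eq kform_rep_eqs )

lemma kdiff_minus: "kdiff m (- f) = - kdiff m f"
  by (rule kform_eqI) (simp add: kdiff.rep_eq kform_rep_eqs sum_negf)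

text \<open>Stated for arbitrary \<open>L\<close>: only the finitely many elements below
  \<open>j\<close> count, and the squared differential is evaluated at infinite \<open>L\<close> as
  well.\<close>

lemma sgn_shuffle_single_insert:
  assumes "i \<noteq> j" "i \<notin> L" "j \<notin> L"
  shows "sgn_shuffle {j} (insert i L) = (sgn_shuffle {j} {i} * sgn_shuffle {j} L :: 'k::comm_ring_1)"
proof -
  have fin: "finite {(k, l). k \<in> {j} \<and> l \<in> M \<and> l < k}" for M
    by (rule finite_subset[of _ "{j} \<times> {..<j}"]) auto
  have eq: "{(k, l). k \<in> {j} \<and> l \<in> insert i L \<and> l < k} =
      {(k, l). k \<in> {j} \<and> l \<in> {i} \<and> l < k} \<union> {(k, l). k \<in> {j} \<and> l \<in> L \<and> l < k}"
    by blast
  have disj: "{(k, l). k \<in> {j} \<and> l \<in> {i} \<and> l < k} \<inter> {(k, l). k \<in> {j} \<and> l \<in> L \<and> l < k} = {}"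
    using assms by blast
  show ?thesis
    unfolding sgn_shuffle_def eq card_Un_disjoint[OF fin fin disj] power_add ..
qed

text \<open>The terms with \<open>i < j\<close> are matched with those with \<open>j < i\<close>.
  Arguing by pairs, instead of showing that the sum equals its negative, covers characteristic
  2.\<close>

lemma sum_antisym_pairs:
  fixes t :: "nat \<Rightarrow> nat \<Rightarrow> 'a::ab_group_add"
  assumes "finite A" "\<And>i j. i \<in> A \<Longrightarrow> j \<in> A \<Longrightarrow> i \<noteq> j \<Longrightarrow> t j i = - t i j"
  shows "(\<Sum>i\<in>A. \<Sum>j\<in>A - {i}. t i j) = 0"
proof -
  let ?P = "{(i, j) \<in> A \<times> A. i < j}" and ?Q = "{(i, j) \<in> A \<times> A. j < i}"
  have fin: "finite ?P" "finite ?Q" by (rule finite_subset[of _ "A \<times> A"]; use assms in auto)+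
  have "(\<Sum>i\<in>A. \<Sum>j\<in>A - {i}. t i j) = (\<Sum>(i, j)\<in>(SIGMA i:A. A - {i}). t i j)"
    using assms by (subst sum.Sigma) auto
  also have "(SIGMA i:A. A - {i}) = ?P \<union> ?Q" by auto
  also have "(\<Sum>(i, j)\<in>?P \<union> ?Q. t i j) = (\<Sum>(i, j)\<in>?P. t i j) + (\<Sum>(i, j)\<in>?Q. t i j)"
    using fin by (intro sum.union_disjoint) auto
  also have "(\<Sum>(i, j)\<in>?Q. t i j) = (\<Sum>(i, j)\<in>?P. t j i)"
    by (rule sum.reindex_bij_witness[of _ "\<lambda>(i, j). (j, i)" "\<lambda>(i, j). (j, i)"]) auto
  also have "\<dots> = (\<Sum>(i, j)\<in>?P. - t i j)"
    by (rule sum.cong[OF refl], clarify, rule assms(2)) auto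
  also have "\<dots> = - (\<Sum>(i, j)\<in>?P. t i j)"
    by (simp add: sum_negf case_prod_beta)
  finally show ?thesis by simp
qed

lemma kdiff_kdiff: "kdiff m (kdiff m f) = 0"
proof (rule kform_eqI)
  fix L
  define t where "t i j = sgn_shuffle {i} L * (sgn_shuffle {j} (insert i L)
     * (var i * var j * kcoeff f (insert i (insert j L))))" for i j
  have "kcoeff (kdiff m (kdiff m f)) L =
      (\<Sum>i\<in>{1..m} - L. \<Sum>j\<in>{1..m} - L - {i}. t i j)"
    unfolding kdiff.rep_eq sum_distrib_left t_def Diff_insert[where B = L]
  proof (intro sum.cong refl, goal_cases)
    case (1 i j)
    have "insert j (insert i L) = insert i (insert j L)" by blast
    then show ?case by (simp only: mult_ac)
  qed
  also have "\<dots> = 0"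
  proof (rule sum_antisym_pairs)
    fix i j assume "i \<in> {1..m} - L" "j \<in> {1..m} - L" "i \<noteq> j"
    then show "t j i = - t i j"
      by (auto simp: t_def sgn_shuffle_single_insert sgn_shuffle_single insert_commute mult_ac)
  qed simp
  finally show "kcoeff (kdiff m (kdiff m f)) L = kcoeff 0 L" by (simp add: zero_kform.rep_eq)
qed

text \<open>The variables have even degree, so the degree of \<open>x\<close> has the parity of the
  exterior length \<open>card L\<close>. The right-hand side has additional terms with overlapping
  exterior factors, which cancel.\<close>

lemma kdiff_leibniz:
  assumes x: "\<And>L. kcoeff x L \<noteq> 0 \<Longrightarrow> even (int (card L) - n)"
  shows "kdiff m (x * y) = kdiff m x * y + (if even n then x * kdiff m y else - (x * kdiff m y))"
proof (rule kform_eqI)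
  fix L
  define s :: "'a mpoly" where "s = (if even n then 1 else - 1)"
  have rhs: "kcoeff (kdiff m x * y + (if even n then x * kdiff m y else - (x * kdiff m y))) L =
      kcoeff (kdiff m x * y) L + s * kcoeff (x * kdiff m y) L"
    by (auto simp: s_def kform_rep_eqs)
  have sx: "(- 1) ^ card I * kcoeff x I = s * kcoeff x I" for I
    using x[of I] by (cases "kcoeff x I = 0") (auto simp: s_def minus_one_power_iff)
  show "kcoeff (kdiff m (x * y)) L =
      kcoeff (kdiff m x * y + (if even n then x * kdiff m y else - (x * kdiff m y))) L"
  proof (cases "finite L")
    case False
    then show ?thesis unfolding rhs by (simp add: kdiff.rep_eq times_kform.rep_eq)
  next
    case True
    have fin: "finite I" if "I \<subseteq> L" for I using True that finite_subset by blast
    define X where "X i I = sgn_shuffle {i} I * sgn_shuffle I (L - I)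
        * (var i * kcoeff x (insert i I) * kcoeff y (L - I))" for i I
    define Y where "Y i I = s * (sgn_shuffle I (L - I) * sgn_shuffle {i} (L - I)
        * (var i * kcoeff x I * kcoeff y (insert i (L - I))))" for i I
    have "kcoeff (kdiff m (x * y)) L = (\<Sum>i\<in>{1..m} - L. (\<Sum>I\<in>Pow L. X i I) + (\<Sum>I\<in>Pow L. Y i I))"
      unfolding kdiff.rep_eq
    proof (rule sum.cong[OF refl])
      fix i assume i: "i \<in> {1..m} - L"
      have "kcoeff (x * y) (insert i L) =
          (\<Sum>I\<in>Pow L \<union> insert i ` Pow L. sgn_shuffle I (insert i L - I) * (kcoeff x I * kcoeff y (insert i L - I)))"
        by (simp add: times_kform.rep_eq Pow_insert)
      also have "\<dots> = (\<Sum>I\<in>Pow L. sgn_shuffle I (insert i L - I) * (kcoeff x I * kcoeff y (insert i L - I)))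
          + (\<Sum>I\<in>insert i ` Pow L. sgn_shuffle I (insert i L - I) * (kcoeff x I * kcoeff y (insert i L - I)))"
        using True i by (intro sum.union_disjoint) auto
      also have "(\<Sum>I\<in>insert i ` Pow L. sgn_shuffle I (insert i L - I) * (kcoeff x I * kcoeff y (insert i L - I)))
         = (\<Sum>I\<in>Pow L. sgn_shuffle (insert i I) (L - I) * (kcoeff x (insert i I) * kcoeff y (L - I)))"
      proof (rule sum.reindex_cong[of "insert i"])
        show "inj_on (insert i) (Pow L)" using i by (auto simp: inj_on_def)
      next
        fix I assume "I \<in> Pow L"
        then have "insert i L - insert i I = L - I" using i by auto
        then show "sgn_shuffle (insert i I) (insert i L - insert i I)
            * (kcoeff x (insert i I) * kcoeff y (insert i L - insert i I)) =
           sgn_shuffle (insert i I) (L - I) * (kcoeff x (insert i I) * kcoeff y (L - I))" by simp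
      qed simp
      finally have eq: "sgn_shuffle {i} L * (var i * kcoeff (x * y) (insert i L)) =
         (\<Sum>I\<in>Pow L. sgn_shuffle {i} L * (var i * (sgn_shuffle I (insert i L - I) * (kcoeff x I * kcoeff y (insert i L - I)))))
         + (\<Sum>I\<in>Pow L. sgn_shuffle {i} L * (var i * (sgn_shuffle (insert i I) (L - I) * (kcoeff x (insert i I) * kcoeff y (L - I)))))"
        by (simp add: distrib_left sum_distrib_left)
      have "sgn_shuffle {i} L * (var i * (sgn_shuffle (insert i I) (L - I) * (kcoeff x (insert i I) * kcoeff y (L - I)))) = X i I"
        if "I \<in> Pow L" for I
      proof -
        have I: "finite I" "finite (L - I)" "i \<notin> I" using that i fin by auto
        have "L = I \<union> (L - I)" using that by auto
        then have 1: "sgn_shuffle {i} L = (sgn_shuffle {i} I * sgn_shuffle {i} (L - I) :: 'a mpoly)"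
          using I sgn_shuffle_Un_right[of "{i}" I "L - I"] by simp
        have 2: "sgn_shuffle (insert i I) (L - I) = (sgn_shuffle {i} (L - I) * sgn_shuffle I (L - I) :: 'a mpoly)"
          by (rule sgn_shuffle_insert_left) (use I in auto)
        show ?thesis unfolding 1 2 X_def by (simp add: mult_ac)
      qed
      moreover have "sgn_shuffle {i} L * (var i * (sgn_shuffle I (insert i L - I) * (kcoeff x I * kcoeff y (insert i L - I)))) = Y i I"
        if "I \<in> Pow L" for I
      proof -
        have I: "finite I" "finite (L - I)" "i \<notin> I" using that i fin by auto
        have "L = I \<union> (L - I)" using that by auto
        then have 1: "sgn_shuffle {i} L = (sgn_shuffle {i} I * sgn_shuffle {i} (L - I) :: 'a mpoly)"
          using I sgn_shuffle_Un_right[of "{i}" I "L - I"] by simp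
        have L: "insert i L - I = insert i (L - I)" using I by auto
        have 2: "sgn_shuffle I (insert i (L - I)) = (sgn_shuffle I {i} * sgn_shuffle I (L - I) :: 'a mpoly)"
          by (rule sgn_shuffle_insert_right) (use I i in auto)
        have "sgn_shuffle {i} L * (var i * (sgn_shuffle I (insert i L - I) * (kcoeff x I * kcoeff y (insert i L - I))))
          = (sgn_shuffle I {i} * sgn_shuffle {i} I * kcoeff x I) * (sgn_shuffle {i} (L - I) * sgn_shuffle I (L - I)
               * var i * kcoeff y (insert i (L - I)))"
          unfolding L 1 2 by (simp add: mult_ac)
        also have "\<dots> = Y i I"
          unfolding sgn_shuffle_swap[OF I(1,3)] sx Y_def by (simp add: mult_ac)
        finally show ?thesis .
      qed
      ultimately show "sgn_shuffle {i} L * (var i * kcoeff (x * y) (insert i L)) =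
          (\<Sum>I\<in>Pow L. X i I) + (\<Sum>I\<in>Pow L. Y i I)"
        unfolding eq by simp
    qed
    also have "\<dots> = (\<Sum>I\<in>Pow L. \<Sum>i\<in>{1..m} - L. X i I) + (\<Sum>I\<in>Pow L. \<Sum>i\<in>{1..m} - L. Y i I)"
      unfolding sum.distrib by (subst (1 2) sum.swap) (rule refl)
    finally have lhs: "kcoeff (kdiff m (x * y)) L = \<dots>" .
    \<comment> \<open>Here \<open>i\<close> is an exterior factor of both \<open>x\<close> and
      \<open>y\<close>. Such products are 0 on the left; on the right, removing \<open>i\<close>
      from \<open>x\<close> cancels removing it from \<open>y\<close>.\<close>
    have cancel: "(\<Sum>I\<in>Pow L. \<Sum>i\<in>{1..m} \<inter> (L - I). X i I) + (\<Sum>I\<in>Pow L. \<Sum>i\<in>{1..m} \<inter> I. Y i I) = 0"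
    proof -
      have "(\<Sum>I\<in>Pow L. \<Sum>i\<in>{1..m} \<inter> (L - I). X i I) = (\<Sum>(I, i)\<in>(SIGMA I:Pow L. {1..m} \<inter> (L - I)). X i I)"
        using True by (subst sum.Sigma) auto
      also have "\<dots> = (\<Sum>(I, i)\<in>(SIGMA I:Pow L. {1..m} \<inter> I). - Y i I)"
      proof (rule sum.reindex_bij_witness[of _ "\<lambda>(I, i). (I - {i}, i)" "\<lambda>(I, i). (insert i I, i)"], goal_cases)
        case (5 z)
        then obtain I i where z: "z = (I, i)" and I: "I \<subseteq> L" "i \<in> L" "i \<notin> I" by auto
        have f: "finite I" "finite (L - insert i I)" using I fin by auto
        have L: "L - I = insert i (L - insert i I)" using I by auto
        have 1: "sgn_shuffle I (insert i (L - insert i I)) = (sgn_shuffle I {i} * sgn_shuffle I (L - insert i I) :: 'a mpoly)"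
          by (rule sgn_shuffle_insert_right) (use f I in auto)
        have 2: "sgn_shuffle (insert i I) (L - insert i I) = (sgn_shuffle {i} (L - insert i I) * sgn_shuffle I (L - insert i I) :: 'a mpoly)"
          by (rule sgn_shuffle_insert_left) (use f I in auto)
        have "X i I = sgn_shuffle I {i} * sgn_shuffle {i} I * (sgn_shuffle I (L - insert i I) *
           (var i * kcoeff x (insert i I) * kcoeff y (insert i (L - insert i I))))"
          unfolding X_def L 1 by (simp add: mult_ac)
        also have "\<dots> = - ((- 1) ^ card (insert i I) * kcoeff x (insert i I)) * (sgn_shuffle I (L - insert i I) *
           (var i * kcoeff y (insert i (L - insert i I))))"
          unfolding sgn_shuffle_swap[OF f(1) I(3)] using f I by (simp add: mult_ac)
        also have "\<dots> = - Y i (insert i I)"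
          unfolding sx Y_def 2 by (simp add: mult_ac)
        finally show ?case by (simp add: z)
      qed auto
      also have "\<dots> = - (\<Sum>I\<in>Pow L. \<Sum>i\<in>{1..m} \<inter> I. Y i I)"
        using True fin by (subst sum.Sigma) (auto simp: sum_negf case_prod_beta)
      finally show ?thesis by simp
    qed
    have "kcoeff (kdiff m x * y) L = (\<Sum>I\<in>Pow L. \<Sum>i\<in>{1..m} - I. X i I)"
      by (simp add: times_kform.rep_eq kdiff.rep_eq sum_distrib_left sum_distrib_right X_def mult_ac)
    also have "\<dots> = (\<Sum>I\<in>Pow L. (\<Sum>i\<in>{1..m} - L. X i I) + (\<Sum>i\<in>{1..m} \<inter> (L - I). X i I))"
    proof (rule sum.cong[OF refl])
      fix I assume "I \<in> Pow L"
      then have "{1..m} - I = ({1..m} - L) \<union> ({1..m} \<inter> (L - I))" by auto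
      then show "(\<Sum>i\<in>{1..m} - I. X i I) = (\<Sum>i\<in>{1..m} - L. X i I) + (\<Sum>i\<in>{1..m} \<inter> (L - I). X i I)"
        by (simp, subst sum.union_disjoint) auto
    qed
    finally have 1: "kcoeff (kdiff m x * y) L = \<dots>" .
    have "s * kcoeff (x * kdiff m y) L = (\<Sum>I\<in>Pow L. \<Sum>i\<in>{1..m} - (L - I). Y i I)"
      by (simp add: times_kform.rep_eq kdiff.rep_eq sum_distrib_left sum_distrib_right Y_def mult_ac)
    also have "\<dots> = (\<Sum>I\<in>Pow L. (\<Sum>i\<in>{1..m} - L. Y i I) + (\<Sum>i\<in>{1..m} \<inter> I. Y i I))"
    proof (rule sum.cong[OF refl])
      fix I assume I: "I \<in> Pow L"
      then have "{1..m} - (L - I) = ({1..m} - L) \<union> ({1..m} \<inter> I)" by auto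
      then show "(\<Sum>i\<in>{1..m} - (L - I). Y i I) = (\<Sum>i\<in>{1..m} - L. Y i I) + (\<Sum>i\<in>{1..m} \<inter> I. Y i I)"
        using I by (simp, subst sum.union_disjoint) auto
    qed
    finally have 2: "s * kcoeff (x * kdiff m y) L = \<dots>" .
    show ?thesis
      unfolding rhs lhs 1 2 sum.distrib using cancel by (simp add: algebra_simps)
  qed
qed

section \<open>Massey products modulo a differential ideal\<close>

definition twist :: "int \<Rightarrow> 'a::ab_group_add \<Rightarrow> 'a" where
  "twist n x = (if even n then x else - x)"

definition msum :: "(nat \<Rightarrow> int) \<Rightarrow> (nat \<Rightarrow> nat \<Rightarrow> 'a::ring) \<Rightarrow> nat \<Rightarrow> nat \<Rightarrow> 'a" where
  "msum e a i j = (\<Sum>r\<in>{i..<j}. twist (massey_deg e i r + 1) (a i r) * a (Suc r) j)"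

lemma massey_deg_refl [simp]: "massey_deg e i i = e i"
  by (simp add: massey_deg_def)

lemma massey_deg_split:
  assumes "i \<le> r" "r < j"
  shows "massey_deg e i j = massey_deg e i r + massey_deg e (Suc r) j - 1"
proof -
  have "{i..j} = {i..r} \<union> {Suc r..j}" using assms by auto
  then have "sum e {i..j} = sum e {i..r} + sum e {Suc r..j}"
    by (simp add: sum.union_disjoint)
  then show ?thesis by (simp add: massey_deg_def)
qed

lemma sum_triangle_swap:
  "(\<Sum>r\<in>{i..<j}. \<Sum>q\<in>{i..<r}. f q r) = (\<Sum>q\<in>{i..<j::nat}. \<Sum>r\<in>{Suc q..<j}. f q r)"
  by (subst (1 2) sum.Sigma, simp, simp, simp, simp,
      rule sum.reindex_bij_witness[of _ "\<lambda>(q, r). (r, q)" "\<lambda>(q, r). (r, q)"]) auto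

text \<open>The homology of the quotient by the differential ideal \<open>J\<close> is handled by
  lifts: a cocycle is an \<open>x\<close> with \<open>d x \<in> J\<close>, and \<open>z\<close> is a
  boundary if \<open>d w - z \<in> J\<close> for some \<open>w\<close>. The Leibniz rule and
  \<open>d (d x) = 0\<close> hold exactly, before passing to the quotient.\<close>

locale dg_ring_mod =
  fixes G :: "int \<Rightarrow> 'a::ring set" and J :: "'a set" and d :: "'a \<Rightarrow> 'a"
  assumes G_zero: "0 \<in> G n"
    and G_add: "x \<in> G n \<Longrightarrow> y \<in> G n \<Longrightarrow> x + y \<in> G n"
    and G_minus: "x \<in> G n \<Longrightarrow> - x \<in> G n"
    and G_mult: "x \<in> G i \<Longrightarrow> y \<in> G j \<Longrightarrow> x * y \<in> G (i + j)"
    and d_G: "x \<in> G n \<Longrightarrow> d x \<in> G (n + 1)"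
    and d_add: "d (x + y) = d x + d y"
    and d_d: "d (d x) = 0"
    and d_mult: "x \<in> G n \<Longrightarrow> d (x * y) = d x * y + twist n (x * d y)"
    and J_zero: "0 \<in> J"
    and J_add: "x \<in> J \<Longrightarrow> y \<in> J \<Longrightarrow> x + y \<in> J"
    and J_minus: "x \<in> J \<Longrightarrow> - x \<in> J"
    and J_mult_left: "x \<in> J \<Longrightarrow> y * x \<in> J"
    and J_mult_right: "x \<in> J \<Longrightarrow> x * y \<in> J"
    and d_J: "x \<in> J \<Longrightarrow> d x \<in> J"
begin

lemma d_zero: "d 0 = 0"
  using d_add[of 0 0] by simp

lemma d_minus: "d (- x) = - d x"
  using d_add[of x "- x"] d_zero by (simp add: eq_neg_iff_add_eq_0 add.commute)

lemma d_sum: "d (sum f A) = (\<Sum>x\<in>A. d (f x))"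
  by (induction A rule: infinite_finite_induct) (simp_all add: d_zero d_add)

lemma d_twist: "d (twist n x) = twist n (d x)"
  by (simp add: twist_def d_minus)

lemma J_diff: "x \<in> J \<Longrightarrow> y \<in> J \<Longrightarrow> x - y \<in> J"
  using J_add[of x "- y"] J_minus by simp

lemma J_sum: "(\<And>x. x \<in> A \<Longrightarrow> f x \<in> J) \<Longrightarrow> sum f A \<in> J"
  by (induction A rule: infinite_finite_induct) (simp_all add: J_zero J_add)

lemma J_twist: "x \<in> J \<Longrightarrow> twist n x \<in> J"
  by (simp add: twist_def J_minus)

lemma G_twist: "x \<in> G n \<Longrightarrow> twist k x \<in> G n"
  by (simp add: twist_def G_minus)

lemma G_sum: "(\<And>x. x \<in> A \<Longrightarrow> f x \<in> G n) \<Longrightarrow> sum f A \<in> G n"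
  by (induction A rule: infinite_finite_induct) (simp_all add: G_zero G_add)

lemma msum_G:
  assumes "\<And>r. i \<le> r \<Longrightarrow> r < j \<Longrightarrow> a i r \<in> G (massey_deg e i r) \<and> a (Suc r) j \<in> G (massey_deg e (Suc r) j)"
  shows "msum e a i j \<in> G (massey_deg e i j + 1)"
  unfolding msum_def
proof (rule G_sum)
  fix r assume r: "r \<in> {i..<j}"
  then have "twist (massey_deg e i r + 1) (a i r) * a (Suc r) j \<in> G (massey_deg e i r + massey_deg e (Suc r) j)"
    using assms by (intro G_mult G_twist) auto
  then show "twist (massey_deg e i r + 1) (a i r) * a (Suc r) j \<in> G (massey_deg e i j + 1)"
    using massey_deg_split[of i r j e] r by simp
qed

text \<open>The value of a Massey product is a cocycle. After replacing the differential of each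
  entry by its sum, every product \<open>a i q * a (Suc q) r * a (Suc r) j\<close> occurs twice,
  once from either factor, with opposite signs.\<close>

lemma d_msum:
  assumes "\<And>r. i \<le> r \<Longrightarrow> r < j \<Longrightarrow> a i r \<in> G (massey_deg e i r)"
    and "\<And>r. i \<le> r \<Longrightarrow> r < j \<Longrightarrow> d (a i r) - msum e a i r \<in> J"
    and "\<And>r. i \<le> r \<Longrightarrow> r < j \<Longrightarrow> d (a (Suc r) j) - msum e a (Suc r) j \<in> J"
  shows "d (msum e a i j) \<in> J"
proof -
  define D where "D = massey_deg e"
  let ?t = "\<lambda>r. twist (D i r + 1) (msum e a i r * a (Suc r) j) - a i r * msum e a (Suc r) j"
  have "d (msum e a i j) - (\<Sum>r\<in>{i..<j}. ?t r) \<in> J"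
    unfolding msum_def[of e a i j] d_sum sum_subtractf[symmetric] D_def[symmetric]
  proof (rule J_sum)
    fix r assume r: "r \<in> {i..<j}"
    have "d (twist (D i r + 1) (a i r) * a (Suc r) j) =
        twist (D i r + 1) (d (a i r) * a (Suc r) j) - a i r * d (a (Suc r) j)"
      using r assms(1) by (subst d_mult[of _ "D i r"]) (auto simp: D_def d_twist G_twist, auto simp: twist_def d_minus)
    then have "d (twist (D i r + 1) (a i r) * a (Suc r) j) - ?t r =
       twist (D i r + 1) ((d (a i r) - msum e a i r) * a (Suc r) j)
        - a i r * (d (a (Suc r) j) - msum e a (Suc r) j)"
      by (simp add: twist_def algebra_simps)
    also have "\<dots> \<in> J"
      using r assms by (intro J_diff[OF J_twist[OF J_mult_right] J_mult_left]) auto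
    finally show "d (twist (D i r + 1) (a i r) * a (Suc r) j) - ?t r \<in> J" .
  qed
  moreover have "(\<Sum>r\<in>{i..<j}. ?t r) = 0"
  proof -
    define T where "T q r = twist (D i r + D i q) (a i q * a (Suc q) r * a (Suc r) j)" for q r
    have "(\<Sum>r\<in>{i..<j}. twist (D i r + 1) (msum e a i r * a (Suc r) j)) = (\<Sum>r\<in>{i..<j}. \<Sum>q\<in>{i..<r}. T q r)"
      unfolding msum_def D_def[symmetric] T_def
      by (intro sum.cong refl)
        (simp add: twist_def sum_distrib_right, auto simp: sum_negf[symmetric] intro!: sum.cong)
    also have "\<dots> = (\<Sum>q\<in>{i..<j}. \<Sum>r\<in>{Suc q..<j}. T q r)"
      by (rule sum_triangle_swap)
    also have "\<dots> = (\<Sum>q\<in>{i..<j}. a i q * msum e a (Suc q) j)"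
    proof (rule sum.cong[OF refl])
      fix q assume q: "q \<in> {i..<j}"
      show "(\<Sum>r\<in>{Suc q..<j}. T q r) = a i q * msum e a (Suc q) j"
        unfolding msum_def sum_distrib_left
      proof (rule sum.cong[OF refl])
        fix r assume r: "r \<in> {Suc q..<j}"
        \<comment> \<open>By this shift the sign \<open>D i r + D i q\<close> depends only on the
          degree of the middle factor.\<close>
        have "D i r = D i q + D (Suc q) r - 1"
          unfolding D_def by (rule massey_deg_split) (use q r in auto)
        then show "T q r = a i q * (twist (massey_deg e (Suc q) r + 1) (a (Suc q) r) * a (Suc r) j)"
          unfolding T_def D_def[symmetric] by (auto simp: twist_def mult.assoc)
      qed
    qed
    finally show ?thesis by (simp add: sum_subtractf)
  qed
  ultimately show ?thesis by simp
qed

end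

text \<open>\<open>F2\<close> and \<open>F3\<close> play the role of filtration steps: products of elements of \<open>B\<close> lie in \<open>F3\<close>, and
  cocycles in \<open>F3\<close> bound elements of \<open>F2\<close>. So all entries off the diagonal of a defining system
  can be chosen in \<open>F2\<close>.\<close>

locale massey_trivial = dg_ring_mod G J d
  for G :: "int \<Rightarrow> 'a::ring set" and J :: "'a set" and d :: "'a \<Rightarrow> 'a" +
  fixes B F2 F3 :: "'a set"
  assumes F3_zero: "0 \<in> F3"
    and F3_add: "x \<in> F3 \<Longrightarrow> y \<in> F3 \<Longrightarrow> x + y \<in> F3"
    and B_minus: "x \<in> B \<Longrightarrow> - x \<in> B"
    and F2_B: "F2 \<subseteq> B"
    and B_mult: "x \<in> B \<Longrightarrow> y \<in> B \<Longrightarrow> x * y \<in> F3"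
    and exact: "z \<in> F3 \<Longrightarrow> z \<in> G n \<Longrightarrow> d z \<in> J \<Longrightarrow> \<exists>w\<in>F2 \<inter> G (n - 1). d w - z \<in> J"
    and represent: "z \<in> G n \<Longrightarrow> 0 < n \<Longrightarrow> d z \<in> J \<Longrightarrow> \<exists>b\<in>B \<inter> G n. \<exists>w\<in>G (n - 1). z - b - d w \<in> J"
begin

lemma cocycle_cong:
  assumes "x - y - d w \<in> J" "d x \<in> J"
  shows "d y \<in> J"
proof -
  have "d (x - y - d w) = d x - d y"
    using d_add[of "x - y" "- d w"] d_add[of x "- y"] by (simp add: d_minus d_d)
  then have "d x - d y \<in> J" using d_J[OF assms(1)] by simp
  then show ?thesis using J_diff[OF assms(2), of "d x - d y"] by simp
qed

text \<open>The classes are moved to representatives in \<open>B\<close>, whose product lies in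
  \<open>F3\<close> and therefore bounds.\<close>

lemma product_exact:
  assumes x: "x \<in> G i" "0 < i" "d x \<in> J" and y: "y \<in> G j" "0 < j" "d y \<in> J"
  shows "\<exists>w\<in>G (i + j - 1). d w - x * y \<in> J"
proof -
  obtain b w where b: "b \<in> B" "b \<in> G i" "w \<in> G (i - 1)" "x - b - d w \<in> J"
    using represent[OF x] by blast
  obtain b' w' where b': "b' \<in> B" "b' \<in> G j" "w' \<in> G (j - 1)" "y - b' - d w' \<in> J"
    using represent[OF y] by blast
  have db: "d b \<in> J" by (rule cocycle_cong[OF b(4) x(3)])
  have db': "d b' \<in> J" by (rule cocycle_cong[OF b'(4) y(3)])
  have "d (b * b') = d b * b' + twist i (b * d b')" by (rule d_mult) (rule b)
  then have "d (b * b') \<in> J"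
    using db db' by (simp add: J_add J_mult_left J_mult_right J_twist)
  then obtain u where u: "u \<in> G (i + j - 1)" "d u - b * b' \<in> J"
    using exact[OF B_mult[OF b(1) b'(1)] G_mult[OF b(2) b'(2)]] by blast
  \<comment> \<open>Modulo \<open>J\<close>, \<open>x * y - b * b'\<close> is
    \<open>b * d w' + d w * y\<close>; as \<open>b\<close> and \<open>y\<close> are cocycles, these
    are the boundaries of the two added terms.\<close>
  define v where "v = u + twist i (b * w') + w * y"
  have G: "b * w' \<in> G (i + j - 1)" "w * y \<in> G (i + j - 1)"
    using G_mult[OF b(2) b'(3)] G_mult[OF b(3) y(1)] by (simp_all add: algebra_simps)
  have "v \<in> G (i + j - 1)"
    unfolding v_def using u G by (intro G_add G_twist)
  moreover have "d v - x * y \<in> J"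
  proof -
    have 1: "d (twist i (b * w')) = twist i (d b * w') + b * d w'"
      unfolding d_twist d_mult[OF b(2)] by (simp add: twist_def)
    have 2: "d (w * y) = d w * y + twist (i - 1) (w * d y)"
      by (rule d_mult[OF b(3)])
    have "d v - x * y = (d u - b * b') + twist i (d b * w') + twist (i - 1) (w * d y)
        - (x - b - d w) * y - b * (y - b' - d w')"
      unfolding v_def d_add 1 2 by (simp add: algebra_simps)
    moreover have "\<dots> \<in> J"
      by (rule J_diff[OF J_diff[OF J_add[OF J_add[OF u(2) J_twist[OF J_mult_right[OF db]]]
            J_twist[OF J_mult_left[OF y(3)]]] J_mult_right[OF b(4)]] J_mult_left[OF b'(4)]])
    ultimately show ?thesis by simp
  qed
  ultimately show ?thesis by blast
qed

text \<open>The pair \<open>(1, n)\<close> is included: the entry there bounds the sum that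
  represents the Massey product.\<close>

lemma massey_exact:
  assumes x: "\<And>k. k \<in> {1..n} \<Longrightarrow> 0 < e k \<and> x k \<in> G (e k) \<and> d (x k) \<in> J"
  shows "\<exists>a. (\<forall>k\<in>{1..n}. \<exists>w\<in>G (e k - 1). a k k \<in> G (e k) \<and> x k - a k k - d w \<in> J) \<and>
    (\<forall>i j. 1 \<le> i \<and> i < j \<and> j \<le> n \<longrightarrow> a i j \<in> G (massey_deg e i j) \<and> d (a i j) - msum e a i j \<in> J)"
proof -
  have "\<exists>b w. b \<in> B \<inter> G (e k) \<and> w \<in> G (e k - 1) \<and> x k - b - d w \<in> J" if "k \<in> {1..n}" for k
    using represent[of "x k" "e k"] x[OF that] by blast
  then obtain b w where bw: "\<And>k. k \<in> {1..n} \<Longrightarrow> b k \<in> B \<inter> G (e k) \<and> w k \<in> G (e k - 1) \<and> x k - b k - d (w k) \<in> J"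
    by metis
  have db: "d (b k) \<in> J" if "k \<in> {1..n}" for k
    using cocycle_cong bw[OF that] x[OF that] by blast
  define ok where "ok a i j \<longleftrightarrow> a i j \<in> F2 \<inter> G (massey_deg e i j) \<and> d (a i j) - msum e a i j \<in> J" for a i j
  \<comment> \<open>Entries are chosen by increasing \<open>j - i\<close>, all of the same length at
    once; \<open>l\<close> is a strict bound for the lengths treated so far.\<close>
  have "\<exists>a. (\<forall>k. a k k = b k) \<and> (\<forall>i j. 1 \<le> i \<and> i < j \<and> j \<le> n \<and> j - i < l \<longrightarrow> ok a i j)" for l
  proof (induction l)
    case 0
    show ?case by (rule exI[of _ "\<lambda>i j. b i"]) simp
  next
    case (Suc l)
    then obtain a where a: "\<And>k. a k k = b k"
      "\<And>i j. 1 \<le> i \<Longrightarrow> i < j \<Longrightarrow> j \<le> n \<Longrightarrow> j - i < l \<Longrightarrow> ok a i j" by blast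
    have inB: "a i j \<in> B \<inter> G (massey_deg e i j) \<and> d (a i j) - msum e a i j \<in> J"
      if "1 \<le> i" "i \<le> j" "j \<le> n" "j - i < l" for i j
    proof (cases "i = j")
      case True
      then show ?thesis using that bw[of i] db[of i] a(1)[of i] by (auto simp: msum_def)
    next
      case False
      then show ?thesis using that a(2)[of i j] F2_B by (auto simp: ok_def)
    qed
    have "\<exists>c. c \<in> F2 \<inter> G (massey_deg e i j) \<and> d c - msum e a i j \<in> J"
      if ij: "1 \<le> i" "i < j" "j \<le> n" "j - i = l" for i j
    proof -
      have 1: "a i r \<in> B \<inter> G (massey_deg e i r) \<and> d (a i r) - msum e a i r \<in> J"
        and 2: "a (Suc r) j \<in> B \<inter> G (massey_deg e (Suc r) j) \<and> d (a (Suc r) j) - msum e a (Suc r) j \<in> J"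
        if "i \<le> r" "r < j" for r
        using that ij inB[of i r] inB[of "Suc r" j] by auto
      have "d (msum e a i j) \<in> J"
        by (rule d_msum) (use 1 2 in auto)
      moreover have "msum e a i j \<in> G (massey_deg e i j + 1)"
        by (rule msum_G) (use 1 2 in auto)
      moreover have "msum e a i j \<in> F3"
      proof -
        have sumF3: "sum f A \<in> F3" if "\<And>r. r \<in> A \<Longrightarrow> f r \<in> F3" for f :: "nat \<Rightarrow> 'a" and A
          using that by (induction A rule: infinite_finite_induct) (simp_all add: F3_zero F3_add)
        have tw: "twist k (a i r) \<in> B" if "i \<le> r" "r < j" for r k
          using 1[OF that] by (simp add: twist_def B_minus)
        show ?thesis
          unfolding msum_def by (rule sumF3, rule B_mult) (use tw 2 in auto)
      qed
      ultimately obtain c where "c \<in> F2 \<inter> G (massey_deg e i j + 1 - 1)" "d c - msum e a i j \<in> J"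
        using exact by blast
      then show ?thesis by auto
    qed
    then obtain c where c: "\<And>i j. 1 \<le> i \<Longrightarrow> i < j \<Longrightarrow> j \<le> n \<Longrightarrow> j - i = l \<Longrightarrow>
        c i j \<in> F2 \<inter> G (massey_deg e i j) \<and> d (c i j) - msum e a i j \<in> J"
      by metis
    \<comment> \<open>Only entries of length \<open>l\<close> change, while sums of length at most
      \<open>l\<close> involve shorter entries only.\<close>
    define a' where "a' i j = (if i < j \<and> j - i = l then c i j else a i j)" for i j
    have "msum e a' i j = msum e a i j" if "j - i \<le> l" for i j
      unfolding msum_def by (rule sum.cong[OF refl]) (use that in \<open>auto simp: a'_def\<close>)
    then have "ok a' i j" if "1 \<le> i" "i < j" "j \<le> n" "j - i < Suc l" for i j
      using that a(2)[of i j] c[of i j] by (cases "j - i = l") (auto simp: ok_def a'_def)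
    moreover have "a' k k = b k" for k using a(1) by (simp add: a'_def)
    ultimately show ?case by blast
  qed
  from this[of n] obtain a where a: "\<And>k. a k k = b k"
    "\<And>i j. 1 \<le> i \<Longrightarrow> i < j \<Longrightarrow> j \<le> n \<Longrightarrow> j - i < n \<Longrightarrow> ok a i j" by blast
  show ?thesis
  proof (intro exI[of _ a] conjI ballI allI impI; (elim conjE)?)
    fix k assume "k \<in> {1..n}"
    then show "\<exists>w\<in>G (e k - 1). a k k \<in> G (e k) \<and> x k - a k k - d w \<in> J"
      using bw[of k] a(1)[of k] by auto
  next
    fix i j assume "1 \<le> i" "i < j" "j \<le> n"
    then have "ok a i j" using a(2)[of i j] by auto
    then show "a i j \<in> G (massey_deg e i j)" "d (a i j) - msum e a i j \<in> J"
      by (auto simp: ok_def)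
  qed
qed

end

section \<open>Subspaces spanned by monomials\<close>

lemma lookup_sgn_mult:
  "Poly_Mapping.lookup (sgn_shuffle I J * f) \<alpha> = sgn_shuffle I J * Poly_Mapping.lookup (f :: 'k::comm_ring_1 mpoly) \<alpha>"
  by (simp add: sgn_shuffle_def minus_one_power_iff)

lemma lookup_var_mult:
  fixes f :: "'k::comm_ring_1 mpoly"
  shows "Poly_Mapping.lookup (var i * f) \<alpha> = (if Poly_Mapping.lookup \<alpha> i = 0 then 0 else Poly_Mapping.lookup f (\<alpha> - Poly_Mapping.single i 1))"
proof -
  define e :: "nat \<Rightarrow>\<^sub>0 nat" where "e = Poly_Mapping.single i 1"
  have "Poly_Mapping.lookup (var i * f) \<alpha> = (\<Sum>l. (1 when e = l) * (\<Sum>q. Poly_Mapping.lookup f q when \<alpha> = l + q))"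
    unfolding lookup_mult by (simp add: var_def e_def lookup_single)
  also have "\<dots> = (\<Sum>l. (\<Sum>q. Poly_Mapping.lookup f q when \<alpha> = e + q) when l = e)"
    by (rule Sum_any.cong) (simp add: when_def)
  also have "\<dots> = (\<Sum>q. Poly_Mapping.lookup f q when \<alpha> = e + q)" by simp
  also have "\<dots> = (if Poly_Mapping.lookup \<alpha> i = 0 then 0 else Poly_Mapping.lookup f (\<alpha> - e))"
  proof (cases "Poly_Mapping.lookup \<alpha> i = 0")
    case True
    then have "\<alpha> \<noteq> e + q" for q by (auto simp: e_def lookup_add)
    then show ?thesis using True by simp
  next
    case False
    then have "\<alpha> = e + q \<longleftrightarrow> q = \<alpha> - e" for q
      by (auto simp: poly_mapping_eq_iff fun_eq_iff e_def lookup_add lookup_minus lookup_single when_def)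
    then show ?thesis using False by simp
  qed
  finally show ?thesis by (simp add: e_def)
qed

text \<open>The span of the monomials \<open>u_L v^\<alpha>\<close> with
  \<open>Q L \<alpha>\<close>. Carrier, grading, filtration and the Stanley-Reisner part are all of
  this shape, so closure under sums, products and \<open>kdiff\<close> becomes a condition on
  monomials.\<close>

definition kspan :: "(nat set \<Rightarrow> (nat \<Rightarrow>\<^sub>0 nat) \<Rightarrow> bool) \<Rightarrow> 'k::comm_ring_1 kform set" where
  "kspan Q = {f. \<forall>L \<alpha>. Poly_Mapping.lookup (kcoeff f L) \<alpha> \<noteq> 0 \<longrightarrow> Q L \<alpha>}"

lemma kspanI: "(\<And>L \<alpha>. Poly_Mapping.lookup (kcoeff f L) \<alpha> \<noteq> 0 \<Longrightarrow> Q L \<alpha>) \<Longrightarrow> f \<in> kspan Q"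
  by (simp add: kspan_def)

lemma kspanD: "f \<in> kspan Q \<Longrightarrow> Poly_Mapping.lookup (kcoeff f L) \<alpha> \<noteq> 0 \<Longrightarrow> Q L \<alpha>"
  by (simp add: kspan_def)

lemma kspan_mono: "f \<in> kspan P \<Longrightarrow> (\<And>L \<alpha>. P L \<alpha> \<Longrightarrow> Q L \<alpha>) \<Longrightarrow> f \<in> kspan Q"
  by (auto simp: kspan_def)

lemma kspan_zero: "0 \<in> kspan Q"
  by (simp add: kspan_def kform_rep_eqs)

lemma kspan_add: "f \<in> kspan Q \<Longrightarrow> g \<in> kspan Q \<Longrightarrow> f + g \<in> kspan Q"
  by (auto simp: kspan_def kform_rep_eqs lookup_add) (metis add_0)

lemma kspan_minus: "f \<in> kspan Q \<Longrightarrow> - f \<in> kspan Q"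
  by (simp add: kspan_def kform_rep_eqs)

lemma kspan_diff: "f \<in> kspan Q \<Longrightarrow> g \<in> kspan Q \<Longrightarrow> f - g \<in> kspan Q"
  using kspan_add[of f Q "- g"] kspan_minus[of g Q] by simp

lemma kspan_mult:
  assumes f: "f \<in> kspan P" and g: "g \<in> kspan Q"
    and R: "\<And>I L \<alpha> \<beta>. finite L \<Longrightarrow> I \<subseteq> L \<Longrightarrow> P I \<alpha> \<Longrightarrow> Q (L - I) \<beta> \<Longrightarrow> R L (\<alpha> + \<beta>)"
  shows "f * g \<in> kspan R"
proof (rule kspanI)
  fix L \<gamma> assume *: "Poly_Mapping.lookup (kcoeff (f * g) L) \<gamma> \<noteq> 0"
  then obtain I where I: "I \<in> Pow L" "Poly_Mapping.lookup (kcoeff f I * kcoeff g (L - I)) \<gamma> \<noteq> 0"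
    unfolding times_kform.rep_eq lookup_sum lookup_sgn_mult
    by (metis (no_types, lifting) mult_zero_right sum.not_neutral_contains_not_neutral)
  then have "\<gamma> \<in> Poly_Mapping.keys (kcoeff f I * kcoeff g (L - I))" by (simp add: in_keys_iff)
  then obtain \<alpha> \<beta> where "\<gamma> = \<alpha> + \<beta>" "\<alpha> \<in> Poly_Mapping.keys (kcoeff f I)" "\<beta> \<in> Poly_Mapping.keys (kcoeff g (L - I))"
    using keys_mult by blast
  moreover have "finite L"
  proof (rule ccontr)
    assume "infinite L"
    then have "kcoeff (f * g) L = 0" by (simp add: times_kform.rep_eq)
    then show False using * by simp
  qed
  ultimately show "R L \<gamma>"
    using I(1) R kspanD[OF f] kspanD[OF g] by (auto simp: in_keys_iff)
qed

lemma lookup_kdiff: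
  "Poly_Mapping.lookup (kcoeff (kdiff m f) L) \<alpha> = (\<Sum>i\<in>{i \<in> {1..m} - L. Poly_Mapping.lookup \<alpha> i \<noteq> 0}.
     sgn_shuffle {i} L * Poly_Mapping.lookup (kcoeff f (insert i L)) (\<alpha> - Poly_Mapping.single i 1))"
  unfolding kdiff.rep_eq lookup_sum lookup_sgn_mult lookup_var_mult
  by (rule sum.mono_neutral_cong_right) auto

lemma single_plus_minus:
  assumes "Poly_Mapping.lookup \<alpha> i \<noteq> (0::nat)"
  shows "\<alpha> - Poly_Mapping.single i 1 + Poly_Mapping.single i 1 = \<alpha>"
  using assms
  by (auto simp: poly_mapping_eq_iff fun_eq_iff lookup_add lookup_minus lookup_single when_def)

lemma kspan_kdiff:
  assumes f: "f \<in> kspan P"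
    and R: "\<And>i L \<alpha>. i \<in> {1..m} \<Longrightarrow> i \<notin> L \<Longrightarrow> P (insert i L) \<alpha> \<Longrightarrow> R L (\<alpha> + Poly_Mapping.single i 1)"
  shows "kdiff m f \<in> kspan R"
proof (rule kspanI)
  fix L \<gamma> assume "Poly_Mapping.lookup (kcoeff (kdiff m f) L) \<gamma> \<noteq> 0"
  then obtain i where "i \<in> {1..m} - L" "Poly_Mapping.lookup \<gamma> i \<noteq> 0"
    "sgn_shuffle {i} L * Poly_Mapping.lookup (kcoeff f (insert i L)) (\<gamma> - Poly_Mapping.single i 1) \<noteq> 0"
    unfolding lookup_kdiff by (rule sum.not_neutral_contains_not_neutral) auto
  moreover from this have "Poly_Mapping.lookup (kcoeff f (insert i L)) (\<gamma> - Poly_Mapping.single i 1) \<noteq> 0"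
    by (metis mult_zero_right)
  ultimately show "R L \<gamma>"
    using R[of i L "\<gamma> - Poly_Mapping.single i 1"] kspanD[OF f, of "insert i L" "\<gamma> - Poly_Mapping.single i 1"]
      single_plus_minus[of \<gamma> i] by auto
qed

section \<open>Presentation of the Koszul algebra of a simplicial complex\<close>

lemma poly_ring_simps [simp]:
  "f \<otimes>\<^bsub>poly_ring m\<^esub> g = f * g" "f \<oplus>\<^bsub>poly_ring m\<^esub> g = f + g"
  "\<one>\<^bsub>poly_ring m\<^esub> = 1" "\<zero>\<^bsub>poly_ring m\<^esub> = 0"
  by (simp_all add: poly_ring_def)

lemma poly_ring_a_inv:
  assumes "f \<in> carrier (poly_ring m)"
  shows "\<ominus>\<^bsub>poly_ring m\<^esub> f = - f"
proof -
  interpret cring "poly_ring m :: 'a mpoly ring" by (rule cring_poly_ring)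
  show ?thesis
    by (rule minus_equality) (use assms in \<open>auto simp: poly_ring_def\<close>)
qed

lemma in_poly_ring_iff:
  "f \<in> carrier (poly_ring m) \<longleftrightarrow>
     (\<forall>\<alpha>. Poly_Mapping.lookup f \<alpha> \<noteq> 0 \<longrightarrow> Poly_Mapping.keys \<alpha> \<subseteq> {1..m})"
  by (auto simp: poly_ring_def in_keys_iff)

lemma mpoly_eq_sum_monomials:
  "f = (\<Sum>\<alpha>\<in>Poly_Mapping.keys f. Poly_Mapping.single \<alpha> (Poly_Mapping.lookup f \<alpha>))"
  by (rule poly_mapping_eqI)
    (auto simp: lookup_sum lookup_single when_def in_keys_iff if_distrib cong: if_cong)

lemma keys_add_nat:
  "Poly_Mapping.keys (\<alpha> + \<beta> :: nat \<Rightarrow>\<^sub>0 nat) = Poly_Mapping.keys \<alpha> \<union> Poly_Mapping.keys \<beta>"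
  by (auto simp: in_keys_iff lookup_add)

definition indicator_exp :: "nat set \<Rightarrow> nat \<Rightarrow>\<^sub>0 nat" where
  "indicator_exp \<sigma> = (\<Sum>i\<in>\<sigma>. Poly_Mapping.single i 1)"

lemma lookup_indicator_exp:
  "finite \<sigma> \<Longrightarrow> Poly_Mapping.lookup (indicator_exp \<sigma>) i = (if i \<in> \<sigma> then 1 else 0)"
  by (simp add: indicator_exp_def lookup_sum lookup_single when_def)

lemma keys_indicator_exp [simp]: "finite \<sigma> \<Longrightarrow> Poly_Mapping.keys (indicator_exp \<sigma>) = \<sigma>"
  by (auto simp: in_keys_iff lookup_indicator_exp split: if_splits)

lemma prod_var: "finite \<sigma> \<Longrightarrow> (\<Prod>i\<in>\<sigma>. var i) = Poly_Mapping.single (indicator_exp \<sigma>) 1"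
  by (induction \<sigma> rule: finite_induct) (simp_all add: var_def indicator_exp_def mult_single)

text \<open>Non-faces are closed under supersets, so the polynomials whose monomials have non-face
  support form an ideal. Conversely such a monomial is a multiple of the squarefree monomial on its
  support, which is a generator.\<close>

lemma sr_ideal_eq:
  assumes K: "simplicial_complex_on m K"
  shows "sr_ideal m K = {f \<in> carrier (poly_ring m :: 'k::comm_ring_1 mpoly ring).
    \<forall>\<alpha>. Poly_Mapping.lookup f \<alpha> \<noteq> 0 \<longrightarrow> Poly_Mapping.keys \<alpha> \<notin> K}" (is "_ = ?I")
proof
  let ?P = "poly_ring m :: 'k mpoly ring"
  interpret cring ?P by (rule cring_poly_ring)
  interpret I: ideal "sr_ideal m K" ?P by (rule ideal_sr_ideal)
  have sub: "\<tau> \<in> K" if "\<sigma> \<in> K" "\<tau> \<subseteq> \<sigma>" for \<sigma> \<tau>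
    using K that by (auto simp: simplicial_complex_on_def)
  have times: "x * a \<in> ?I" if "a \<in> ?I" "x \<in> carrier ?P" for a x
  proof -
    have "x * a \<in> carrier ?P" using m_closed[of x a] that by simp
    moreover have "Poly_Mapping.keys \<gamma> \<notin> K" if "Poly_Mapping.lookup (x * a) \<gamma> \<noteq> 0" for \<gamma>
    proof -
      have "\<gamma> \<in> Poly_Mapping.keys (x * a)" using that by (simp add: in_keys_iff)
      then obtain \<alpha> \<beta> where "\<gamma> = \<alpha> + \<beta>" "\<beta> \<in> Poly_Mapping.keys a" using keys_mult by blast
      then show ?thesis
        using \<open>a \<in> ?I\<close> sub[of "Poly_Mapping.keys \<gamma>" "Poly_Mapping.keys \<beta>"]
        by (auto simp: in_keys_iff keys_add_nat)
    qed
    ultimately show ?thesis by simp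
  qed
  have "ideal ?I ?P"
  proof (rule idealI)
    show "subgroup ?I (add_monoid ?P)"
    proof (rule subgroup.intro)
      fix x assume "x \<in> ?I"
      then show "inv\<^bsub>add_monoid ?P\<^esub> x \<in> ?I"
        using poly_ring_a_inv[of x m] by (auto simp: a_inv_def in_poly_ring_iff)
    next
      fix x y assume "x \<in> ?I" "y \<in> ?I"
      then have "x + y \<in> carrier ?P" using a_closed[of x y] by simp
      moreover have "Poly_Mapping.keys \<alpha> \<notin> K" if "Poly_Mapping.lookup (x + y) \<alpha> \<noteq> 0" for \<alpha>
        using that \<open>x \<in> ?I\<close> \<open>y \<in> ?I\<close> by (auto simp: lookup_add) (metis add_0)
      ultimately show "x \<otimes>\<^bsub>add_monoid ?P\<^esub> y \<in> ?I"
        by simp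
    qed (auto simp: in_poly_ring_iff)
  next
    fix a x assume "a \<in> ?I" "x \<in> carrier ?P"
    then have "x * a \<in> ?I" by (rule times)
    then show "x \<otimes>\<^bsub>?P\<^esub> a \<in> ?I" "a \<otimes>\<^bsub>?P\<^esub> x \<in> ?I" by (simp_all only: poly_ring_simps mult.commute)
  qed (rule ring_axioms)
  moreover have gens: "{\<Prod>i\<in>\<sigma>. var i | \<sigma>. \<sigma> \<subseteq> {1..m} \<and> \<sigma> \<notin> K} \<subseteq> ?I"
  proof clarify
    fix \<sigma> assume s: "\<sigma> \<subseteq> {1..m}" "\<sigma> \<notin> K"
    then have fin: "finite \<sigma>" using finite_subset by blast
    show "(\<Prod>i\<in>\<sigma>. var i) \<in> carrier ?P \<and>
        (\<forall>\<alpha>. Poly_Mapping.lookup (\<Prod>i\<in>\<sigma>. var i :: 'k mpoly) \<alpha> \<noteq> 0 \<longrightarrow> Poly_Mapping.keys \<alpha> \<notin> K)"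
      using s fin by (auto simp: prod_var in_poly_ring_iff lookup_single when_def split: if_splits)
  qed
  ultimately show "sr_ideal m K \<subseteq> ?I"
    unfolding sr_ideal_def by (rule genideal_minimal)
  show "?I \<subseteq> sr_ideal m K"
  proof
    fix f assume f: "f \<in> ?I"
    have mono: "Poly_Mapping.single \<alpha> c \<in> sr_ideal m K"
      if "Poly_Mapping.keys \<alpha> \<subseteq> {1..m}" "Poly_Mapping.keys \<alpha> \<notin> K" for \<alpha> and c :: 'k
    proof -
      let ?s = "Poly_Mapping.keys \<alpha>"
      have "(\<Prod>i\<in>?s. var i :: 'k mpoly) \<in> {\<Prod>i\<in>\<sigma>. var i | \<sigma>. \<sigma> \<subseteq> {1..m} \<and> \<sigma> \<notin> K}"
        using that by blast
      moreover have "{\<Prod>i\<in>\<sigma>. var i | \<sigma>. \<sigma> \<subseteq> {1..m} \<and> \<sigma> \<notin> K} \<subseteq> carrier ?P"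
        using gens by blast
      ultimately have "(\<Prod>i\<in>?s. var i :: 'k mpoly) \<in> sr_ideal m K"
        unfolding sr_ideal_def using genideal_self by blast
      moreover have "Poly_Mapping.single (\<alpha> - indicator_exp ?s) c \<in> carrier ?P"
        using that by (auto simp: in_poly_ring_iff lookup_single when_def in_keys_iff lookup_minus split: if_splits)
      ultimately have "Poly_Mapping.single (\<alpha> - indicator_exp ?s) c \<otimes>\<^bsub>?P\<^esub> (\<Prod>i\<in>?s. var i) \<in> sr_ideal m K"
        by (rule I.I_l_closed)
      moreover have "\<alpha> - indicator_exp ?s + indicator_exp ?s = \<alpha>"
        by (auto simp: poly_mapping_eq_iff fun_eq_iff lookup_add lookup_minus lookup_indicator_exp in_keys_iff)
      ultimately show ?thesis by (simp add: prod_var mult_single)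
    qed
    have sums: "(\<Sum>\<alpha>\<in>A. g \<alpha>) \<in> sr_ideal m K" if "finite A" "\<And>\<alpha>. \<alpha> \<in> A \<Longrightarrow> g \<alpha> \<in> sr_ideal m K"
      for A :: "(nat \<Rightarrow>\<^sub>0 nat) set" and g :: "_ \<Rightarrow> 'k mpoly"
      using that
    proof (induction A rule: finite_induct)
      case empty
      then show ?case using I.zero_closed by simp
    next
      case (insert x A)
      then show ?case using I.a_closed[of "g x" "sum g A"] by simp
    qed
    show "f \<in> sr_ideal m K"
      by (subst mpoly_eq_sum_monomials, rule sums)
        (use f mono in \<open>auto simp: in_keys_iff poly_ring_def\<close>)
  qed
qed

section \<open>Graded forms and the Stanley-Reisner part\<close>

definition kcarrier :: "nat \<Rightarrow> 'k::comm_ring_1 kform set" where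
  "kcarrier m = kspan (\<lambda>L \<alpha>. L \<subseteq> {1..m} \<and> Poly_Mapping.keys \<alpha> \<subseteq> {1..m})"

definition kgr :: "nat \<Rightarrow> int \<Rightarrow> 'k::comm_ring_1 kform set" where
  "kgr m n = kspan (\<lambda>L \<alpha>. (L \<subseteq> {1..m} \<and> Poly_Mapping.keys \<alpha> \<subseteq> {1..m}) \<and>
     int (\<Sum>i\<in>{1..m}. 2 * Poly_Mapping.lookup \<alpha> i) + int (card L) = n)"

text \<open>Variables and exterior factors outside the vertex set are allowed, because the ideal
  laws of \<open>dg_ring_mod\<close> quantify over all forms of the type.\<close>

definition knull :: "nat set set \<Rightarrow> 'k::comm_ring_1 kform set" where
  "knull K = kspan (\<lambda>L \<alpha>. Poly_Mapping.keys \<alpha> \<notin> K)"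

definition kproj :: "nat \<Rightarrow> nat set set \<Rightarrow> 'k::comm_ring_1 kform \<Rightarrow> nat set \<Rightarrow> 'k mpoly set" where
  "kproj m K f = (\<lambda>L\<in>Pow {1..m}. sr_class m K (kcoeff f L))"

lemma kgr_kcarrier: "f \<in> kgr m n \<Longrightarrow> f \<in> kcarrier m"
  unfolding kgr_def kcarrier_def by (erule kspan_mono) auto

lemma kcoeff_carrier: "f \<in> kcarrier m \<Longrightarrow> kcoeff f L \<in> carrier (poly_ring m)"
  by (auto simp: kcarrier_def kspan_def in_poly_ring_iff)

lemma kcarrier_add: "f \<in> kcarrier m \<Longrightarrow> g \<in> kcarrier m \<Longrightarrow> f + g \<in> kcarrier m"
  and kcarrier_minus: "f \<in> kcarrier m \<Longrightarrow> - f \<in> kcarrier m"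
  and kcarrier_diff: "f \<in> kcarrier m \<Longrightarrow> g \<in> kcarrier m \<Longrightarrow> f - g \<in> kcarrier m"
  and kcarrier_zero: "0 \<in> kcarrier m"
  by (simp_all add: kcarrier_def kspan_add kspan_minus kspan_zero kspan_diff)

lemma kcarrier_mult: "f \<in> kcarrier m \<Longrightarrow> g \<in> kcarrier m \<Longrightarrow> f * g \<in> kcarrier m"
  unfolding kcarrier_def by (erule (1) kspan_mult) (auto simp: keys_add_nat)

lemma kcarrier_kdiff: "f \<in> kcarrier m \<Longrightarrow> kdiff m f \<in> kcarrier m"
  unfolding kcarrier_def by (erule kspan_kdiff) (auto simp: keys_add_nat)

lemma kgr_mult:
  assumes "f \<in> kgr m i" "g \<in> kgr m j"
  shows "f * g \<in> kgr m (i + j)"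
  using assms unfolding kgr_def
proof (rule kspan_mult, goal_cases)
  case (1 I L \<alpha> \<beta>)
  then have "card L = card I + card (L - I)"
    by (simp add: card_Diff_subset finite_subset card_mono)
  then show ?case
    using 1 by (auto simp: keys_add_nat lookup_add sum.distrib algebra_simps)
qed

lemma kgr_kdiff:
  assumes "f \<in> kgr m n"
  shows "kdiff m f \<in> kgr m (n + 1)"
  using assms unfolding kgr_def
proof (rule kspan_kdiff, goal_cases)
  case (1 i L \<alpha>)
  then have "L \<subseteq> {1..m}" by auto
  then have fin: "finite L" by (rule finite_subset) simp
  have "(\<Sum>j\<in>{1..m}. 2 * Poly_Mapping.lookup (\<alpha> + Poly_Mapping.single i 1) j) =
     (\<Sum>j\<in>{1..m}. 2 * Poly_Mapping.lookup \<alpha> j + (if i = j then 2 else 0))"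
    by (rule sum.cong) (simp_all add: lookup_add lookup_single when_def)
  also have "\<dots> = (\<Sum>j\<in>{1..m}. 2 * Poly_Mapping.lookup \<alpha> j) + 2"
    using 1(1) by (simp add: sum.distrib)
  finally have deg: "(\<Sum>j\<in>{1..m}. 2 * Poly_Mapping.lookup (\<alpha> + Poly_Mapping.single i 1) j) = \<dots>" .
  have "int (card (insert i L)) = int (card L) + 1" using fin 1(2) by simp
  moreover have "Poly_Mapping.keys (\<alpha> + Poly_Mapping.single i 1) \<subseteq> {1..m}"
    using 1 by (auto simp: keys_add_nat)
  ultimately show ?case
    unfolding deg using \<open>L \<subseteq> {1..m}\<close> 1(3) by simp
qed

lemma dg_ring_mod_koszul:
  assumes "simplicial_complex_on m K"
  shows "dg_ring_mod (kgr m) (knull K :: 'k::comm_ring_1 kform set) (kdiff m)"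
proof
  have sub: "\<tau> \<in> K" if "\<sigma> \<in> K" "\<tau> \<subseteq> \<sigma>" for \<sigma> \<tau>
    using assms that by (auto simp: simplicial_complex_on_def)
  have K1: "Poly_Mapping.keys (\<alpha> + \<beta>) \<notin> K" if "Poly_Mapping.keys \<alpha> \<notin> K" for \<alpha> \<beta> :: "nat \<Rightarrow>\<^sub>0 nat"
    using that sub by (auto simp: keys_add_nat)
  have K2: "Poly_Mapping.keys (\<beta> + \<alpha>) \<notin> K" if "Poly_Mapping.keys \<alpha> \<notin> K" for \<alpha> \<beta> :: "nat \<Rightarrow>\<^sub>0 nat"
    using that sub by (auto simp: keys_add_nat)
  fix x y :: "'k kform" and n i j
  show "x \<in> kgr m n \<Longrightarrow> kdiff m (x * y) = kdiff m x * y + twist n (x * kdiff m y)"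
  proof -
    assume x: "x \<in> kgr m n"
    have "even (int (card L) - n)" if nz: "kcoeff x L \<noteq> 0" for L
    proof -
      obtain \<alpha> where "Poly_Mapping.lookup (kcoeff x L) \<alpha> \<noteq> 0"
        using nz by (metis lookup_zero poly_mapping_eqI)
      with x have "int (\<Sum>i\<in>{1..m}. 2 * Poly_Mapping.lookup \<alpha> i) + int (card L) = n"
        by (auto simp: kgr_def dest: kspanD)
      then have "int (card L) - n = - (2 * int (\<Sum>i\<in>{1..m}. Poly_Mapping.lookup \<alpha> i))"
        by (simp add: sum_distrib_left)
      then show ?thesis by simp
    qed
    then show ?thesis using kdiff_leibniz[of x n m y] by (simp add: twist_def)
  qed
  show "x \<in> kgr m i \<Longrightarrow> y \<in> kgr m j \<Longrightarrow> x * y \<in> kgr m (i + j)" by (rule kgr_mult)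
  show "x \<in> kgr m n \<Longrightarrow> kdiff m x \<in> kgr m (n + 1)" by (rule kgr_kdiff)
  show "x \<in> knull K \<Longrightarrow> y * x \<in> knull K"
    unfolding knull_def
    by (rule kspan_mult[of y "\<lambda>_ _. True" x "\<lambda>L \<alpha>. Poly_Mapping.keys \<alpha> \<notin> K"]) (auto simp: K2 intro: kspanI)
  show "x \<in> knull K \<Longrightarrow> x * y \<in> knull K"
    unfolding knull_def
    by (rule kspan_mult[of x "\<lambda>L \<alpha>. Poly_Mapping.keys \<alpha> \<notin> K" y "\<lambda>_ _. True"]) (auto simp: K1 intro: kspanI)
  show "x \<in> knull K \<Longrightarrow> kdiff m x \<in> knull K"
    unfolding knull_def by (erule kspan_kdiff) (rule K1)
qed (simp_all add: kgr_def knull_def kspan_add kspan_minus kspan_zero kdiff_add kdiff_kdiff)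

section \<open>The projection from forms to the Koszul algebra of \<open>K\<close>\<close>

locale sr_koszul =
  fixes m :: nat and K :: "nat set set" and A :: "(nat set \<Rightarrow> 'k::comm_ring_1 mpoly set) dga"
  assumes K: "simplicial_complex_on m K" and A: "A = koszul_dga m K"
begin

abbreviation "P \<equiv> poly_ring m :: 'k mpoly ring"
abbreviation "R \<equiv> sr_ring m K :: 'k mpoly set ring"
abbreviation cls :: "'k mpoly \<Rightarrow> 'k mpoly set" where "cls \<equiv> sr_class m K"
abbreviation proj :: "'k kform \<Rightarrow> nat set \<Rightarrow> 'k mpoly set" where "proj \<equiv> kproj m K"

sublocale P: cring P by (rule cring_poly_ring)
sublocale R: cring R by (rule cring_sr_ring)
sublocale I: ideal "sr_ideal m K" P by (rule ideal_sr_ideal)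

sublocale cls: ring_hom_cring P R cls
proof -
  have "cls = (+>\<^bsub>P\<^esub>) (sr_ideal m K)" by (simp add: sr_class_def fun_eq_iff)
  then show "ring_hom_cring P R cls"
    using I.rcos_ring_hom by (intro ring_hom_cring.intro P.cring_axioms R.cring_axioms ring_hom_cring_axioms.intro)
      (simp add: sr_ring_def)
qed

lemma carrier_R: "carrier R = cls ` carrier P"
  by (auto simp: sr_ring_def FactRing_def A_RCOSETS_def' sr_class_def)

lemma cls_eq_iff:
  assumes "f \<in> carrier P" "g \<in> carrier P"
  shows "cls f = cls g \<longleftrightarrow> (\<forall>\<alpha>. Poly_Mapping.lookup (f - g) \<alpha> \<noteq> 0 \<longrightarrow> Poly_Mapping.keys \<alpha> \<notin> K)"
proof -
  have eq: "f \<ominus>\<^bsub>P\<^esub> g = f - g"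
    using assms by (simp add: a_minus_def poly_ring_a_inv)
  have c: "f - g \<in> carrier P" using P.minus_closed[OF assms] unfolding eq .
  have "cls f = cls g \<longleftrightarrow> f - g \<in> sr_ideal m K"
    unfolding sr_class_def eq[symmetric]
    by (rule P.quotient_eq_iff_same_a_r_cos[OF ideal_sr_ideal assms, symmetric])
  also have "\<dots> \<longleftrightarrow> (\<forall>\<alpha>. Poly_Mapping.lookup (f - g) \<alpha> \<noteq> 0 \<longrightarrow> Poly_Mapping.keys \<alpha> \<notin> K)"
    unfolding sr_ideal_eq[OF K] using c by blast
  finally show ?thesis .
qed

lemma P_sum: "(\<And>x. x \<in> X \<Longrightarrow> f x \<in> carrier P) \<Longrightarrow> sum f X \<in> carrier P"
  by (induction X rule: infinite_finite_induct) (use P.zero_closed P.a_closed in auto)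

lemma cls_add: "f \<in> carrier P \<Longrightarrow> g \<in> carrier P \<Longrightarrow> cls (f + g) = cls f \<oplus>\<^bsub>R\<^esub> cls g"
  and cls_mult: "f \<in> carrier P \<Longrightarrow> g \<in> carrier P \<Longrightarrow> cls (f * g) = cls f \<otimes>\<^bsub>R\<^esub> cls g"
  and cls_zero: "cls 0 = \<zero>\<^bsub>R\<^esub>" and cls_one: "cls 1 = \<one>\<^bsub>R\<^esub>"
  using cls.hom_add cls.hom_mult cls.hom_zero cls.hom_one by simp_all

lemma cls_minus: "f \<in> carrier P \<Longrightarrow> cls (- f) = \<ominus>\<^bsub>R\<^esub> cls f"
  using cls.hom_a_inv[of f] by (simp add: poly_ring_a_inv)

lemma P_minus: "f \<in> carrier P \<Longrightarrow> - f \<in> carrier P"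
  using P.a_inv_closed[of f] by (simp add: poly_ring_a_inv)

lemma P_mult: "f \<in> carrier P \<Longrightarrow> g \<in> carrier P \<Longrightarrow> f * g \<in> carrier P"
  using P.m_closed[of f g] by simp

lemma cls_sum:
  assumes "finite X" "\<And>x. x \<in> X \<Longrightarrow> f x \<in> carrier P"
  shows "cls (sum f X) = (\<Oplus>\<^bsub>R\<^esub>x\<in>X. cls (f x))"
  using assms
proof (induction X rule: finite_induct)
  case empty
  then show ?case by (simp add: cls_zero)
next
  case (insert x X)
  then have "cls (sum f (insert x X)) = cls (f x) \<oplus>\<^bsub>R\<^esub> cls (sum f X)"
    using P_sum[of X f] by (simp add: cls_add)
  also have "\<dots> = (\<Oplus>\<^bsub>R\<^esub>x\<in>insert x X. cls (f x))"
    using insert by (subst R.finsum_insert) (auto intro: cls.hom_closed)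
  finally show ?case .
qed

lemma sgn_carrier: "sgn_shuffle I J \<in> carrier P"
  using P.one_closed P_minus[OF P.one_closed] by (auto simp: sgn_shuffle_def minus_one_power_iff)

lemma cls_sgn: "cls (sgn_shuffle I J) = shuffle_sign R I J"
  using P.one_closed cls_one cls_minus[of 1]
  by (auto simp: sgn_shuffle_def shuffle_sign_def ring_sign_def minus_one_power_iff)

lemma var_carrier: "i \<in> {1..m} \<Longrightarrow> var i \<in> carrier P"
  by (simp add: var_def poly_ring_def)

lemma A_simps:
  "carrier A = Pow {1..m} \<rightarrow>\<^sub>E carrier R"
  "x \<oplus>\<^bsub>A\<^esub> y = (\<lambda>L\<in>Pow {1..m}. x L \<oplus>\<^bsub>R\<^esub> y L)"
  "x \<otimes>\<^bsub>A\<^esub> y = (\<lambda>L\<in>Pow {1..m}. \<Oplus>\<^bsub>R\<^esub>I\<in>Pow L. shuffle_sign R I (L - I) \<otimes>\<^bsub>R\<^esub> (x I \<otimes>\<^bsub>R\<^esub> y (L - I)))"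
  "\<zero>\<^bsub>A\<^esub> = (\<lambda>L\<in>Pow {1..m}. \<zero>\<^bsub>R\<^esub>)"
  "gr A n = {f \<in> Pow {1..m} \<rightarrow>\<^sub>E carrier R. \<forall>L\<in>Pow {1..m}. f L \<in> sr_gr m K (n - int (card L))}"
  "dff A x = (\<lambda>L\<in>Pow {1..m}. \<Oplus>\<^bsub>R\<^esub>i\<in>{1..m} - L.
      shuffle_sign R {i} L \<otimes>\<^bsub>R\<^esub> (cls (var i) \<otimes>\<^bsub>R\<^esub> x (insert i L)))"
  by (simp_all add: A koszul_dga_def Let_def)

lemma proj_carrier: "f \<in> kcarrier m \<Longrightarrow> proj f \<in> carrier A"
  by (auto simp: A_simps kproj_def kcoeff_carrier intro!: cls.hom_closed)

lemma proj_add: "f \<in> kcarrier m \<Longrightarrow> g \<in> kcarrier m \<Longrightarrow> proj (f + g) = proj f \<oplus>\<^bsub>A\<^esub> proj g"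
  by (auto simp: A_simps kproj_def kcoeff_carrier kform_rep_eqs cls_add fun_eq_iff restrict_def)

lemma proj_zero: "proj 0 = \<zero>\<^bsub>A\<^esub>"
  by (auto simp: A_simps kproj_def kform_rep_eqs cls_zero)

lemma proj_mult:
  assumes f: "f \<in> kcarrier m" and g: "g \<in> kcarrier m"
  shows "proj (f * g) = proj f \<otimes>\<^bsub>A\<^esub> proj g"
proof
  fix L
  show "proj (f * g) L = (proj f \<otimes>\<^bsub>A\<^esub> proj g) L"
  proof (cases "L \<subseteq> {1..m}")
    case True
    then have fin: "finite L" using finite_subset by blast
    have "cls (kcoeff (f * g) L) =
        (\<Oplus>\<^bsub>R\<^esub>I\<in>Pow L. cls (sgn_shuffle I (L - I) * (kcoeff f I * kcoeff g (L - I))))"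
      unfolding times_kform.rep_eq using fin f g
      by (intro cls_sum) (auto intro!: P_mult sgn_carrier kcoeff_carrier)
    also have "\<dots> = (\<Oplus>\<^bsub>R\<^esub>I\<in>Pow L. shuffle_sign R I (L - I) \<otimes>\<^bsub>R\<^esub> (proj f I \<otimes>\<^bsub>R\<^esub> proj g (L - I)))"
    proof (rule R.finsum_cong')
      fix I assume I: "I \<in> Pow L"
      have 1: "kcoeff f I \<in> carrier P" "kcoeff g (L - I) \<in> carrier P"
        using f g by (auto intro: kcoeff_carrier)
      have "proj f I = cls (kcoeff f I)" "proj g (L - I) = cls (kcoeff g (L - I))"
        using I True by (auto simp: kproj_def)
      then show "cls (sgn_shuffle I (L - I) * (kcoeff f I * kcoeff g (L - I))) =
          shuffle_sign R I (L - I) \<otimes>\<^bsub>R\<^esub> (proj f I \<otimes>\<^bsub>R\<^esub> proj g (L - I))"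
        using 1 by (simp add: cls_mult sgn_carrier P_mult cls_sgn)
    next
      show "(\<lambda>I. shuffle_sign R I (L - I) \<otimes>\<^bsub>R\<^esub> (proj f I \<otimes>\<^bsub>R\<^esub> proj g (L - I))) \<in> Pow L \<rightarrow> carrier R"
      proof
        fix I assume "I \<in> Pow L"
        then have "I \<in> Pow {1..m}" "L - I \<in> Pow {1..m}" using True by auto
        then show "shuffle_sign R I (L - I) \<otimes>\<^bsub>R\<^esub> (proj f I \<otimes>\<^bsub>R\<^esub> proj g (L - I)) \<in> carrier R"
          using f g unfolding cls_sgn[symmetric] kproj_def
          by (simp only: restrict_apply') (intro R.m_closed cls.hom_closed sgn_carrier kcoeff_carrier)
      qed
    qed simp_all
    finally show ?thesis using True by (simp add: A_simps kproj_def)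
  qed (simp add: A_simps kproj_def)
qed

lemma proj_kdiff:
  assumes f: "f \<in> kcarrier m"
  shows "proj (kdiff m f) = dff A (proj f)"
proof
  fix L
  show "proj (kdiff m f) L = dff A (proj f) L"
  proof (cases "L \<subseteq> {1..m}")
    case True
    have "cls (kcoeff (kdiff m f) L) =
        (\<Oplus>\<^bsub>R\<^esub>i\<in>{1..m} - L. cls (sgn_shuffle {i} L * (var i * kcoeff f (insert i L))))"
      unfolding kdiff.rep_eq using f
      by (intro cls_sum) (auto intro!: P_mult sgn_carrier kcoeff_carrier var_carrier)
    also have "\<dots> = (\<Oplus>\<^bsub>R\<^esub>i\<in>{1..m} - L. shuffle_sign R {i} L \<otimes>\<^bsub>R\<^esub> (cls (var i) \<otimes>\<^bsub>R\<^esub> proj f (insert i L)))"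
    proof (rule R.finsum_cong')
      fix i assume i: "i \<in> {1..m} - L"
      have 1: "kcoeff f (insert i L) \<in> carrier P" "var i \<in> carrier P"
        using f i by (auto intro: kcoeff_carrier var_carrier)
      have "proj f (insert i L) = cls (kcoeff f (insert i L))"
        using i True by (auto simp: kproj_def)
      then show "cls (sgn_shuffle {i} L * (var i * kcoeff f (insert i L))) =
          shuffle_sign R {i} L \<otimes>\<^bsub>R\<^esub> (cls (var i) \<otimes>\<^bsub>R\<^esub> proj f (insert i L))"
        using 1 by (simp add: cls_mult sgn_carrier P_mult cls_sgn)
    next
      show "(\<lambda>i. shuffle_sign R {i} L \<otimes>\<^bsub>R\<^esub> (cls (var i) \<otimes>\<^bsub>R\<^esub> proj f (insert i L))) \<in> {1..m} - L \<rightarrow> carrier R"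
        using True f unfolding cls_sgn[symmetric]
        by (auto simp: kproj_def intro!: R.m_closed cls.hom_closed sgn_carrier kcoeff_carrier var_carrier)
    qed simp_all
    finally show ?thesis using True by (simp add: A_simps kproj_def)
  qed (simp add: A_simps kproj_def)
qed

lemma proj_eq_iff:
  assumes "f \<in> kcarrier m" "g \<in> kcarrier m"
  shows "proj f = proj g \<longleftrightarrow> f - g \<in> knull K"
proof -
  have "proj f = proj g \<longleftrightarrow> (\<forall>L\<in>Pow {1..m}. cls (kcoeff f L) = cls (kcoeff g L))"
    by (auto simp: kproj_def fun_eq_iff restrict_def)
  also have "\<dots> \<longleftrightarrow> (\<forall>L\<in>Pow {1..m}. \<forall>\<alpha>. Poly_Mapping.lookup (kcoeff (f - g) L) \<alpha> \<noteq> 0 \<longrightarrow> Poly_Mapping.keys \<alpha> \<notin> K)"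
    using assms by (simp add: cls_eq_iff kcoeff_carrier kform_rep_eqs)
  also have "\<dots> \<longleftrightarrow> f - g \<in> knull K"
  proof -
    have "L \<subseteq> {1..m}" if "Poly_Mapping.lookup (kcoeff (f - g) L) \<alpha> \<noteq> 0" for L \<alpha>
      using kspanD[OF kcarrier_diff[OF assms, unfolded kcarrier_def] that] by blast
    then show ?thesis unfolding knull_def kspan_def by blast
  qed
  finally show ?thesis .
qed

lemma proj_eq_zero_iff: "f \<in> kcarrier m \<Longrightarrow> proj f = \<zero>\<^bsub>A\<^esub> \<longleftrightarrow> f \<in> knull K"
  using proj_eq_iff[of f 0] by (simp add: proj_zero kcarrier_zero)

lemma kform_exists:
  assumes "\<And>L. L \<subseteq> {1..m} \<Longrightarrow> r L \<in> carrier P"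
  obtains f :: "'k kform" where "f \<in> kcarrier m" "\<And>L. L \<subseteq> {1..m} \<Longrightarrow> kcoeff f L = r L" "\<And>L. \<not> L \<subseteq> {1..m} \<Longrightarrow> kcoeff f L = 0"
proof
  define f where "f = Kform (\<lambda>L. if L \<subseteq> {1..m} then r L else 0)"
  have f: "kcoeff f = (\<lambda>L. if L \<subseteq> {1..m} then r L else 0)"
    unfolding f_def by (rule Kform_inverse) simp
  show "kcoeff f L = r L" if "L \<subseteq> {1..m}" for L using that f by simp
  show "kcoeff f L = 0" if "\<not> L \<subseteq> {1..m}" for L using that f by simp
  show "f \<in> kcarrier m"
    unfolding kcarrier_def using assms f
    by (auto simp: kspan_def in_poly_ring_iff split: if_splits)
qed

lemma carrier_A: "carrier A = proj ` kcarrier m"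
proof
  show "carrier A \<subseteq> proj ` kcarrier m"
  proof
    fix x assume x: "x \<in> carrier A"
    then have "\<exists>r. r \<in> carrier P \<and> x L = cls r" if "L \<subseteq> {1..m}" for L
    proof -
      have "x L \<in> carrier R" using x that by (auto simp: A_simps)
      then show ?thesis unfolding carrier_R by blast
    qed
    then obtain r where r: "\<And>L. L \<subseteq> {1..m} \<Longrightarrow> r L \<in> carrier P \<and> x L = cls (r L)" by metis
    then have "\<And>L. L \<subseteq> {1..m} \<Longrightarrow> r L \<in> carrier P" by blast
    then obtain f where f: "f \<in> kcarrier m" "\<And>L. L \<subseteq> {1..m} \<Longrightarrow> kcoeff f L = r L"
      "\<And>L. \<not> L \<subseteq> {1..m} \<Longrightarrow> kcoeff f L = 0"
      using kform_exists[of r] by blast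
    have "x = proj f"
      using x r f(2) by (auto simp: A_simps kproj_def PiE_iff fun_eq_iff restrict_def extensional_def)
    then show "x \<in> proj ` kcarrier m" using f by blast
  qed
qed (use proj_carrier in blast)

lemma gr_A: "gr A n = proj ` kgr m n"
proof
  show "gr A n \<subseteq> proj ` kgr m n"
  proof
    fix x assume x: "x \<in> gr A n"
    then have "\<exists>r. r \<in> poly_gr m (n - int (card L)) \<and> x L = cls r" if "L \<subseteq> {1..m}" for L
      using that by (auto simp: A_simps sr_gr_def)
    then obtain r where r: "\<And>L. L \<subseteq> {1..m} \<Longrightarrow> r L \<in> poly_gr m (n - int (card L)) \<and> x L = cls (r L)" by metis
    then have "\<And>L. L \<subseteq> {1..m} \<Longrightarrow> r L \<in> carrier P" by (auto simp: poly_gr_def)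
    then obtain f where f: "f \<in> kcarrier m" "\<And>L. L \<subseteq> {1..m} \<Longrightarrow> kcoeff f L = r L"
      "\<And>L. \<not> L \<subseteq> {1..m} \<Longrightarrow> kcoeff f L = 0"
      using kform_exists[of r] by blast
    have "x = proj f"
      using x r f(2) by (auto simp: A_simps kproj_def PiE_iff fun_eq_iff restrict_def extensional_def)
    moreover have "f \<in> kgr m n"
      unfolding kgr_def
    proof (rule kspanI)
      fix L \<alpha> assume nz: "Poly_Mapping.lookup (kcoeff f L) \<alpha> \<noteq> 0"
      have L: "L \<subseteq> {1..m} \<and> Poly_Mapping.keys \<alpha> \<subseteq> {1..m}"
        using kspanD[OF f(1)[unfolded kcarrier_def] nz] .
      then have "\<alpha> \<in> Poly_Mapping.keys (r L)" using nz f(2) by (simp add: in_keys_iff)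
      then have "int (\<Sum>i\<in>{1..m}. 2 * Poly_Mapping.lookup \<alpha> i) = n - int (card L)"
        using r[of L] L by (auto simp: poly_gr_def)
      then show "(L \<subseteq> {1..m} \<and> Poly_Mapping.keys \<alpha> \<subseteq> {1..m}) \<and>
          int (\<Sum>i\<in>{1..m}. 2 * Poly_Mapping.lookup \<alpha> i) + int (card L) = n"
        using L by simp
    qed
    ultimately show "x \<in> proj ` kgr m n" by blast
  qed
  show "proj ` kgr m n \<subseteq> gr A n"
  proof clarify
    fix f :: "'k kform" assume f: "f \<in> kgr m n"
    have c: "kcoeff f L \<in> carrier P" for L
      by (rule kcoeff_carrier[OF kgr_kcarrier[OF f]])
    have "kcoeff f L \<in> poly_gr m (n - int (card L))" for L
      using c[of L] kspanD[OF f[unfolded kgr_def], of L] by (fastforce simp: poly_gr_def in_keys_iff)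
    then show "proj f \<in> gr A n"
      using c by (auto simp: A_simps kproj_def sr_gr_def intro!: cls.hom_closed)
  qed
qed

sublocale A: abelian_group A
proof (rule abelian_groupI)
  fix x y z assume "x \<in> carrier A" "y \<in> carrier A" "z \<in> carrier A"
  then show "x \<oplus>\<^bsub>A\<^esub> y \<oplus>\<^bsub>A\<^esub> z = x \<oplus>\<^bsub>A\<^esub> (y \<oplus>\<^bsub>A\<^esub> z)"
    unfolding carrier_A by (auto simp: proj_add[symmetric] kcarrier_add add.assoc)
next
  fix x y assume "x \<in> carrier A" "y \<in> carrier A"
  then show "x \<oplus>\<^bsub>A\<^esub> y = y \<oplus>\<^bsub>A\<^esub> x" "x \<oplus>\<^bsub>A\<^esub> y \<in> carrier A"
    unfolding carrier_A by (auto simp: proj_add[symmetric] kcarrier_add add.commute)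
next
  fix x assume "x \<in> carrier A"
  then obtain f where f: "x = proj f" "f \<in> kcarrier m" unfolding carrier_A by blast
  then show "\<zero>\<^bsub>A\<^esub> \<oplus>\<^bsub>A\<^esub> x = x"
    using proj_add[of 0 f] by (simp add: proj_zero kcarrier_zero)
  show "\<exists>y\<in>carrier A. y \<oplus>\<^bsub>A\<^esub> x = \<zero>\<^bsub>A\<^esub>"
    using f proj_add[of "- f" f] by (intro bexI[of _ "proj (- f)"]) (simp_all add: proj_zero kcarrier_minus proj_carrier)
next
  show "\<zero>\<^bsub>A\<^esub> \<in> carrier A" using proj_carrier[OF kcarrier_zero] by (simp add: proj_zero)
qed

lemma proj_minus: "f \<in> kcarrier m \<Longrightarrow> proj (- f) = \<ominus>\<^bsub>A\<^esub> proj f"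
  using proj_add[of "- f" f] by (intro A.minus_equality[symmetric])
    (simp_all add: proj_zero kcarrier_minus proj_carrier)

lemma proj_twist: "f \<in> kcarrier m \<Longrightarrow> proj (twist n f) = signed A n (proj f)"
  by (simp add: twist_def signed_def proj_minus)

lemma kcarrier_twist: "f \<in> kcarrier m \<Longrightarrow> twist n f \<in> kcarrier m"
  by (simp add: twist_def kcarrier_minus)

lemma kcarrier_sum: "(\<And>x. x \<in> X \<Longrightarrow> f x \<in> kcarrier m) \<Longrightarrow> sum f X \<in> kcarrier m"
  by (induction X rule: infinite_finite_induct) (auto simp: kcarrier_zero kcarrier_add)

lemma proj_sum:
  assumes "finite X" "\<And>x. x \<in> X \<Longrightarrow> f x \<in> kcarrier m"
  shows "proj (sum f X) = (\<Oplus>\<^bsub>A\<^esub>x\<in>X. proj (f x))"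
  using assms
proof (induction X rule: finite_induct)
  case empty
  then show ?case by (simp add: proj_zero)
next
  case (insert x X)
  then have "proj (sum f (insert x X)) = proj (f x) \<oplus>\<^bsub>A\<^esub> proj (sum f X)"
    using kcarrier_sum[of X f] by (simp add: proj_add)
  also have "\<dots> = (\<Oplus>\<^bsub>A\<^esub>x\<in>insert x X. proj (f x))"
    using insert by (subst A.finsum_insert) (auto intro: proj_carrier)
  finally show ?case .
qed

lemma proj_msum:
  assumes "\<And>r. i \<le> r \<Longrightarrow> r < j \<Longrightarrow> a i r \<in> kcarrier m \<and> a (Suc r) j \<in> kcarrier m"
  shows "proj (msum e a i j) = massey_sum A e (\<lambda>i j. proj (a i j)) i j"
proof -
  define F where "F r = twist (massey_deg e i r + 1) (a i r) * a (Suc r) j" for r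
  have F: "F r \<in> kcarrier m"
    "signed A (massey_deg e i r + 1) (proj (a i r)) \<otimes>\<^bsub>A\<^esub> proj (a (Suc r) j) = proj (F r)" if "r \<in> {i..<j}" for r
    unfolding F_def using that assms[of r] by (simp_all add: kcarrier_mult proj_mult proj_twist kcarrier_twist)
  have "proj (msum e a i j) = (\<Oplus>\<^bsub>A\<^esub>r\<in>{i..<j}. proj (F r))"
    unfolding msum_def F_def[symmetric] by (rule proj_sum[OF _ F(1)]) simp
  also have "\<dots> = massey_sum A e (\<lambda>i j. proj (a i j)) i j"
    unfolding massey_sum_def by (rule A.finsum_cong') (simp_all add: F proj_carrier Pi_def)
  finally show ?thesis .
qed

lemma coboundaries_A: "coboundaries A n = (\<lambda>w. proj (kdiff m w)) ` kgr m (n - 1)"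
  unfolding coboundaries_def gr_A image_image
  by (rule image_cong) (auto simp: proj_kdiff[symmetric] dest: kgr_kcarrier)

lemma cocycles_A: "cocycles A n = proj ` {f \<in> kgr m n. kdiff m f \<in> knull K}"
  unfolding cocycles_def gr_A
  by (auto simp: proj_kdiff[symmetric] proj_eq_zero_iff kcarrier_kdiff kgr_kcarrier)

lemma hclass_A:
  assumes "f \<in> kcarrier m"
  shows "hclass A n (proj f) = (\<lambda>w. proj (kdiff m w + f)) ` kgr m (n - 1)"
proof -
  have "hclass A n (proj f) = (\<lambda>h. h \<oplus>\<^bsub>A\<^esub> proj f) ` coboundaries A n"
    by (auto simp: hclass_def a_r_coset_def')
  also have "\<dots> = (\<lambda>w. proj (kdiff m w + f)) ` kgr m (n - 1)"
    unfolding coboundaries_A image_image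
    by (rule image_cong) (auto simp: proj_add assms kcarrier_kdiff dest: kgr_kcarrier)
  finally show ?thesis .
qed

lemma hclass_eq_coboundaries_iff:
  assumes f: "f \<in> kcarrier m"
  shows "hclass A n (proj f) = coboundaries A n \<longleftrightarrow> (\<exists>w\<in>kgr m (n - 1). kdiff m w - f \<in> knull K)"
proof
  assume "hclass A n (proj f) = coboundaries A n"
  moreover have "proj f \<in> hclass A n (proj f)"
    unfolding hclass_A[OF f] by (rule image_eqI[of _ _ 0]) (simp_all add: kgr_def kspan_zero)
  ultimately obtain w where w: "w \<in> kgr m (n - 1)" "proj f = proj (kdiff m w)"
    by (auto simp: coboundaries_A)
  then have "kdiff m w - f \<in> knull K"
    using proj_eq_iff[of "kdiff m w" f] f kgr_kcarrier kcarrier_kdiff by fastforce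
  then show "\<exists>w\<in>kgr m (n - 1). kdiff m w - f \<in> knull K" using w by blast
next
  assume "\<exists>w\<in>kgr m (n - 1). kdiff m w - f \<in> knull K"
  then obtain w where w: "w \<in> kgr m (n - 1)" "kdiff m w - f \<in> knull K" by blast
  have wc: "kdiff m v \<in> kcarrier m" if "v \<in> kgr m (n - 1)" for v :: "'k kform"
    using that kgr_kcarrier kcarrier_kdiff by blast
  have pf: "proj f = proj (kdiff m w)"
    using proj_eq_iff[of "kdiff m w" f] f w wc by auto
  show "hclass A n (proj f) = coboundaries A n"
  proof
    show "hclass A n (proj f) \<subseteq> coboundaries A n"
    proof
      fix x assume "x \<in> hclass A n (proj f)"
      then obtain v where v: "v \<in> kgr m (n - 1)" "x = proj (kdiff m v + f)"
        unfolding hclass_A[OF f] by blast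
      then have "x = proj (kdiff m (v + w))"
        using pf w wc f by (simp add: proj_add kdiff_add)
      moreover have "v + w \<in> kgr m (n - 1)" using v w by (simp add: kgr_def kspan_add)
      ultimately show "x \<in> coboundaries A n" unfolding coboundaries_A by blast
    qed
    show "coboundaries A n \<subseteq> hclass A n (proj f)"
    proof
      fix x assume "x \<in> coboundaries A n"
      then obtain v where v: "v \<in> kgr m (n - 1)" "x = proj (kdiff m v)"
        unfolding coboundaries_A by blast
      have vw: "v - w \<in> kgr m (n - 1)" using v w by (simp add: kgr_def kspan_diff)
      have "v = (v - w) + w" by simp
      then have "kdiff m v = kdiff m (v - w) + kdiff m w" by (metis kdiff_add)
      then have "x = proj (kdiff m (v - w) + f)"
        using v pf w wc f vw by (simp add: proj_add)
      then show "x \<in> hclass A n (proj f)" unfolding hclass_A[OF f] using vw by blast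
    qed
  qed
qed

lemma homology_A: "homology A n = (\<lambda>f. hclass A n (proj f)) ` {f \<in> kgr m n. kdiff m f \<in> knull K}"
  unfolding homology_def cocycles_A image_image ..

sublocale dg_ring_mod "kgr m" "knull K :: 'k kform set" "kdiff m"
  by (rule dg_ring_mod_koszul[OF K])

lemma hclass_rep:
  assumes f: "f \<in> kgr m n" "kdiff m f \<in> knull K" and x: "x \<in> hclass A n (proj f)"
  obtains g where "g \<in> kgr m n" "kdiff m g \<in> knull K" "x = proj g"
proof -
  obtain w where w: "w \<in> kgr m (n - 1)" "x = proj (kdiff m w + f)"
    using x unfolding hclass_A[OF kgr_kcarrier[OF f(1)]] by blast
  have "kdiff m w \<in> kgr m n" using kgr_kdiff[OF w(1)] by simp
  then show ?thesis
    using that[of "kdiff m w + f"] w f by (simp add: G_add kdiff_add kdiff_kdiff)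
qed

lemma trivial_products_iff:
  "trivial_products A \<longleftrightarrow>
     (\<forall>i j. \<forall>x\<in>(kgr m i :: 'k kform set). \<forall>y\<in>kgr m j. 0 < i \<longrightarrow> 0 < j \<longrightarrow> kdiff m x \<in> knull K \<longrightarrow> kdiff m y \<in> knull K \<longrightarrow>
        (\<exists>w\<in>kgr m (i + j - 1). kdiff m w - x * y \<in> knull K))" (is "?L \<longleftrightarrow> ?R")
proof
  assume L: ?L
  show ?R
  proof (intro allI ballI impI)
    fix i j and x y :: "'k kform"
    assume x: "x \<in> kgr m i" and y: "y \<in> kgr m j" and ij: "0 < i" "0 < j"
      and d: "kdiff m x \<in> knull K" "kdiff m y \<in> knull K"
    have self: "proj f \<in> hclass A n (proj f)" if "f \<in> kcarrier m" for f n
      unfolding hclass_A[OF that] by (rule image_eqI[of _ _ 0]) (simp_all add: G_zero)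
    have "hclass A i (proj x) \<in> homology A i" "hclass A j (proj y) \<in> homology A j"
      unfolding homology_A using x y d by auto
    then have "hclass A (i + j) (proj x \<otimes>\<^bsub>A\<^esub> proj y) = coboundaries A (i + j)"
      using L ij self[of x i] self[of y j] x y kgr_kcarrier unfolding trivial_products_def by blast
    then show "\<exists>w\<in>kgr m (i + j - 1). kdiff m w - x * y \<in> knull K"
      using x y kgr_kcarrier by (metis hclass_eq_coboundaries_iff kcarrier_mult proj_mult)
  qed
next
  assume R: ?R
  show ?L
    unfolding trivial_products_def
  proof (intro allI ballI impI)
    fix i j \<alpha> \<beta> x y
    assume "\<alpha> \<in> homology A i" "\<beta> \<in> homology A j" and ij: "0 < i \<and> 0 < j" and x: "x \<in> \<alpha>" and y: "y \<in> \<beta>"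
    then obtain f g where f: "f \<in> kgr m i" "kdiff m f \<in> knull K" "\<alpha> = hclass A i (proj f)"
      and g: "g \<in> kgr m j" "kdiff m g \<in> knull K" "\<beta> = hclass A j (proj g)"
      unfolding homology_A by blast
    obtain f' where f': "f' \<in> kgr m i" "kdiff m f' \<in> knull K" "x = proj f'"
      using hclass_rep[OF f(1,2)] x f(3) by blast
    obtain g' where g': "g' \<in> kgr m j" "kdiff m g' \<in> knull K" "y = proj g'"
      using hclass_rep[OF g(1,2)] y g(3) by blast
    have "\<exists>w\<in>kgr m (i + j - 1). kdiff m w - f' * g' \<in> knull K"
      using R ij f' g' by blast
    then show "hclass A (i + j) (x \<otimes>\<^bsub>A\<^esub> y) = coboundaries A (i + j)"
      using f' g' kgr_kcarrier by (metis hclass_eq_coboundaries_iff kcarrier_mult proj_mult)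
  qed
qed

text \<open>The premise provides a lifted defining system together with one further entry at
  \<open>(1, n)\<close>. That entry lies outside the system; it bounds the value of the product,
  which is therefore the zero class.\<close>

lemma trivial_massey_productsI:
  assumes exact: "\<And>(n::nat) (e :: nat \<Rightarrow> int) (x :: nat \<Rightarrow> 'k kform). (\<And>k. k \<in> {1..n} \<Longrightarrow> 0 < e k \<and> x k \<in> kgr m (e k) \<and> kdiff m (x k) \<in> knull K) \<Longrightarrow>
    \<exists>a. (\<forall>k\<in>{1..n}. \<exists>w\<in>kgr m (e k - 1). a k k \<in> kgr m (e k) \<and> x k - a k k - kdiff m w \<in> knull K) \<and>
      (\<forall>i j. 1 \<le> i \<and> i < j \<and> j \<le> n \<longrightarrow> a i j \<in> kgr m (massey_deg e i j) \<and> kdiff m (a i j) - msum e a i j \<in> knull K)"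
  shows "trivial_massey_products A"
  unfolding trivial_massey_products_def
proof (intro allI impI; elim conjE)
  fix n :: nat and e :: "nat \<Rightarrow> int" and \<alpha>
  assume n: "3 \<le> n" and e: "\<forall>k\<in>{1..n}. 0 < e k \<and> \<alpha> k \<in> homology A (e k)"
  then have "\<exists>f. f \<in> kgr m (e k) \<and> kdiff m f \<in> knull K \<and> \<alpha> k = hclass A (e k) (proj f)" if "k \<in> {1..n}" for k
    using that unfolding homology_A by blast
  then obtain x where x: "\<And>k. k \<in> {1..n} \<Longrightarrow> x k \<in> kgr m (e k) \<and> kdiff m (x k) \<in> knull K \<and> \<alpha> k = hclass A (e k) (proj (x k))"
    by metis
  obtain a where a1: "\<And>k. k \<in> {1..n} \<Longrightarrow> \<exists>w\<in>kgr m (e k - 1). a k k \<in> kgr m (e k) \<and> x k - a k k - kdiff m w \<in> knull K"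
    and a2: "\<And>i j. 1 \<le> i \<Longrightarrow> i < j \<Longrightarrow> j \<le> n \<Longrightarrow>
        a i j \<in> kgr m (massey_deg e i j) \<and> kdiff m (a i j) - msum e a i j \<in> knull K"
    using exact[of n e x] x e by blast
  have ac: "a i j \<in> kcarrier m" if "1 \<le> i" "i \<le> j" "j \<le> n" for i j
    using that a1[of i] a2[of i j] kgr_kcarrier by (cases "i = j") auto
  have ms: "proj (msum e a i j) = massey_sum A e (\<lambda>i j. proj (a i j)) i j" if "1 \<le> i" "j \<le> n" for i j
    by (rule proj_msum) (use that ac in auto)
  have msc: "msum e a i j \<in> kcarrier m" if "1 \<le> i" "j \<le> n" for i j
    unfolding msum_def by (rule kcarrier_sum) (use that ac in \<open>auto intro!: kcarrier_mult kcarrier_twist\<close>)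
  have "defining_system A n e \<alpha> (\<lambda>i j. proj (a i j))"
    unfolding defining_system_def
  proof (intro conjI ballI allI impI; (elim conjE)?)
    fix k assume k: "k \<in> {1..n}"
    then obtain w where w: "w \<in> kgr m (e k - 1)" "x k - a k k - kdiff m w \<in> knull K"
      using a1 by blast
    have "kdiff m (- w) + x k - a k k \<in> knull K" using w(2) by (simp add: kdiff_minus algebra_simps)
    then have "proj (a k k) = proj (kdiff m (- w) + x k)"
      using x[OF k] ac[of k k] k w(1) kgr_kcarrier
      by (subst eq_commute, subst proj_eq_iff) (auto intro!: kcarrier_add kcarrier_kdiff kcarrier_minus)
    moreover have "- w \<in> kgr m (e k - 1)" using w(1) by (rule G_minus)
    moreover have "x k \<in> kcarrier m" using x[OF k] kgr_kcarrier by blast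
    ultimately show "proj (a k k) \<in> \<alpha> k"
      using x[OF k] by (auto simp: hclass_A)
  next
    fix i j assume ij: "1 \<le> i" "i < j" "j \<le> n"
    then show "proj (a i j) \<in> gr A (massey_deg e i j)" using a2 gr_A by blast
    have "dff A (proj (a i j)) = proj (kdiff m (a i j))"
      using ij ac by (simp add: proj_kdiff)
    also have "\<dots> = proj (msum e a i j)"
      using ij a2[of i j] ac[of i j] msc[of i j] by (subst proj_eq_iff) (auto intro!: kcarrier_kdiff)
    finally show "dff A (proj (a i j)) = massey_sum A e (\<lambda>i j. proj (a i j)) i j"
      using ij ms by simp
  qed
  then have "hclass A (massey_deg e 1 n + 1) (massey_sum A e (\<lambda>i j. proj (a i j)) 1 n) \<in> massey_product A n e \<alpha>"
    unfolding massey_product_def by blast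
  moreover have "hclass A (massey_deg e 1 n + 1) (massey_sum A e (\<lambda>i j. proj (a i j)) 1 n) =
      coboundaries A (massey_deg e 1 n + 1)"
  proof -
    have "\<exists>w\<in>kgr m (massey_deg e 1 n + 1 - 1). kdiff m w - msum e a 1 n \<in> knull K"
      using a2[of 1 n] n by auto
    then show ?thesis
      using hclass_eq_coboundaries_iff[of "msum e a 1 n"] msc[of 1 n] ms[of 1 n] by auto
  qed
  ultimately show "coboundaries A (massey_deg e 1 n + 1) \<in> massey_product A n e \<alpha>" by simp
qed

end

section \<open>A criterion for Golodness of two-dimensional complexes\<close>

definition vexp :: "nat \<Rightarrow> nat \<Rightarrow>\<^sub>0 nat" where
  "vexp i = Poly_Mapping.single i 1"

lemma lookup_vexp: "Poly_Mapping.lookup (vexp i) j = (if i = j then 1 else 0)"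
  by (simp add: vexp_def lookup_single when_def)

lemma lookup_kdiff':
  "Poly_Mapping.lookup (kcoeff (kdiff m f) L) \<alpha> = (\<Sum>i\<in>{i \<in> {1..m} - L. Poly_Mapping.lookup \<alpha> i \<noteq> 0}.
     sgn_shuffle {i} L * Poly_Mapping.lookup (kcoeff f (insert i L)) (\<alpha> - vexp i))"
  unfolding vexp_def by (rule lookup_kdiff)

lemma exp_eqI: "(\<And>i. Poly_Mapping.lookup \<alpha> i = Poly_Mapping.lookup \<beta> i) \<Longrightarrow> \<alpha> = (\<beta> :: nat \<Rightarrow>\<^sub>0 nat)"
  by (rule poly_mapping_eqI)

lemma sgn_shuffle_ij: "i \<noteq> j \<Longrightarrow> sgn_shuffle {i} {j} * sgn_shuffle {j} {i} = (- 1 :: 'k::comm_ring_1)"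
  by (auto simp: sgn_shuffle_single)

definition pdeg :: "nat \<Rightarrow> (nat \<Rightarrow>\<^sub>0 nat) \<Rightarrow> nat" where
  "pdeg m \<alpha> = (\<Sum>i\<in>{1..m}. Poly_Mapping.lookup \<alpha> i)"

lemma pdeg_add: "pdeg m (\<alpha> + \<beta>) = pdeg m \<alpha> + pdeg m \<beta>"
  by (simp add: pdeg_def lookup_add sum.distrib)

lemma pdeg_vexp: "i \<in> {1..m} \<Longrightarrow> pdeg m (vexp i) = 1"
  by (simp add: pdeg_def lookup_vexp)

lemma vexp_minus_plus: "Poly_Mapping.lookup \<alpha> i \<noteq> 0 \<Longrightarrow> \<alpha> - vexp i + vexp i = \<alpha>"
  by (rule exp_eqI) (auto simp: lookup_add lookup_minus lookup_vexp)

lemma pdeg_minus_vexp: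
  assumes "i \<in> {1..m}" "Poly_Mapping.lookup \<alpha> i \<noteq> 0"
  shows "pdeg m \<alpha> = Suc (pdeg m (\<alpha> - vexp i))"
  using pdeg_add[of m "\<alpha> - vexp i" "vexp i"] assms by (simp add: vexp_minus_plus pdeg_vexp)

lemma pdeg_eq_0:
  assumes "Poly_Mapping.keys \<alpha> \<subseteq> {1..m}" "pdeg m \<alpha> = 0"
  shows "\<alpha> = 0"
proof (rule exp_eqI)
  fix i
  have "Poly_Mapping.lookup \<alpha> i = 0"
  proof (cases "i \<in> {1..m}")
    case True
    then show ?thesis using assms(2) unfolding pdeg_def by simp
  next
    case False
    then show ?thesis using assms(1) by (meson in_keys_iff subsetD)
  qed
  then show "Poly_Mapping.lookup \<alpha> i = Poly_Mapping.lookup 0 i" by simp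
qed

definition kind :: "nat \<Rightarrow> int \<Rightarrow> nat set \<Rightarrow> (nat \<Rightarrow>\<^sub>0 nat) \<Rightarrow> bool" where
  "kind m n L \<alpha> \<longleftrightarrow> L \<subseteq> {1..m} \<and> Poly_Mapping.keys \<alpha> \<subseteq> {1..m} \<and> 2 * int (pdeg m \<alpha>) + int (card L) = n"

lemma kgr_eq: "kgr m n = kspan (kind m n)"
  unfolding kgr_def
  by (rule arg_cong[of _ _ kspan]) (simp add: kind_def pdeg_def fun_eq_iff sum_distrib_left[symmetric])

lemma kgrD: "f \<in> kgr m n \<Longrightarrow> \<not> kind m n L \<alpha> \<Longrightarrow> Poly_Mapping.lookup (kcoeff f L) \<alpha> = 0"
  unfolding kgr_eq using kspanD by blast

lemma kind_insert:
  assumes "kind m n L \<alpha>" "i \<in> {1..m} - L" "Poly_Mapping.lookup \<alpha> i \<noteq> 0"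
  shows "kind m (n - 1) (insert i L) (\<alpha> - vexp i)"
proof -
  have "finite L" using assms(1) finite_subset[of L "{1..m}"] by (simp add: kind_def)
  moreover have "Poly_Mapping.keys (\<alpha> - vexp i) \<subseteq> Poly_Mapping.keys \<alpha>"
    by (auto simp: in_keys_iff lookup_minus)
  ultimately show ?thesis
    using assms pdeg_minus_vexp[of i m \<alpha>] by (auto simp: kind_def)
qed

lemma finite_exponents: "finite {\<alpha>. Poly_Mapping.keys \<alpha> \<subseteq> {1..m} \<and> pdeg m \<alpha> \<le> k}"
proof -
  let ?F = "{f :: nat \<Rightarrow> nat. \<forall>i. (i \<in> {1..m} \<longrightarrow> f i \<in> {0..k}) \<and> (i \<notin> {1..m} \<longrightarrow> f i = 0)}"
  have "finite ?F" by (rule finite_set_of_finite_funs) simp_all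
  moreover have "Poly_Mapping.lookup ` {\<alpha>. Poly_Mapping.keys \<alpha> \<subseteq> {1..m} \<and> pdeg m \<alpha> \<le> k} \<subseteq> ?F"
  proof clarify
    fix \<alpha> :: "nat \<Rightarrow>\<^sub>0 nat" and i
    assume \<alpha>: "Poly_Mapping.keys \<alpha> \<subseteq> {1..m}" "pdeg m \<alpha> \<le> k"
    have "Poly_Mapping.lookup \<alpha> i \<le> pdeg m \<alpha>" if "i \<in> {1..m}"
      unfolding pdeg_def by (rule member_le_sum) (use that in auto)
    then show "(i \<in> {1..m} \<longrightarrow> Poly_Mapping.lookup \<alpha> i \<in> {0..k}) \<and> (i \<notin> {1..m} \<longrightarrow> Poly_Mapping.lookup \<alpha> i = 0)"
      using \<alpha> by (force simp: in_keys_iff subset_iff)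
  qed
  ultimately have "finite (Poly_Mapping.lookup ` {\<alpha> :: nat \<Rightarrow>\<^sub>0 nat. Poly_Mapping.keys \<alpha> \<subseteq> {1..m} \<and> pdeg m \<alpha> \<le> k})"
    by (rule finite_subset[rotated])
  then show ?thesis
    by (rule finite_imageD) (rule inj_onI, rule exp_eqI, simp)
qed

text \<open>In a fixed degree only finitely many exponents occur, so coefficients can be prescribed
  freely.\<close>

lemma kgr_exists:
  fixes c :: "nat set \<Rightarrow> (nat \<Rightarrow>\<^sub>0 nat) \<Rightarrow> 'k::comm_ring_1"
  obtains w where "w \<in> kgr m n"
    "\<And>L \<alpha>. Poly_Mapping.lookup (kcoeff w L) \<alpha> = (if kind m n L \<alpha> then c L \<alpha> else 0)"
proof -
  define S where "S L = {\<alpha>. kind m n L \<alpha>}" for L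
  have fin: "finite (S L)" for L
  proof (rule finite_subset[OF _ finite_exponents[of m "nat n"]])
    show "S L \<subseteq> {\<alpha>. Poly_Mapping.keys \<alpha> \<subseteq> {1..m} \<and> pdeg m \<alpha> \<le> nat n}"
      by (auto simp: S_def kind_def)
  qed
  define w where "w = Kform (\<lambda>L. \<Sum>\<alpha>\<in>S L. Poly_Mapping.single \<alpha> (c L \<alpha>))"
  have w: "kcoeff w L = (\<Sum>\<alpha>\<in>S L. Poly_Mapping.single \<alpha> (c L \<alpha>))" for L
    unfolding w_def by (simp add: Kform_inverse)
  have lk: "Poly_Mapping.lookup (kcoeff w L) \<alpha> = (if kind m n L \<alpha> then c L \<alpha> else 0)" for L \<alpha>
  proof -
    have "Poly_Mapping.lookup (kcoeff w L) \<alpha> = (\<Sum>\<beta>\<in>S L. if \<beta> = \<alpha> then c L \<beta> else 0)"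
      unfolding w lookup_sum lookup_single when_def by simp
    also have "\<dots> = (if \<alpha> \<in> S L then c L \<alpha> else 0)" using fin by simp
    finally show ?thesis by (simp add: S_def)
  qed
  moreover have "w \<in> kgr m n"
    unfolding kgr_eq by (rule kspanI) (auto simp: lk split: if_splits)
  ultimately show ?thesis using that by blast
qed

text \<open>\<open>solve\<close> is a choice of primitives for the simplicial 2-cochains of
  \<open>K\<close>: the sum over \<open>j \<in> \<tau>\<close> is the coboundary, with
  \<open>sgn_shuffle {j} \<tau>\<close> as its usual sign. A 2-cochain of a full subcomplex extends
  by 0 to \<open>K\<close>, where it is a cocycle for dimension reasons, so \<open>solve\<close>
  serves all full subcomplexes.\<close>

locale golod_criterion =
  fixes m :: nat and K :: "nat set set" and a :: nat
    and solve :: "(nat set \<Rightarrow> 'k::comm_ring_1) \<Rightarrow> nat set \<Rightarrow> 'k"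
  assumes K: "simplicial_complex_on m K"
    and dim: "\<sigma> \<in> K \<Longrightarrow> card \<sigma> \<le> 3"
    and a: "a \<in> {1..m}"
    and edges: "i \<in> {1..m} - {a} \<Longrightarrow> j \<in> {1..m} - {a} \<Longrightarrow> {i, j} \<in> K"
    and solve: "\<tau> \<in> K \<Longrightarrow> card \<tau> = 3 \<Longrightarrow> (\<Sum>j\<in>\<tau>. sgn_shuffle {j} \<tau> * solve g (\<tau> - {j})) = g \<tau>"
begin

definition F :: "nat \<Rightarrow> 'k kform set" where
  "F c = kspan (\<lambda>L \<alpha>. c \<le> pdeg m \<alpha>)"

definition B :: "'k kform set" where
  "B = kspan (\<lambda>L \<alpha>. 2 \<le> pdeg m \<alpha> \<or> 1 \<le> pdeg m \<alpha> \<and> a \<in> L)"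

lemma B_mult: "x \<in> B \<Longrightarrow> y \<in> B \<Longrightarrow> x * y \<in> F 3"
  unfolding B_def F_def by (erule (1) kspan_mult) (auto simp: pdeg_add)

lemma vertex: "i \<in> {1..m} \<Longrightarrow> {i} \<in> K"
  using K by (auto simp: simplicial_complex_on_def)

lemma cocycle:
  assumes "kdiff m z \<in> knull K" "Poly_Mapping.keys \<alpha> \<in> K"
  shows "Poly_Mapping.lookup (kcoeff (kdiff m z) L) \<alpha> = 0"
  using assms unfolding knull_def by (metis kspanD)

text \<open>In degree 0 the cocycle condition at \<open>v_i\<close> for some
  \<open>i \<in> L\<close> kills the coefficient of \<open>u_L\<close>. In degree 1 the condition at
  \<open>v_i^2\<close> kills the terms with \<open>i \<in> L\<close>. The other terms form, for each
  vertex set \<open>S\<close>, a 0-cocycle of the full subcomplex on \<open>S\<close>, which is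
  constant on connected parts; the differential of a multiple of \<open>u_S\<close> subtracts a
  constant.\<close>

lemma represent:
  assumes z: "z \<in> kgr m n" and n: "0 < n" and dz: "kdiff m z \<in> knull K"
  shows "\<exists>b\<in>B \<inter> kgr m n. \<exists>w\<in>kgr m (n - 1). z - b - kdiff m w \<in> knull K"
proof -
  define lk where "lk f L \<alpha> = Poly_Mapping.lookup (kcoeff f L) \<alpha>" for f :: "'k kform" and L \<alpha>
  have coc: "(\<Sum>i\<in>{i \<in> {1..m} - L. Poly_Mapping.lookup \<alpha> i \<noteq> 0}. sgn_shuffle {i} L * lk z (insert i L) (\<alpha> - vexp i)) = 0"
    if "Poly_Mapping.keys \<alpha> \<in> K" for L \<alpha>
    using cocycle[OF dz that, of L] unfolding lookup_kdiff' lk_def .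
  \<comment> \<open>The vertex at which the 0-cochain on \<open>S\<close> is normalised to 0.
    Choosing \<open>a\<close> removes the only term without exterior factor \<open>a\<close>; if
    \<open>a\<close> is not in \<open>S\<close>, the full subcomplex has all edges and any vertex
    serves.\<close>
  define pick where "pick S = (if a \<in> S then a else Min S)" for S :: "nat set"
  define c where "c S \<alpha> = (if \<alpha> = 0 then sgn_shuffle {pick S} (S - {pick S}) * lk z (S - {pick S}) (vexp (pick S)) else 0)"
    for S and \<alpha> :: "nat \<Rightarrow>\<^sub>0 nat"
  obtain w where w: "w \<in> kgr m (n - 1)"
    "\<And>L \<alpha>. Poly_Mapping.lookup (kcoeff w L) \<alpha> = (if kind m (n - 1) L \<alpha> then c L \<alpha> else 0)"
    using kgr_exists[of m "n - 1" c] by blast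
  define b where "b = z - kdiff m w"
  have bgr: "b \<in> kgr m n"
    unfolding b_def kgr_eq using z kgr_kdiff[OF w(1)] by (intro kspan_diff) (simp_all add: kgr_eq)
  have "b \<in> B"
    unfolding B_def
  proof (rule kspanI, rule ccontr)
    fix L \<alpha>
    assume nz: "Poly_Mapping.lookup (kcoeff b L) \<alpha> \<noteq> 0"
      and no: "\<not> (2 \<le> pdeg m \<alpha> \<or> 1 \<le> pdeg m \<alpha> \<and> a \<in> L)"
    have kd: "kind m n L \<alpha>" using kgrD[OF bgr] nz by blast
    then have L: "L \<subseteq> {1..m}" and keys: "Poly_Mapping.keys \<alpha> \<subseteq> {1..m}" by (auto simp: kind_def)
    have finL: "finite L" using L finite_subset by blast
    have coeff: "Poly_Mapping.lookup (kcoeff b L) \<alpha> = lk z L \<alpha> -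
       (\<Sum>i\<in>{i \<in> {1..m} - L. Poly_Mapping.lookup \<alpha> i \<noteq> 0}. sgn_shuffle {i} L * c (insert i L) (\<alpha> - vexp i))"
      unfolding b_def lk_def
      by (auto simp: kform_rep_eqs lookup_minus lookup_kdiff' w(2) kind_insert[OF kd] intro!: sum.cong)
    consider "pdeg m \<alpha> = 0" | "pdeg m \<alpha> = 1" "a \<notin> L" using no by linarith
    then show False
    proof cases
      case 1
      then have "\<alpha> = 0" using keys pdeg_eq_0 by blast
      then have "int (card L) = n" using kd 1 by (simp add: kind_def)
      with n obtain i where i: "i \<in> L" by fastforce
      have "{j \<in> {1..m} - (L - {i}). Poly_Mapping.lookup (vexp i) j \<noteq> 0} = {i}"
        using i L by (auto simp: lookup_vexp)
      then have "sgn_shuffle {i} (L - {i}) * lk z L 0 = 0"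
        using coc[of "vexp i" "L - {i}"] i L vertex[of i] by (auto simp: vexp_def insert_absorb)
      then have "lk z L 0 = 0" by (metis mult_zero_right sgn_shuffle_sq(2))
      then show False using nz coeff \<open>\<alpha> = 0\<close> by simp
    next
      case 2
      obtain i where i: "i \<in> {1..m}" "Poly_Mapping.lookup \<alpha> i \<noteq> 0"
        using 2(1) unfolding pdeg_def by (metis sum.neutral zero_neq_one)
      then have "pdeg m (\<alpha> - vexp i) = 0" using 2(1) pdeg_minus_vexp[of i m \<alpha>] by simp
      moreover have "Poly_Mapping.keys (\<alpha> - vexp i) \<subseteq> {1..m}"
        using keys by (auto simp: in_keys_iff lookup_minus subset_iff)
      ultimately have "\<alpha> - vexp i = 0" using pdeg_eq_0 by blast
      then have \<alpha>: "\<alpha> = vexp i" using vexp_minus_plus[OF i(2)] by simp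
      have z0: "lk z L (vexp i) = (if i \<in> L then 0 else sgn_shuffle {i} L * c (insert i L) 0)"
      proof (cases "i \<in> L")
        case True
        have "{j \<in> {1..m} - (L - {i}). Poly_Mapping.lookup (vexp i + vexp i) j \<noteq> 0} = {i}"
          using True L by (auto simp: lookup_vexp lookup_add)
        moreover have "Poly_Mapping.keys (vexp i + vexp i) = {i}"
          by (auto simp: in_keys_iff lookup_vexp lookup_add split: if_splits)
        ultimately have "sgn_shuffle {i} (L - {i}) * lk z L (vexp i) = 0"
          using coc[of "vexp i + vexp i" "L - {i}"] True vertex[OF i(1)] by (simp add: insert_absorb)
        then show ?thesis using True by (metis mult_zero_right sgn_shuffle_sq(2))
      next
        case False
        define S where "S = insert i L"
        define j where "j = pick S"
        have "finite S" "S \<noteq> {}" using finL by (auto simp: S_def)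
        then have jS: "j \<in> S" by (auto simp: j_def pick_def)
        have cS: "c S 0 = sgn_shuffle {j} (S - {j}) * lk z (S - {j}) (vexp j)"
          by (simp add: c_def j_def)
        show ?thesis
        proof (cases "j = i")
          case True
          then have "S - {j} = L" using False by (auto simp: S_def)
          then show ?thesis using cS False True by (simp add: S_def)
        next
          case neq: False
          then have jL: "j \<in> L" using jS by (simp add: S_def)
          have ia: "i \<noteq> a" using neq by (auto simp: j_def pick_def S_def)
          have ja: "j \<noteq> a" using jL 2(2) by auto
          \<comment> \<open>Both \<open>i\<close> and \<open>j\<close> differ from \<open>a\<close>,
            so the cocycle condition at the edge \<open>{i, j}\<close> compares the values at these
            two vertices.\<close>
          define M where "M = L - {j}"
          have M: "i \<notin> M" "j \<notin> M" "L = insert j M" "S - {j} = insert i M"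
            using jL False neq by (auto simp: M_def S_def)
          have "{k \<in> {1..m} - M. Poly_Mapping.lookup (vexp i + vexp j) k \<noteq> 0} = {i, j}"
            using i(1) jL L M by (auto simp: lookup_vexp lookup_add split: if_splits)
          moreover have "Poly_Mapping.keys (vexp i + vexp j) = {i, j}"
            by (auto simp: in_keys_iff lookup_vexp lookup_add split: if_splits)
          moreover have "vexp i + vexp j - vexp i = vexp j" "vexp i + vexp j - vexp j = vexp i"
            by simp_all
          ultimately have eq: "sgn_shuffle {i} M * lk z (insert i M) (vexp j) + sgn_shuffle {j} M * lk z L (vexp i) = 0"
            using coc[of "vexp i + vexp j" M] edges[of i j] i(1) ia ja jL L neq M(3) by (simp add: subset_iff)
          have s1: "sgn_shuffle {i} (insert j M) = (sgn_shuffle {i} {j} * sgn_shuffle {i} M :: 'k)"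
            and s2: "sgn_shuffle {j} (insert i M) = (sgn_shuffle {j} {i} * sgn_shuffle {j} M :: 'k)"
            by (rule sgn_shuffle_single_insert; use M(1,2) neq in simp)+
          have "sgn_shuffle {i} L * c S 0 =
              sgn_shuffle {i} (insert j M) * (sgn_shuffle {j} (insert i M) * lk z (insert i M) (vexp j))"
            unfolding cS M(4) using M(3) by simp
          also have "\<dots> = (sgn_shuffle {i} {j} * sgn_shuffle {j} {i}) * sgn_shuffle {j} M * (sgn_shuffle {i} M * lk z (insert i M) (vexp j))"
            unfolding s1 s2 by (simp only: mult_ac)
          also have "\<dots> = - sgn_shuffle {j} M * (sgn_shuffle {i} M * lk z (insert i M) (vexp j))"
            using neq by (simp add: sgn_shuffle_ij)
          also have "\<dots> = lk z L (vexp i)"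
            using eq by (simp add: eq_neg_iff_add_eq_0[symmetric])
          finally show ?thesis using False by (simp add: S_def)
        qed
      qed
      have idx: "{k \<in> {1..m} - L. Poly_Mapping.lookup (vexp i) k \<noteq> 0} = (if i \<in> L then {} else {i})"
        using i(1) by (auto simp: lookup_vexp)
      have "Poly_Mapping.lookup (kcoeff b L) \<alpha> = 0"
        unfolding coeff unfolding \<alpha> idx z0 by simp
      then show False using nz by simp
    qed
  qed
  moreover have "z - b - kdiff m w \<in> knull K" by (simp add: b_def knull_def kspan_zero)
  ultimately show ?thesis using bgr w(1) by blast
qed

text \<open>The exponent of \<open>i\<close> in the multidegree of \<open>u_L v^\<alpha>\<close>;
  the differential preserves it.\<close>

definition vmult :: "nat set \<Rightarrow> (nat \<Rightarrow>\<^sub>0 nat) \<Rightarrow> nat \<Rightarrow> nat" where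
  "vmult L \<alpha> i = Poly_Mapping.lookup \<alpha> i + (if i \<in> L then 1 else 0)"

lemma vmult_insert:
  assumes "j \<notin> L" "Poly_Mapping.lookup \<alpha> j \<noteq> 0"
  shows "vmult (insert j L) (\<alpha> - vexp j) = vmult L \<alpha>"
  using assms by (auto simp: vmult_def fun_eq_iff lookup_minus lookup_vexp)

text \<open>In multidegrees with a component at least 2 the Koszul complex is contracted by moving one
  power of the least such variable to the exterior factor; in squarefree multidegrees it is the
  cochain complex of a full subcomplex.\<close>

lemma exact:
  assumes z: "z \<in> F 3" "z \<in> kgr m n" and dz: "kdiff m z \<in> knull K"
  shows "\<exists>w\<in>F 2 \<inter> kgr m (n - 1). kdiff m w - z \<in> knull K"
proof -
  define lk where "lk f L \<alpha> = Poly_Mapping.lookup (kcoeff f L) \<alpha>" for f :: "'k kform" and L \<alpha>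
  have coc: "(\<Sum>i\<in>{i \<in> {1..m} - L. Poly_Mapping.lookup \<alpha> i \<noteq> 0}. sgn_shuffle {i} L * lk z (insert i L) (\<alpha> - vexp i)) = 0"
    if "Poly_Mapping.keys \<alpha> \<in> K" for L \<alpha>
    using cocycle[OF dz that, of L] unfolding lookup_kdiff' lk_def .
  \<comment> \<open>Signs that turn the Koszul differential in the squarefree multidegree
    \<open>I\<close> into the simplicial coboundary.\<close>
  define eps where "eps I \<sigma> = (\<Prod>l\<in>\<sigma>. sgn_shuffle {l} I :: 'k)" for I \<sigma>
  \<comment> \<open>The part of \<open>z\<close> in multidegree \<open>I\<close> as a 2-cochain,
    extended by 0 from the full subcomplex on \<open>I\<close> to \<open>K\<close>.\<close>
  define g where "g I \<tau> = (if \<tau> \<subseteq> I then eps I \<tau> * lk z (I - \<tau>) (indicator_exp \<tau>) else 0)" for I \<tau>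
  define least where "least L \<alpha> = (LEAST i. 2 \<le> vmult L \<alpha> i)" for L \<alpha>
  \<comment> \<open>Coefficients of degree below 2 are set to 0 to place \<open>w\<close> in
    \<open>F 2\<close>; as \<open>z\<close> starts in degree 3, nothing is lost.\<close>
  define c where "c L \<alpha> = (if pdeg m \<alpha> < 2 then 0
     else if \<exists>i. 2 \<le> vmult L \<alpha> i then
       (if least L \<alpha> \<in> L then sgn_shuffle {least L \<alpha>} (L - {least L \<alpha>}) *
           lk z (L - {least L \<alpha>}) (\<alpha> + vexp (least L \<alpha>)) else 0)
     else eps (L \<union> Poly_Mapping.keys \<alpha>) (Poly_Mapping.keys \<alpha>) *
        solve (g (L \<union> Poly_Mapping.keys \<alpha>)) (Poly_Mapping.keys \<alpha>))" for L \<alpha>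
  obtain w where w: "w \<in> kgr m (n - 1)"
    "\<And>L \<alpha>. Poly_Mapping.lookup (kcoeff w L) \<alpha> = (if kind m (n - 1) L \<alpha> then c L \<alpha> else 0)"
    using kgr_exists[of m "n - 1" c] by blast
  have "w \<in> F 2"
    unfolding F_def by (rule kspanI) (auto simp: w(2) c_def not_less split: if_splits)
  moreover have "kdiff m w - z \<in> knull K"
    unfolding knull_def
  proof (rule kspanI, rule notI)
    fix L \<alpha>
    assume nz: "Poly_Mapping.lookup (kcoeff (kdiff m w - z) L) \<alpha> \<noteq> 0" and kK: "Poly_Mapping.keys \<alpha> \<in> K"
    have "kdiff m w - z \<in> kgr m n"
      unfolding kgr_eq using z kgr_kdiff[OF w(1)] by (intro kspan_diff) (simp_all add: kgr_eq)
    then have kd: "kind m n L \<alpha>" using kgrD nz by blast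
    then have L: "L \<subseteq> {1..m}" and keys: "Poly_Mapping.keys \<alpha> \<subseteq> {1..m}" by (auto simp: kind_def)
    have finL: "finite L" using L finite_subset by blast
    define X where "X = {j \<in> {1..m} - L. Poly_Mapping.lookup \<alpha> j \<noteq> 0}"
    have finX: "finite X" by (simp add: X_def)
    have "Poly_Mapping.lookup (kcoeff (kdiff m w) L) \<alpha> = (\<Sum>j\<in>X. sgn_shuffle {j} L * c (insert j L) (\<alpha> - vexp j))"
      unfolding lookup_kdiff' X_def by (rule sum.cong) (auto simp: w(2) kind_insert[OF kd])
    also have "\<dots> = lk z L \<alpha>"
    proof (cases "pdeg m \<alpha> < 3")
      case True
      then have "lk z L \<alpha> = 0"
        using z(1) unfolding F_def lk_def by (metis kspanD not_less)
      moreover have "c (insert j L) (\<alpha> - vexp j) = 0" if "j \<in> X" for j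
        using that True pdeg_minus_vexp[of j m \<alpha>] by (simp add: c_def X_def)
      ultimately show ?thesis by simp
    next
      case False
      then have pd: "\<not> pdeg m (\<alpha> - vexp j) < 2" if "j \<in> X" for j
        using that pdeg_minus_vexp[of j m \<alpha>] by (simp add: X_def)
      have vm: "vmult (insert j L) (\<alpha> - vexp j) = vmult L \<alpha>" if "j \<in> X" for j
        by (rule vmult_insert) (use that in \<open>auto simp: X_def\<close>)
      show ?thesis
      proof (cases "\<exists>i. 2 \<le> vmult L \<alpha> i")
        case ns: True
        define i where "i = least L \<alpha>"
        have i2: "2 \<le> vmult L \<alpha> i" using ns unfolding i_def least_def by (rule LeastI_ex)
        \<comment> \<open>The exterior factor accounts for at most 1, so \<open>v_i\<close> divides
          the monomial. Hence multiplying by \<open>v_i\<close> keeps the support, which remains a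
          face.\<close>
        then have ai: "Poly_Mapping.lookup \<alpha> i \<noteq> 0" by (auto simp: vmult_def split: if_splits)
        have im: "i \<in> {1..m}" by (rule subsetD[OF keys]) (use ai in \<open>simp add: in_keys_iff\<close>)
        have cj: "c (insert j L) (\<alpha> - vexp j) = (if i \<in> insert j L then sgn_shuffle {i} (insert j L - {i}) *
             lk z (insert j L - {i}) (\<alpha> - vexp j + vexp i) else 0)" if "j \<in> X" for j
          using pd[OF that] ns unfolding c_def least_def vm[OF that] i_def by simp
        show ?thesis
        proof (cases "i \<in> L")
          case False
          then have iX: "i \<in> X" using im ai by (simp add: X_def)
          have "(\<Sum>j\<in>X. sgn_shuffle {j} L * c (insert j L) (\<alpha> - vexp j)) =
             (\<Sum>j\<in>X. if j = i then sgn_shuffle {i} L * (sgn_shuffle {i} L * lk z L \<alpha>) else 0)"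
          proof (rule sum.cong[OF refl])
            fix j assume j: "j \<in> X"
            show "sgn_shuffle {j} L * c (insert j L) (\<alpha> - vexp j) =
               (if j = i then sgn_shuffle {i} L * (sgn_shuffle {i} L * lk z L \<alpha>) else 0)"
              unfolding cj[OF j] using False by (auto simp: vexp_minus_plus[OF ai])
          qed
          also have "\<dots> = lk z L \<alpha>" using iX finX by simp
          finally show ?thesis .
        next
          case True
          \<comment> \<open>The cocycle condition one power of \<open>v_i\<close> higher expresses
            the coefficient at \<open>L\<close> by those at \<open>insert j M\<close>. This is the
            homotopy identity; the sign comes from exchanging \<open>i\<close> and
            \<open>j\<close>.\<close>
          define M where "M = L - {i}"
          have M: "i \<notin> M" "L = insert i M" using True by (auto simp: M_def)
          have iX: "i \<notin> X" using True by (simp add: X_def)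
          have "Poly_Mapping.keys (\<alpha> + vexp i) = Poly_Mapping.keys \<alpha>"
            using ai by (auto simp: in_keys_iff lookup_add lookup_vexp split: if_splits)
          moreover have "{j \<in> {1..m} - M. Poly_Mapping.lookup (\<alpha> + vexp i) j \<noteq> 0} = insert i X"
            using im M by (auto simp: X_def lookup_add lookup_vexp split: if_splits)
          ultimately have "(\<Sum>j\<in>insert i X. sgn_shuffle {j} M * lk z (insert j M) (\<alpha> + vexp i - vexp j)) = 0"
            using coc[of "\<alpha> + vexp i" M] kK by simp
          then have eq: "(\<Sum>j\<in>X. sgn_shuffle {j} M * lk z (insert j M) (\<alpha> + vexp i - vexp j)) = - (sgn_shuffle {i} M * lk z L \<alpha>)"
            using iX finX M(2) by (simp add: eq_neg_iff_add_eq_0 add.commute)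
          have "(\<Sum>j\<in>X. sgn_shuffle {j} L * c (insert j L) (\<alpha> - vexp j)) =
             (\<Sum>j\<in>X. - sgn_shuffle {i} M * (sgn_shuffle {j} M * lk z (insert j M) (\<alpha> + vexp i - vexp j)))"
          proof (rule sum.cong[OF refl])
            fix j assume j: "j \<in> X"
            then have jM: "j \<notin> M" "j \<noteq> i" "Poly_Mapping.lookup \<alpha> j \<noteq> 0" using M True by (auto simp: X_def)
            have 1: "insert j L - {i} = insert j M" using M jM by auto
            have 2: "\<alpha> - vexp j + vexp i = \<alpha> + vexp i - vexp j"
              using jM by (intro exp_eqI) (auto simp: lookup_add lookup_minus lookup_vexp)
            have s1: "sgn_shuffle {i} (insert j M) = (sgn_shuffle {i} {j} * sgn_shuffle {i} M :: 'k)"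
              and s2: "sgn_shuffle {j} (insert i M) = (sgn_shuffle {j} {i} * sgn_shuffle {j} M :: 'k)"
              by (rule sgn_shuffle_single_insert; use M(1) jM in simp)+
            have "sgn_shuffle {j} L * c (insert j L) (\<alpha> - vexp j) =
                sgn_shuffle {j} (insert i M) * (sgn_shuffle {i} (insert j M) * lk z (insert j M) (\<alpha> + vexp i - vexp j))"
              unfolding cj[OF j] 1 2 using True M(2) by simp
            also have "\<dots> = (sgn_shuffle {i} {j} * sgn_shuffle {j} {i}) * sgn_shuffle {i} M *
                (sgn_shuffle {j} M * lk z (insert j M) (\<alpha> + vexp i - vexp j))"
              unfolding s1 s2 by (simp only: mult_ac)
            finally show "sgn_shuffle {j} L * c (insert j L) (\<alpha> - vexp j) =
                - sgn_shuffle {i} M * (sgn_shuffle {j} M * lk z (insert j M) (\<alpha> + vexp i - vexp j))"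
              using jM by (simp add: sgn_shuffle_ij)
          qed
          also have "\<dots> = - sgn_shuffle {i} M * - (sgn_shuffle {i} M * lk z L \<alpha>)"
            unfolding sum_distrib_left[symmetric] eq ..
          finally show ?thesis by simp
        qed
      next
        case sf: False
        define \<tau> where "\<tau> = Poly_Mapping.keys \<alpha>"
        have fin\<tau>: "finite \<tau>" by (simp add: \<tau>_def)
        have le1: "Poly_Mapping.lookup \<alpha> i + (if i \<in> L then 1 else 0) \<le> 1" for i
        proof -
          have "\<not> 2 \<le> vmult L \<alpha> i" using sf by blast
          then show ?thesis unfolding vmult_def by linarith
        qed
        have disj: "\<tau> \<inter> L = {}"
        proof (rule ccontr)
          assume "\<tau> \<inter> L \<noteq> {}"
          then obtain i where "i \<in> L" "Poly_Mapping.lookup \<alpha> i \<noteq> 0" by (auto simp: \<tau>_def in_keys_iff)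
          then show False using le1[of i] by simp
        qed
        have X: "X = \<tau>" using disj keys by (auto simp: X_def \<tau>_def in_keys_iff)
        have \<alpha>: "\<alpha> = indicator_exp \<tau>"
        proof (rule exp_eqI)
          fix i
          show "Poly_Mapping.lookup \<alpha> i = Poly_Mapping.lookup (indicator_exp \<tau>) i"
            using le1[of i] fin\<tau> by (auto simp: lookup_indicator_exp \<tau>_def in_keys_iff split: if_splits)
        qed
        have "pdeg m \<alpha> = card \<tau>"
        proof -
          have "pdeg m \<alpha> = (\<Sum>i\<in>{1..m}. if i \<in> \<tau> then 1 else 0)"
            unfolding pdeg_def by (subst \<alpha>) (simp add: lookup_indicator_exp fin\<tau>)
          also have "\<dots> = card ({1..m} \<inter> \<tau>)" by (simp add: sum.If_cases)
          also have "{1..m} \<inter> \<tau> = \<tau>" using keys by (auto simp: \<tau>_def)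
          finally show ?thesis .
        qed
        \<comment> \<open>Degree at least 3 and dimension at most 2 leave only triangles.\<close>
        then have card: "card \<tau> = 3" using False dim[OF kK] by (simp add: \<tau>_def)
        define I where "I = L \<union> \<tau>"
        have finI: "finite I" using finL fin\<tau> by (simp add: I_def)
        have sgn_I: "sgn_shuffle {j} I = sgn_shuffle {j} \<tau> * (sgn_shuffle {j} L :: 'k)" for j
          unfolding I_def using finL fin\<tau> disj by (subst sgn_shuffle_Un_right) (auto simp: mult.commute)
        have "(\<Sum>j\<in>X. sgn_shuffle {j} L * c (insert j L) (\<alpha> - vexp j)) =
            (\<Sum>j\<in>\<tau>. eps I \<tau> * (sgn_shuffle {j} \<tau> * solve (g I) (\<tau> - {j})))"
          unfolding X
        proof (rule sum.cong[OF refl])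
          fix j assume j: "j \<in> \<tau>"
          then have jX: "j \<in> X" by (simp add: X)
          have keys': "Poly_Mapping.keys (\<alpha> - vexp j) = \<tau> - {j}"
            by (subst \<alpha>) (auto simp: in_keys_iff lookup_minus lookup_indicator_exp fin\<tau> lookup_vexp split: if_splits)
          have I': "insert j L \<union> (\<tau> - {j}) = I" using j by (auto simp: I_def)
          have c: "c (insert j L) (\<alpha> - vexp j) = eps I (\<tau> - {j}) * solve (g I) (\<tau> - {j})"
            using pd[OF jX] sf unfolding c_def vm[OF jX] keys' I' by simp
          have "eps I \<tau> = sgn_shuffle {j} I * eps I (\<tau> - {j})"
            unfolding eps_def using j fin\<tau> by (rule prod.remove[rotated])
          then have "eps I \<tau> * sgn_shuffle {j} \<tau> = sgn_shuffle {j} L * eps I (\<tau> - {j})"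
            by (simp add: sgn_I mult_ac)
          then show "sgn_shuffle {j} L * c (insert j L) (\<alpha> - vexp j) =
              eps I \<tau> * (sgn_shuffle {j} \<tau> * solve (g I) (\<tau> - {j}))"
            by (simp only: c mult.assoc[symmetric])
        qed
        also have "\<dots> = eps I \<tau> * g I \<tau>"
          unfolding sum_distrib_left[symmetric] using solve[of \<tau> "g I"] kK card by (simp add: \<tau>_def)
        also have "\<dots> = (eps I \<tau> * eps I \<tau>) * lk z L \<alpha>"
        proof -
          have "I - \<tau> = L" "\<tau> \<subseteq> I" using disj by (auto simp: I_def)
          then show ?thesis unfolding g_def using \<alpha> by (simp add: mult.assoc)
        qed
        also have "eps I \<tau> * eps I \<tau> = 1"
          unfolding eps_def prod.distrib[symmetric] by simp
        finally show ?thesis by simp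
      qed
    qed
    finally show False using nz by (simp add: lk_def kform_rep_eqs lookup_minus)
  qed
  ultimately show ?thesis using w(1) by blast
qed

sublocale dg_ring_mod "kgr m" "knull K :: 'k kform set" "kdiff m"
  by (rule dg_ring_mod_koszul[OF K])

sublocale massey_trivial "kgr m" "knull K :: 'k kform set" "kdiff m" B "F 2" "F 3"
proof
  show "F 2 \<subseteq> B" unfolding F_def B_def by (auto intro: kspan_mono)
qed (use B_mult exact represent in \<open>auto simp: F_def B_def kspan_zero kspan_add kspan_minus\<close>)

lemma golod: "golod TYPE('k) m K"
proof -
  interpret sr_koszul m K "koszul_dga m K :: (nat set \<Rightarrow> 'k mpoly set) dga"
    by (rule sr_koszul.intro[OF K refl])
  have "trivial_products (koszul_dga m K :: (nat set \<Rightarrow> 'k mpoly set) dga)"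
    unfolding trivial_products_iff using product_exact by blast
  moreover have "trivial_massey_products (koszul_dga m K :: (nat set \<Rightarrow> 'k mpoly set) dga)"
    by (rule trivial_massey_productsI) (rule massey_exact)
  ultimately show ?thesis by (simp add: golod_def)
qed

end

section \<open>Oriented triangles\<close>

definition orient2 :: "nat \<Rightarrow> nat \<Rightarrow> 'k::comm_ring_1" where
  "orient2 x y = (if x < y then 1 else - 1)"

text \<open>For distinct arguments this is the sign of the permutation that sorts them.\<close>

definition orient3 :: "nat \<Rightarrow> nat \<Rightarrow> nat \<Rightarrow> 'k::comm_ring_1" where
  "orient3 x y z = orient2 x y * orient2 y z * orient2 x z"

lemma orient2_sq [simp]: "orient2 x y * orient2 x y = 1" "orient2 x y * (orient2 x y * k) = k"
  by (simp_all add: orient2_def)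

lemma orient2_swap: "x \<noteq> y \<Longrightarrow> orient2 y x = - orient2 x y"
  by (simp add: orient2_def)

lemma orient3_sq [simp]: "orient3 x y z * orient3 x y z = 1"
  by (simp add: orient3_def orient2_def)

lemma sgn_shuffle_single_self: "sgn_shuffle {x} {x} = 1"
  by (simp add: sgn_shuffle_single)

lemma sgn_shuffle_single_triangle:
  assumes "x \<noteq> y" "x \<noteq> z" "y \<noteq> z"
  shows "sgn_shuffle {x} {x, y, z} = (orient2 x y * orient2 x z :: 'k::comm_ring_1)"
proof -
  have "sgn_shuffle {x} {x, y, z} = (sgn_shuffle {x} {x} * sgn_shuffle {x} {y, z} :: 'k)"
    by (rule sgn_shuffle_insert_right) (use assms in auto)
  also have "sgn_shuffle {x} {y, z} = (sgn_shuffle {x} {y} * sgn_shuffle {x} {z} :: 'k)"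
    by (rule sgn_shuffle_insert_right) (use assms in auto)
  finally show ?thesis
    using assms by (simp add: sgn_shuffle_single_self) (auto simp: sgn_shuffle_single orient2_def)
qed

text \<open>In oriented form the coboundary is a cyclic sum, whatever the order of the vertices.
  Labels taken modulo \<open>n\<close> come in no fixed order, so facets are handled in this
  form.\<close>

lemma sum_triangle:
  assumes "x \<noteq> y" "x \<noteq> z" "y \<noteq> z" and H: "\<And>u v. u \<noteq> v \<Longrightarrow> orient2 u v * h {u, v} = (H u v :: 'k::comm_ring_1)"
  shows "(\<Sum>j\<in>{x, y, z}. sgn_shuffle {j} {x, y, z} * h ({x, y, z} - {j})) =
    orient3 x y z * (H x y + H y z + H z x)"
proof -
  have h: "h {u, v} = orient2 u v * H u v" if "u \<noteq> v" for u v
    using H[OF that] by (metis orient2_sq(2))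
  have d: "{x, y, z} - {x} = {y, z}" "{x, y, z} - {y} = {x, z}" "{x, y, z} - {z} = {x, y}"
    using assms by auto
  have s: "sgn_shuffle {x} {x, y, z} = (orient2 x y * orient2 x z :: 'k)"
    "sgn_shuffle {y} {x, y, z} = (orient2 y x * orient2 y z :: 'k)"
    "sgn_shuffle {z} {x, y, z} = (orient2 z x * orient2 z y :: 'k)"
    using sgn_shuffle_single_triangle[of x y z] sgn_shuffle_single_triangle[of y x z]
      sgn_shuffle_single_triangle[of z x y] assms by (simp_all add: insert_commute)
  have Hzx: "H z x = - H x z"
  proof -
    have "{z, x} = {x, z}" by blast
    moreover have "orient2 z x * h {z, x} = H z x" by (rule H) (use assms in simp)
    ultimately show ?thesis
      using H[OF assms(2)] orient2_swap[OF assms(2), where ?'a = 'k] by simp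
  qed
  have "(\<Sum>j\<in>{x, y, z}. sgn_shuffle {j} {x, y, z} * h ({x, y, z} - {j})) =
     sgn_shuffle {x} {x, y, z} * h {y, z} + sgn_shuffle {y} {x, y, z} * h {x, z} + sgn_shuffle {z} {x, y, z} * h {x, y}"
    using assms by (simp add: d add.assoc)
  also have "\<dots> = orient3 x y z * (H x y + H y z + H z x)"
    unfolding s h[OF assms(1)] h[OF assms(2)] h[OF assms(3)] orient3_def Hzx
      orient2_swap[OF assms(1)] orient2_swap[OF assms(2)] orient2_swap[OF assms(3)]
    by (simp add: algebra_simps)
  finally show ?thesis .
qed

section \<open>A triangulation of the mod p Moore space\<close>

locale moore_triangulation =
  fixes p :: nat
  assumes p: "2 \<le> p"
begin

definition n :: nat where "n = 2 * p + 1"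

lemma n_gt: "p < n" "2 * p < n" "0 < n" "p + 1 + p = n" "5 \<le> n"
  using p by (simp_all add: n_def)

definition V :: "nat \<Rightarrow> nat" where "V j = j mod n + 1"
text \<open>The centre and the new vertex come after the labels \<open>{1..n}\<close> of the circle;
  \<open>a\<close> is last, so that \<open>K0\<close> uses exactly \<open>{1..c}\<close>.\<close>

definition c :: nat where "c = 2 * p + 2"
definition a :: nat where "a = 2 * p + 3"

definition facets0 :: "nat set set" where
  "facets0 = {{V j, V (j + t), V (j + t + 1)} | j t. 1 \<le> t \<and> t < p} \<union> {{c, V j, V (j + p)} | j. True}"

definition facets :: "nat set set" where
  "facets = {{V j, V (j + t), V (j + t + 1)} | j t. 1 \<le> t \<and> t < p} \<union>
     {{c, V j, V (j + p)} | j. j mod n \<noteq> 0} \<union> {{a, c, V 0}, {a, V 0, V p}, {a, V p, c}}"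

definition K0 :: "nat set set" where "K0 = {\<sigma>. \<exists>\<tau>\<in>facets0. \<sigma> \<subseteq> \<tau>}"
definition K :: "nat set set" where "K = {\<sigma>. \<exists>\<tau>\<in>facets. \<sigma> \<subseteq> \<tau>}"

lemma K_I: "\<tau> \<in> facets \<Longrightarrow> \<sigma> \<subseteq> \<tau> \<Longrightarrow> \<sigma> \<in> K"
  unfolding K_def by blast

lemma K_subset: "\<sigma> \<in> K \<Longrightarrow> \<tau> \<subseteq> \<sigma> \<Longrightarrow> \<tau> \<in> K"
  unfolding K_def by blast

lemma V_mod [simp]: "V (j mod n) = V j" "V (j mod n + t) = V (j + t)"
  by (simp_all add: V_def mod_add_left_eq)

lemma V_n [simp]: "V (j + n) = V j"
  by (simp add: V_def)

lemma V_in: "V j \<in> {1..n}"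
  using mod_less_divisor[OF n_gt(3), of j] by (simp add: V_def Suc_leI)

lemma V_lt: "V j < c" "V j < a" "c < a"
  using V_in[of j] by (auto simp: n_def c_def a_def)

lemma V_neq [simp]: "V j \<noteq> c" "V j \<noteq> a" "c \<noteq> V j" "a \<noteq> V j" "a \<noteq> c" "c \<noteq> a"
  using V_lt(1,2)[of j] V_lt(3) by auto

lemma V_eq_iff: "V i = V j \<longleftrightarrow> i mod n = j mod n"
  by (simp add: V_def)

lemma V_surj: "x \<in> {1..n} \<Longrightarrow> \<exists>j<n. x = V j"
  by (rule exI[of _ "x - 1"]) (auto simp: V_def)

lemma V_add_neq:
  assumes "t < n" "s < n" "s \<noteq> t"
  shows "V (j + s) \<noteq> V (j + t)"
proof
  assume "V (j + s) = V (j + t)"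
  then have "(j + s) mod n = (j + t) mod n" by (simp add: V_eq_iff)
  then have "int (j + s) mod int n = int (j + t) mod int n" by (metis zmod_int)
  then have "int n dvd int s - int t" by (simp add: mod_eq_dvd_iff)
  moreover have "int s - int t \<noteq> 0" "\<bar>int s - int t\<bar> < int n" using assms by auto
  ultimately show False using dvd_imp_le_int[of "int s - int t" "int n"] by linarith
qed

lemma V_add_neq0:
  assumes "t < n" "0 < t"
  shows "V (j + t) \<noteq> V j" "V j \<noteq> V (j + t)"
  using V_add_neq[of t 0 j] V_add_neq[of 0 t j] assms by auto

lemma facets_card: "\<tau> \<in> facets \<Longrightarrow> card \<tau> \<le> 3"
  by (auto simp: facets_def card_insert_if)

lemma facets_sub: "\<tau> \<in> facets \<Longrightarrow> \<tau> \<subseteq> {1..a}"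
proof -
  have "V j \<in> {1..a}" for j using V_in[of j] by (auto simp: a_def n_def)
  moreover have "c \<in> {1..a}" "a \<in> {1..a}" by (auto simp: a_def c_def)
  ultimately show "\<tau> \<in> facets \<Longrightarrow> \<tau> \<subseteq> {1..a}" unfolding facets_def by blast
qed

lemma facets_cases:
  assumes "\<tau> \<in> facets"
  obtains j t where "j < n" "1 \<le> t" "t < p" "\<tau> = {V j, V (j + t), V (j + t + 1)}"
  | j where "0 < j" "j < n" "\<tau> = {c, V j, V (j + p)}"
  | "\<tau> = {a, c, V 0}" | "\<tau> = {a, V 0, V p}" | "\<tau> = {a, V p, c}"
proof -
  consider j t where "1 \<le> t" "t < p" "\<tau> = {V j, V (j + t), V (j + t + 1)}"
    | j where "j mod n \<noteq> 0" "\<tau> = {c, V j, V (j + p)}"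
    | "\<tau> = {a, c, V 0} \<or> \<tau> = {a, V 0, V p} \<or> \<tau> = {a, V p, c}"
    using assms unfolding facets_def by blast
  then show thesis
  proof cases
    case (1 j t)
    moreover have "{V j, V (j + t), V (j + t + 1)} = {V (j mod n), V (j mod n + t), V (j mod n + t + 1)}"
      by (simp only: V_mod add.assoc)
    ultimately show thesis using that(1)[of "j mod n" t] n_gt(3) by simp
  next
    case (2 j)
    then show thesis using that(2)[of "j mod n"] n_gt(3) by simp
  next
    case 3
    then show thesis using that by blast
  qed
qed

text \<open>Of the differences \<open>t\<close> and \<open>n - t\<close> of two distinct vertices
  one is at most \<open>p\<close>. A chord of length below \<open>p\<close> begins a fan triangle,
  one of length \<open>p\<close> closes the last.\<close>

lemma edge_circle: "{V i, V j} \<in> K"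
proof -
  have *: "{V i, V (i + t)} \<in> K" if "1 \<le> t" "t \<le> p" for i t
  proof (cases "t = p")
    case True
    have "{V i, V (i + (p - 1)), V (i + (p - 1) + 1)} \<in> facets"
      using p unfolding facets_def by (intro UnI1 CollectI exI[of _ i] exI[of _ "p - 1"]) auto
    moreover have "i + (p - 1) + 1 = i + t" using True p by simp
    ultimately show ?thesis by (metis K_I insertCI insert_subset empty_subsetI)
  next
    case False
    then have "{V i, V (i + t), V (i + t + 1)} \<in> facets"
      using that unfolding facets_def by (intro UnI1 CollectI exI[of _ i] exI[of _ t]) auto
    then show ?thesis by (rule K_I) blast
  qed
  define t where "t = (j mod n + (n - i mod n)) mod n"
  have j: "V j = V (i + t)" and tn: "t < n"
  proof -
    have "i mod n < n" by (rule mod_less_divisor) (rule n_gt)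
    then have "(i mod n + (j mod n + (n - i mod n))) = j mod n + n" by simp
    then have "(i + t) mod n = j mod n"
      unfolding t_def by (metis mod_add_left_eq mod_add_right_eq mod_add_self2 mod_mod_trivial)
    then show "V j = V (i + t)" by (simp add: V_eq_iff)
    show "t < n" unfolding t_def by (rule mod_less_divisor) (rule n_gt)
  qed
  consider "t = 0" | "1 \<le> t" "t \<le> p" | "p < t" by linarith
  then show ?thesis
  proof cases
    case 1
    have "{V i, V (i + 1)} \<in> K" by (rule *) (use p in auto)
    then show ?thesis using 1 j by (auto intro: K_subset)
  next
    case 2
    then show ?thesis using *[of t i] j by simp
  next
    case 3
    have "V (i + t + (n - t)) = V i" using tn V_n[of i] by (simp del: V_n)
    moreover have "{V (i + t), V (i + t + (n - t))} \<in> K"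
      by (rule *) (use 3 tn in \<open>auto simp: n_def\<close>)
    ultimately show ?thesis using j by (simp add: insert_commute)
  qed
qed

lemma edge_c: "{c, V j} \<in> K"
proof (cases "j mod n = 0")
  case True
  \<comment> \<open>The central triangle starting at \<open>V 0\<close> has been subdivided;
    \<open>V 0\<close> is also the end of the one that starts at \<open>V (p + 1)\<close>.\<close>
  then have "V j = V (p + 1 + p)" unfolding n_gt(4) by (simp add: V_eq_iff)
  moreover have "{c, V (p + 1), V (p + 1 + p)} \<in> facets"
    using p unfolding facets_def
    by (intro UnI1 UnI2 CollectI exI[of _ "p + 1"]) (simp add: n_def)
  ultimately show ?thesis by (auto intro: K_I)
next
  case False
  then have "{c, V j, V (j + p)} \<in> facets" unfolding facets_def by (intro UnI1 UnI2) auto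
  then show ?thesis by (rule K_I) blast
qed

lemma vertex_cases:
  assumes "x \<in> {1..a}"
  obtains j where "x = V j" | "x = c" | "x = a"
proof -
  have "x \<in> {1..n} \<or> x = c \<or> x = a" using assms by (auto simp: a_def c_def n_def)
  then show thesis using that V_surj by blast
qed

lemma edges:
  assumes "i \<in> {1..a} - {a}" "j \<in> {1..a} - {a}"
  shows "{i, j} \<in> K"
proof -
  have "{c} \<in> K" using edge_c[of 0] by (rule K_subset) blast
  moreover have "x = c \<or> (\<exists>j. x = V j)" if "x \<in> {1..a} - {a}" for x
    using that vertex_cases[of x] by blast
  ultimately show ?thesis
    using assms edge_circle edge_c by (metis insert_absorb2 insert_commute)
qed

lemma simplicial_complex_K: "simplicial_complex_on a K"
proof -
  have "{i} \<in> K" if "i \<in> {1..a}" for i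
  proof (cases "i = a")
    case True
    moreover have "{a, c, V 0} \<in> facets" by (simp add: facets_def)
    ultimately show ?thesis by (auto intro: K_I)
  next
    case False
    then show ?thesis using edges[of i i] that by simp
  qed
  moreover have "{} \<in> K" using edge_c[of 0] by (rule K_subset) blast
  moreover have "\<sigma> \<in> Pow {1..a}" if s: "\<sigma> \<in> K" for \<sigma>
  proof -
    obtain \<tau> where "\<tau> \<in> facets" "\<sigma> \<subseteq> \<tau>" using s unfolding K_def by blast
    then show ?thesis using facets_sub[of \<tau>] by blast
  qed
  ultimately show ?thesis
    unfolding simplicial_complex_on_def by (auto intro: K_subset)
qed

lemma dim_K: "\<sigma> \<in> K \<Longrightarrow> card \<sigma> \<le> 3"
proof -
  assume "\<sigma> \<in> K"
  then obtain \<tau> where t: "\<tau> \<in> facets" "\<sigma> \<subseteq> \<tau>" unfolding K_def by blast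
  then have "finite \<tau>" using facets_sub finite_subset by blast
  then show ?thesis using t facets_card[of \<tau>] card_mono[of \<tau> \<sigma>] by simp
qed

lemma triangle_K:
  assumes "\<tau> \<in> K" "card \<tau> = 3"
  shows "\<tau> \<in> facets"
proof -
  obtain \<rho> where r: "\<rho> \<in> facets" "\<tau> \<subseteq> \<rho>" using assms unfolding K_def by blast
  then have fin: "finite \<rho>" using facets_sub finite_subset by blast
  then have "\<tau> = \<rho>"
    using r assms facets_card[of \<rho>] by (intro card_seteq) auto
  then show ?thesis using r by simp
qed

lemma missing_edge: "x \<in> {1..a} - {a, c, V 0, V p} \<Longrightarrow> {a, x} \<notin> K"
proof
  assume x: "x \<in> {1..a} - {a, c, V 0, V p}" and "{a, x} \<in> K"
  then obtain \<tau> where "\<tau> \<in> facets" "a \<in> \<tau>" "x \<in> \<tau>" unfolding K_def by blast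
  then show False using x by (auto elim!: facets_cases)
qed

lemma missing_triangle: "{c, V 0, V p} \<notin> K"
proof
  have 1: "V 0 \<noteq> V p" using V_add_neq0[of p 0] p n_gt by simp
  assume "{c, V 0, V p} \<in> K"
  then have "{c, V 0, V p} \<in> facets"
    by (rule triangle_K) (use 1 in simp)
  then show False
  proof (cases rule: facets_cases)
    case (1 j t)
    then have "c \<in> {V j, V (j + t), V (j + t + 1)}" by blast
    then show ?thesis by simp
  next
    case (2 j)
    have "V 0 \<noteq> V j" using 2 V_add_neq0[of j 0] by simp
    moreover have "V 0 \<in> {c, V j, V (j + p)}" "V p \<in> {c, V j, V (j + p)}" using 2 by blast+
    ultimately have "V 0 = V (j + p)" by simp
    moreover have "V p \<noteq> V (j + p)" using V_add_neq0[of j p] 2 by (simp add: add.commute)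
    then have "V p = V j" using \<open>V p \<in> {c, V j, V (j + p)}\<close> by simp
    \<comment> \<open>So 2p would be divisible by 2p + 1.\<close>
    ultimately have "(j + p) mod n = 0" "j = p" using p 2(2) n_gt by (auto simp: V_eq_iff)
    then show ?thesis using p n_gt(2) by (simp add: mult_2)
  next
    case 3
    then have "a \<in> {c, V 0, V p}" by blast
    then show ?thesis by simp
  next
    case 4
    then have "a \<in> {c, V 0, V p}" by blast
    then show ?thesis by simp
  next
    case 5
    then have "a \<in> {c, V 0, V p}" by blast
    then show ?thesis by simp
  qed
qed

section \<open>The fundamental chain and its boundary\<close>

definition fund :: "(nat \<Rightarrow> nat \<Rightarrow> nat \<Rightarrow> 'k::comm_ring_1) \<Rightarrow> 'k" where
  "fund g = (\<Sum>j<n. \<Sum>t\<in>{1..<p}. g (V j) (V (j + t)) (V (j + t + 1))) +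
     (\<Sum>j\<in>{1..<n}. g c (V j) (V (j + p))) + g a c (V 0) + g a (V 0) (V p) + g a (V p) c"

lemma sum_shift_V: "(\<Sum>j<n. f (V (j + t))) = (\<Sum>j<n. f (V j) :: 'b::ab_group_add)"
proof (induction t)
  case (Suc t)
  have "(\<Sum>j<n. f (V (j + Suc t))) = (\<Sum>j<n. f (V (Suc j + t)))" by simp
  also have "\<dots> = (\<Sum>j<n. f (V (j + t)))"
  proof -
    have "f (V (0 + t)) + (\<Sum>j<n. f (V (Suc j + t))) = (\<Sum>j<Suc n. f (V (j + t)))"
      by (rule sum.lessThan_Suc_shift[symmetric])
    also have "\<dots> = (\<Sum>j<n. f (V (j + t))) + f (V (t + n))"
      by (simp add: add.commute)
    finally show ?thesis using V_n[of t] by (simp add: add.commute)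
  qed
  finally show ?case using Suc by simp
qed simp

text \<open>The boundary of the disc runs \<open>p\<close> times round the circle: each circle edge
  occurs once in each of the \<open>p\<close> positions on the boundary of a sector. Chords and
  spokes cancel in pairs.\<close>

lemma fund_coboundary:
  fixes H :: "nat \<Rightarrow> nat \<Rightarrow> 'k::comm_ring_1"
  assumes H: "\<And>x y. x \<noteq> y \<Longrightarrow> H y x = - H x y"
  shows "fund (\<lambda>x y z. H x y + H y z + H z x) = of_nat p * (\<Sum>j<n. H (V j) (V (j + 1)))"
proof -
  define S where "S = (\<Sum>j<n. H (V j) (V (j + 1)))"
  define T where "T = (\<Sum>j<n. H (V j) (V (j + p)))"
  \<comment> \<open>The boundary of the part of the fan up to the chord of length
    \<open>q\<close>.\<close>
  have tel: "(\<Sum>t\<in>{1..<q}. H (V j) (V (j + t)) + H (V (j + t)) (V (j + t + 1)) + H (V (j + t + 1)) (V j)) =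
      H (V j) (V (j + 1)) - H (V j) (V (j + q)) + (\<Sum>t\<in>{1..<q}. H (V (j + t)) (V (j + t + 1)))"
    if "1 \<le> q" "q \<le> p" for j q
    using that
  proof (induction q rule: dec_induct)
    case (step q)
    have "H (V (j + q + 1)) (V j) = - H (V j) (V (j + q + 1))"
      using V_add_neq0(2)[of "q + 1" j] step p n_gt by (intro H) (auto simp: add.assoc)
    then show ?case using step by simp
  qed simp
  have "(\<Sum>j<n. \<Sum>t\<in>{1..<p}. H (V j) (V (j + t)) + H (V (j + t)) (V (j + t + 1)) + H (V (j + t + 1)) (V j))
      = (\<Sum>j<n. H (V j) (V (j + 1)) - H (V j) (V (j + p)) + (\<Sum>t\<in>{1..<p}. H (V (j + t)) (V (j + t + 1))))"
    by (rule sum.cong[OF refl], rule tel) (use p in auto)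
  also have "\<dots> = S - T + (\<Sum>t\<in>{1..<p}. \<Sum>j<n. H (V (j + t)) (V (j + t + 1)))"
    unfolding S_def T_def sum.distrib sum_subtractf by (subst sum.swap) (rule refl)
  also have "(\<Sum>t\<in>{1..<p}. \<Sum>j<n. H (V (j + t)) (V (j + t + 1))) = (\<Sum>t\<in>{1..<p}. S)"
  proof (rule sum.cong[OF refl])
    fix t
    have succ: "V (i + 1) = V (V i)" for i
      by (simp add: V_def mod_Suc_eq)
    have "(\<Sum>j<n. H (V (j + t)) (V (j + t + 1))) = (\<Sum>j<n. H (V (j + t)) (V (V (j + t))))"
      by (rule sum.cong[OF refl]) (simp only: succ)
    also have "\<dots> = (\<Sum>j<n. H (V j) (V (V j)))"
      by (rule sum_shift_V)
    also have "\<dots> = S" unfolding S_def by (rule sum.cong[OF refl]) (simp only: succ)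
    finally show "(\<Sum>j<n. H (V (j + t)) (V (j + t + 1))) = S" .
  qed
  finally have 1: "(\<Sum>j<n. \<Sum>t\<in>{1..<p}. H (V j) (V (j + t)) + H (V (j + t)) (V (j + t + 1)) + H (V (j + t + 1)) (V j))
      = S - T + of_nat (p - 1) * S" by simp
  have split0: "(\<Sum>j<n. f j) = f 0 + (\<Sum>j\<in>{1..<n}. f j)" for f :: "nat \<Rightarrow> 'k"
  proof -
    have "{..<n} = insert 0 {1..<n}" using n_gt(3) by auto
    then show ?thesis by simp
  qed
  have "(\<Sum>j<n. H c (V j) + H (V j) (V (j + p)) + H (V (j + p)) c) =
      (\<Sum>j<n. H c (V j)) + T - (\<Sum>j<n. H c (V (j + p)))"
    unfolding T_def using H[of c] by (simp add: sum.distrib sum_negf sum_subtractf)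
  also have "\<dots> = T" by (simp add: sum_shift_V)
  finally have 2: "(\<Sum>j\<in>{1..<n}. H c (V j) + H (V j) (V (j + p)) + H (V (j + p)) c) =
      T - (H c (V 0) + H (V 0) (V p) + H (V p) c)"
    unfolding split0 by (simp add: algebra_simps)
  \<comment> \<open>With these, the three triangles at \<open>a\<close> together have the boundary
    of the triangle \<open>c, V 0, V p\<close> left out of the sum.\<close>
  have 3: "H c a = - H a c" "H (V 0) a = - H a (V 0)" "H (V p) a = - H a (V p)"
    "H (V 0) c = - H c (V 0)" "H (V p) c = - H c (V p)"
    by (rule H, simp)+
  have "p = Suc (p - 1)" using p by simp
  then have "of_nat p = (of_nat (Suc (p - 1)) :: 'k)" by (rule arg_cong)
  then have "of_nat p = (of_nat (p - 1) + 1 :: 'k)" by (simp add: add.commute)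
  then show ?thesis
    unfolding fund_def 1 2 S_def[symmetric] by (simp add: 3 algebra_simps)
qed

lemma facets_I:
  "1 \<le> t \<Longrightarrow> t < p \<Longrightarrow> {V j, V (j + t), V (j + t + 1)} \<in> facets"
  "j \<in> {1..<n} \<Longrightarrow> {c, V j, V (j + p)} \<in> facets"
  "{a, c, V 0} \<in> facets" "{a, V 0, V p} \<in> facets" "{a, V p, c} \<in> facets"
  unfolding facets_def by (blast, rule UnI1, rule UnI2, rule CollectI, rule exI[of _ j], simp, blast+)

lemma distinct_V:
  assumes "1 \<le> t" "t < p"
  shows "V j \<noteq> V (j + t)" "V j \<noteq> V (j + t + 1)" "V (j + t) \<noteq> V (j + t + 1)" "V j \<noteq> V (j + p)"
  using V_add_neq0[of t j] V_add_neq0[of "t + 1" j] V_add_neq0[of 1 "j + t"] V_add_neq0[of p j] assms n_gt(1)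
  by (auto simp: add.assoc)

lemma V_p_neq: "V j \<noteq> V (j + p)" "V 0 \<noteq> V p"
  using V_add_neq0[of p j] V_add_neq0[of p 0] p n_gt(1) by auto

lemma fund_cong:
  assumes "\<And>x y z. {x, y, z} \<in> facets \<Longrightarrow> x \<noteq> y \<Longrightarrow> x \<noteq> z \<Longrightarrow> y \<noteq> z \<Longrightarrow> g x y z = g' x y z"
  shows "fund g = fund g'"
proof -
  have 1: "(\<Sum>j<n. \<Sum>t\<in>{1..<p}. g (V j) (V (j + t)) (V (j + t + 1))) =
      (\<Sum>j<n. \<Sum>t\<in>{1..<p}. g' (V j) (V (j + t)) (V (j + t + 1)))"
    by (intro sum.cong refl assms facets_I(1) distinct_V) auto
  have 2: "(\<Sum>j\<in>{1..<n}. g c (V j) (V (j + p))) = (\<Sum>j\<in>{1..<n}. g' c (V j) (V (j + p)))"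
    by (intro sum.cong refl assms facets_I(2) V_p_neq) auto
  have 3: "g a c (V 0) = g' a c (V 0)" "g a (V 0) (V p) = g' a (V 0) (V p)" "g a (V p) c = g' a (V p) c"
    using V_p_neq(2) by (intro assms facets_I(3-5); auto)+
  show ?thesis unfolding fund_def 1 2 3 ..
qed

section \<open>Primitives of 2-cochains in characteristic 0\<close>

lemma solve_from_H:
  fixes H :: "nat \<Rightarrow> nat \<Rightarrow> 'k::comm_ring_1"
  assumes H: "\<And>x y. x \<noteq> y \<Longrightarrow> H y x = - H x y"
    and cyc: "\<And>j t. j < n \<Longrightarrow> 1 \<le> t \<Longrightarrow> t < p \<Longrightarrow>
        H (V j) (V (j + t)) + H (V (j + t)) (V (j + t + 1)) + H (V (j + t + 1)) (V j) =
        orient3 (V j) (V (j + t)) (V (j + t + 1)) * G {V j, V (j + t), V (j + t + 1)}"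
      "\<And>j. 0 < j \<Longrightarrow> j < n \<Longrightarrow> H c (V j) + H (V j) (V (j + p)) + H (V (j + p)) c =
        orient3 c (V j) (V (j + p)) * G {c, V j, V (j + p)}"
      "H a c + H c (V 0) + H (V 0) a = orient3 a c (V 0) * G {a, c, V 0}"
      "H a (V 0) + H (V 0) (V p) + H (V p) a = orient3 a (V 0) (V p) * G {a, V 0, V p}"
      "H a (V p) + H (V p) c + H c a = orient3 a (V p) c * G {a, V p, c}"
  shows "\<exists>h. \<forall>\<tau>\<in>K. card \<tau> = 3 \<longrightarrow> (\<Sum>j\<in>\<tau>. sgn_shuffle {j} \<tau> * h (\<tau> - {j})) = G \<tau>"
proof -
  \<comment> \<open>An antisymmetric function of ordered edges is stored by its value on the
    increasing order.\<close>
  define h where "h e = H (Min e) (Max e)" for e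
  have h: "orient2 u v * h {u, v} = H u v" if "u \<noteq> v" for u v
  proof (cases "u < v")
    case True
    then show ?thesis by (simp add: h_def orient2_def min_def max_def)
  next
    case False
    then show ?thesis using that H[of u v] by (simp add: h_def orient2_def min_def max_def)
  qed
  have "(\<Sum>j\<in>\<tau>. sgn_shuffle {j} \<tau> * h (\<tau> - {j})) = G \<tau>" if \<tau>: "\<tau> \<in> K" "card \<tau> = 3" for \<tau>
  proof -
    have "\<exists>x y z. \<tau> = {x, y, z} \<and> H x y + H y z + H z x = orient3 x y z * G {x, y, z}"
      using triangle_K[OF \<tau>]
    proof (cases rule: facets_cases)
      case (1 j t)
      then show ?thesis using cyc(1)[of j t] by blast
    next
      case (2 j)
      then show ?thesis using cyc(2)[of j] by blast
    qed (use cyc(3-5) in blast)+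
    then obtain x y z where xyz: "\<tau> = {x, y, z}" "H x y + H y z + H z x = orient3 x y z * G {x, y, z}"
      by blast
    have "x \<noteq> y" "x \<noteq> z" "y \<noteq> z" using \<tau>(2) xyz(1) by (auto simp: card_insert_if split: if_splits)
    then have "(\<Sum>j\<in>\<tau>. sgn_shuffle {j} \<tau> * h (\<tau> - {j})) = orient3 x y z * (orient3 x y z * G {x, y, z})"
      unfolding xyz(1) using sum_triangle[of x y z h H] h xyz(2) by simp
    then show ?thesis unfolding xyz(1) by (simp add: mult.assoc[symmetric])
  qed
  then show ?thesis by blast
qed

text \<open>\<open>2 * p\<close> is -1 modulo \<open>n\<close>, so \<open>n - 2\<close> is the
  inverse of \<open>p\<close>.\<close>

lemma inverse_p: "((n - 2) * j * p) mod n = j mod n"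
proof -
  have "(n - 2) * p = (p - 1) * n + 1"
  proof -
    obtain q where q: "p = Suc q" using p by (cases p) auto
    have "n = 2 * q + 3" unfolding n_def using q by simp
    then show ?thesis using q by (simp add: algebra_simps)
  qed
  then have "(n - 2) * j * p = j * (p - 1) * n + j" by (metis add_mult_distrib2 mult.assoc mult.commute mult.right_neutral)
  then show ?thesis by simp
qed

lemma sum_mult_p: "(\<Sum>i<n. f ((i * p) mod n)) = (\<Sum>j<n. f j)"
proof (rule sum.reindex_bij_witness[of _ "\<lambda>j. ((n - 2) * j) mod n" "\<lambda>i. (i * p) mod n"])
  fix i assume "i \<in> {..<n}"
  then have i: "i mod n = i" by simp
  have "((n - 2) * ((i * p) mod n)) mod n = ((n - 2) * i * p) mod n"
    by (metis mod_mult_right_eq mult.assoc)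
  then show "((n - 2) * ((i * p) mod n)) mod n = i" unfolding inverse_p i .
  have "(((n - 2) * i) mod n * p) mod n = ((n - 2) * i * p) mod n" by (rule mod_mult_left_eq)
  then show "(((n - 2) * i) mod n * p) mod n = i" unfolding inverse_p i .
qed (use n_gt(3) in auto)

text \<open>Give all circle edges the same value \<open>s\<close>. The fan triangles then determine
  the chord values \<open>A i t\<close> successively, and the triangles at the centre prescribe the
  difference of the spoke values \<open>h\<close> at \<open>j + p\<close> and \<open>j\<close>.
  Since \<open>p\<close> is a unit modulo \<open>n\<close>, steps of length \<open>p\<close> visit
  every vertex once. The recursion closes up iff its increments sum to 0, which fixes
  \<open>s\<close> after division by \<open>p * n\<close>.\<close>

lemma solve_exists:
  fixes G :: "nat set \<Rightarrow> 'k::field_char_0"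
  shows "\<exists>h. \<forall>\<tau>\<in>K. card \<tau> = 3 \<longrightarrow> (\<Sum>j\<in>\<tau>. sgn_shuffle {j} \<tau> * h (\<tau> - {j})) = G \<tau>"
proof -
  define Gt where "Gt x y z = orient3 x y z * G {x, y, z}" for x y z
  define D where "D i k = Gt (V i) (V (i + k)) (V (i + k + 1))" for i k
  \<comment> \<open>At the subdivided triangle the three prescribed values add up, as the edges at
    \<open>a\<close> cancel.\<close>
  define C where "C j = (if j = 0 then Gt a c (V 0) + Gt a (V 0) (V p) + Gt a (V p) c else Gt c (V j) (V (j + p)))" for j
  define s where "s = (\<Sum>j<n. (\<Sum>k\<in>{1..<p}. D j k) + C j) / (of_nat p * of_nat n)"
  define A where "A i t = of_nat t * s - (\<Sum>k\<in>{1..<t}. D i k)" for i t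
  \<comment> \<open>The spoke value after \<open>k\<close> steps of length \<open>p\<close> from
    \<open>V 0\<close>, starting with 0; \<open>h\<close> finds \<open>k\<close> by multiplying with
    the inverse of \<open>p\<close>.\<close>
  define u where "u k = (\<Sum>i<k. A ((i * p) mod n) p - C ((i * p) mod n))" for k
  define h where "h j = u (((n - 2) * j) mod n)" for j
  have u_n: "u n = 0"
  proof -
    have "u n = (\<Sum>j<n. A j p - C j)"
      unfolding u_def by (rule sum_mult_p)
    also have "\<dots> = of_nat n * (of_nat p * s) - (\<Sum>j<n. (\<Sum>k\<in>{1..<p}. D j k) + C j)"
      by (simp add: A_def sum.distrib sum_subtractf)
    also have "\<dots> = 0" using p n_gt(3) by (simp add: s_def)
    finally show ?thesis .
  qed
  have h_step: "h ((j + p) mod n) = h j + A j p - C j" if "j < n" for j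
  proof -
    define k where "k = ((n - 2) * j) mod n"
    have kn: "k < n" unfolding k_def using n_gt(3) by simp
    have kp: "(k * p) mod n = j" unfolding k_def mod_mult_left_eq inverse_p using that by simp
    have "((n - 2) * ((j + p) mod n)) mod n = ((n - 2) * j + (n - 2) * 1 * p) mod n"
      by (simp add: mod_mult_right_eq distrib_left)
    also have "\<dots> = (k + 1) mod n"
      using inverse_p[of 1] n_gt by (metis k_def mod_add_eq mod_mod_trivial)
    finally have *: "h ((j + p) mod n) = u ((k + 1) mod n)" unfolding h_def by simp
    have uk: "u (k + 1) = u k + (A j p - C j)" unfolding u_def by (simp add: kp)
    show ?thesis
    proof (cases "k + 1 = n")
      case True
      then have "h ((j + p) mod n) = 0" unfolding * by (simp add: u_def)
      moreover have "u k + A j p - C j = 0" using uk u_n True by (simp add: add_diff_eq)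
      ultimately show ?thesis by (simp add: h_def k_def)
    next
      case False
      then have "(k + 1) mod n = k + 1" using kn by simp
      then show ?thesis using uk * by (simp add: h_def k_def)
    qed
  qed
  \<comment> \<open>A pair of circle vertices is read in the direction in which it has length at
    most \<open>p\<close>.\<close>
  define HH where "HH i j = (let t = (j + n - i) mod n in if t \<le> p then A i t else - A j ((i + n - j) mod n))" for i j
  have dif: "(i + n - j) mod n = n - (j + n - i) mod n" if "i < n" "j < n" "i \<noteq> j" for i j
  proof (cases "i < j")
    case True
    then have "(j + n - i) mod n = j - i" using that by (simp add: mod_if)
    then show ?thesis using True that by simp
  next
    case False
    then have "(i + n - j) mod n = i - j" using that by (simp add: mod_if)
    moreover have "(j + n - i) mod n = j + n - i" using False that by simp
    ultimately show ?thesis using False that by simp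
  qed
  have HH_anti: "HH j i = - HH i j" if "i < n" "j < n" "i \<noteq> j" for i j
    using dif[OF that] dif[of j i] that unfolding HH_def Let_def n_def by (auto simp: not_le)
  \<comment> \<open>With value 0 on the edge from \<open>a\<close> to \<open>c\<close>, two of the
    triangles at \<open>a\<close> determine the values on its edges to \<open>V 0\<close> and
    \<open>V p\<close>; the third triangle then holds by the choice of \<open>C 0\<close>.\<close>
  define e where "e y = (if y = V 0 then h 0 - Gt a c (V 0) else Gt a (V p) c + h p)" for y
  define H where "H x y = (if x \<le> n \<and> y \<le> n then HH (x - 1) (y - 1)
     else if x = c \<and> y \<le> n then h (y - 1) else if x \<le> n \<and> y = c then - h (x - 1)
     else if x = a \<and> y \<le> n then e y else if x \<le> n \<and> y = a then - e x else 0)" for x y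
  have ca: "c = n + 1" "a = n + 2" by (simp_all add: c_def a_def n_def)
  have Vn: "V j \<le> n" "V j - Suc 0 = j mod n" for j using V_in[of j] by (auto simp: V_def)
  have H_V: "H (V i) (V (i + t)) = A i t" if "i < n" "t \<le> p" for i t
  proof -
    have "((i + t) mod n + n - i) mod n = t"
    proof (cases "i + t < n")
      case True
      then show ?thesis using that n_gt(1) by (simp add: mod_if)
    next
      case False
      then have "(i + t) mod n = i + t - n" using that n_gt(1) by (simp add: mod_if)
      then show ?thesis using that n_gt(1) False by simp
    qed
    then show ?thesis using that Vn(1) by (simp add: H_def HH_def Vn(2))
  qed
  have H_c: "H c (V j) = h (j mod n)" "H (V j) c = - h (j mod n)" for j
    using Vn by (simp_all add: H_def ca)
  have H_a: "H a (V j) = e (V j)" "H (V j) a = - e (V j)" for j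
    using Vn by (simp_all add: H_def ca)
  have H_ac: "H a c = 0" "H c a = 0" by (simp_all add: H_def ca)
  have anti: "H y x = - H x y" if xy: "x \<noteq> y" "x \<noteq> 0" "y \<noteq> 0" for x y
  proof (cases "x \<le> n \<and> y \<le> n")
    case True
    have "x - 1 < n" "y - 1 < n" "x - 1 \<noteq> y - 1" using True xy by linarith+
    then show ?thesis using True HH_anti[of "x - 1" "y - 1"] unfolding H_def by simp
  next
    case False
    consider "x \<le> n" "n < y" | "n < x" "y \<le> n" | "n < x" "n < y" using False by linarith
    then show ?thesis by cases (simp_all add: H_def ca)
  qed
  show ?thesis
  \<comment> \<open>Label 0 is no vertex, and \<open>x - 1\<close> would merge it with label 1. With
    value 0 there the function is antisymmetric for all labels.\<close>
  proof (rule solve_from_H[where H = "\<lambda>x y. if x = 0 \<or> y = 0 then 0 else H x y"], goal_cases)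
    case (1 x y)
    then show ?case using anti[of x y] by (cases "x = 0 \<or> y = 0") auto
  next
    case (2 j t)
    have V1: "V (j + t) = V ((j + t) mod n)" "V (j + t + 1) = V ((j + t) mod n + 1)" by (simp_all only: V_mod)
    have "H (V (j + t)) (V (j + t + 1)) = s"
      unfolding V1 using H_V[of "(j + t) mod n" 1] n_gt(3) p by (simp add: A_def)
    moreover have "H (V (j + t + 1)) (V j) = - H (V j) (V (j + t + 1))"
      using distinct_V(2)[of t j] 2 V_in by (intro anti) (auto simp: V_def)
    moreover have "H (V j) (V (j + t + 1)) = A j (t + 1)" using H_V[of j "t + 1"] 2 by (simp add: add.assoc)
    moreover have "H (V j) (V (j + t)) = A j t" using H_V[of j t] 2 by simp
    moreover have "A j t + s - A j (t + 1) = D j t" using 2 by (simp add: A_def algebra_simps)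
    ultimately show ?case by (simp add: V_def D_def Gt_def)
  next
    case (3 j)
    have "H c (V j) + H (V j) (V (j + p)) + H (V (j + p)) c = C j"
      using 3 h_step[of j] H_V[of j p] unfolding H_c by simp
    then show ?case using 3 by (simp add: C_def Gt_def V_def ca)
  next
    case 4
    show ?case using H_ac H_c(1)[of 0] H_a(2)[of 0] by (simp add: e_def Gt_def V_def ca)
  next
    case 5
    have "H (V 0) (V p) = A 0 p" using H_V[of 0 p] n_gt(3) by simp
    moreover have "h p = h 0 + A 0 p - C 0" using h_step[of 0] n_gt by simp
    moreover have "e (V 0) = h 0 - Gt a c (V 0)" "e (V p) = Gt a (V p) c + h p"
      using V_p_neq(2) by (simp_all add: e_def)
    ultimately have "H a (V 0) + H (V 0) (V p) + H (V p) a = Gt a (V 0) (V p)"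
      unfolding H_a by (simp add: C_def)
    then show ?case by (simp add: Gt_def V_def ca)
  next
    case 6
    have "e (V p) = Gt a (V p) c + h p" using V_p_neq(2) by (simp add: e_def)
    then have "H a (V p) + H (V p) c + H c a = Gt a (V p) c"
      unfolding H_a H_c H_ac using n_gt(1) by simp
    then show ?case by (simp add: Gt_def V_def ca)
  qed
qed

lemma golod_char_0: "golod TYPE('k::field_char_0) a K"
proof -
  define solve :: "(nat set \<Rightarrow> 'k) \<Rightarrow> nat set \<Rightarrow> 'k" where
    "solve g = (SOME h. \<forall>\<tau>\<in>K. card \<tau> = 3 \<longrightarrow> (\<Sum>j\<in>\<tau>. sgn_shuffle {j} \<tau> * h (\<tau> - {j})) = g \<tau>)" for g
  have solve: "\<forall>\<tau>\<in>K. card \<tau> = 3 \<longrightarrow> (\<Sum>j\<in>\<tau>. sgn_shuffle {j} \<tau> * solve g (\<tau> - {j})) = g \<tau>" for g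
    unfolding solve_def by (rule someI_ex[OF solve_exists])
  interpret golod_criterion a K a solve
    by (rule golod_criterion.intro[OF simplicial_complex_K dim_K _ edges])
      (use solve in \<open>auto simp: a_def\<close>)
  show ?thesis by (rule golod)
qed

section \<open>A nonzero product modulo p\<close>

definition kmon :: "nat set \<Rightarrow> (nat \<Rightarrow>\<^sub>0 nat) \<Rightarrow> 'k::comm_ring_1 kform" where
  "kmon L \<alpha> = Kform (\<lambda>M. if M = L then Poly_Mapping.single \<alpha> 1 else 0)"

lemma kcoeff_kmon: "kcoeff (kmon L \<alpha>) M = (if M = L then Poly_Mapping.single \<alpha> 1 else 0)"
  by (simp add: kmon_def Kform_inverse)

lemma kmon_kspan: "kmon L \<alpha> \<in> kspan (\<lambda>M \<beta>. M = L \<and> \<beta> = \<alpha>)"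
  by (rule kspanI) (auto simp: kcoeff_kmon lookup_single when_def split: if_splits)

text \<open>Signs identifying the Koszul differential in the squarefree top multidegree with the
  simplicial coboundary.\<close>

definition eps :: "nat set \<Rightarrow> 'k::comm_ring_1" where
  "eps \<sigma> = (\<Prod>l\<in>\<sigma>. sgn_shuffle {l} {1..a})"

lemma eps_sq: "eps \<sigma> * eps \<sigma> = 1"
  unfolding eps_def prod.distrib[symmetric] by simp

text \<open>The fundamental cycle of the complex modulo p, evaluated on the squarefree part of top
  multidegree, which is the cochain complex of the complex.\<close>

definition top_eval :: "'k::comm_ring_1 kform \<Rightarrow> nat \<Rightarrow> nat \<Rightarrow> nat \<Rightarrow> 'k" where
  "top_eval f x y z = orient3 x y z * (eps {x, y, z} *
     Poly_Mapping.lookup (kcoeff f ({1..a} - {x, y, z})) (indicator_exp {x, y, z}))"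

lemma facet_in:
  assumes "{x, y, z} \<in> facets"
  shows "{x, y, z} \<in> K" "{x, y, z} \<subseteq> {1..a}"
  using assms facets_sub K_I by blast+

text \<open>In the top multidegree \<open>kdiff\<close> is the coboundary of the edge cochain
  \<open>h\<close>, and \<open>fund\<close> takes coboundaries to multiples of
  \<open>p\<close>.\<close>

lemma fund_kdiff:
  assumes "of_nat p = (0 :: 'k::comm_ring_1)"
  shows "fund (top_eval (kdiff a w)) = (0 :: 'k)"
proof -
  define h :: "nat set \<Rightarrow> 'k" where
    "h e = eps e * Poly_Mapping.lookup (kcoeff w ({1..a} - e)) (indicator_exp e)" for e
  define H where "H x y = orient2 x y * h {x, y}" for x y
  have "fund (top_eval (kdiff a w)) = fund (\<lambda>x y z. H x y + H y z + H z x)"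
  proof (rule fund_cong)
    fix x y z assume f: "{x, y, z} \<in> facets" and d: "x \<noteq> y" "x \<noteq> z" "y \<noteq> z"
    define \<tau> where "\<tau> = {x, y, z}"
    have sub: "\<tau> \<subseteq> {1..a}" and fin: "finite \<tau>" using facet_in(2)[OF f] by (auto simp: \<tau>_def)
    have idx: "{i \<in> {1..a} - ({1..a} - \<tau>). Poly_Mapping.lookup (indicator_exp \<tau>) i \<noteq> 0} = \<tau>"
      using sub fin by (auto simp: lookup_indicator_exp)
    have "eps \<tau> * Poly_Mapping.lookup (kcoeff (kdiff a w) ({1..a} - \<tau>)) (indicator_exp \<tau>) =
       (\<Sum>j\<in>\<tau>. sgn_shuffle {j} \<tau> * h (\<tau> - {j}))"
      unfolding lookup_kdiff' idx sum_distrib_left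
    proof (rule sum.cong[OF refl])
      fix j assume j: "j \<in> \<tau>"
      have 1: "insert j ({1..a} - \<tau>) = {1..a} - (\<tau> - {j})" using j sub by auto
      have 2: "indicator_exp \<tau> - vexp j = indicator_exp (\<tau> - {j})"
        using fin j by (intro exp_eqI) (auto simp: lookup_minus lookup_indicator_exp lookup_vexp)
      have 3: "{1..a} = \<tau> \<union> ({1..a} - \<tau>)" using sub by auto
      have 4: "sgn_shuffle {j} {1..a} = (sgn_shuffle {j} \<tau> * sgn_shuffle {j} ({1..a} - \<tau>) :: 'k)"
        by (subst 3, rule sgn_shuffle_Un_right) (use fin in auto)
      have 5: "eps \<tau> = (sgn_shuffle {j} {1..a} * eps (\<tau> - {j}) :: 'k)"
        unfolding eps_def using fin j by (rule prod.remove)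
      have "eps \<tau> * (sgn_shuffle {j} ({1..a} - \<tau>) * q) =
          (sgn_shuffle {j} ({1..a} - \<tau>) * sgn_shuffle {j} ({1..a} - \<tau>)) * (sgn_shuffle {j} \<tau> * (eps (\<tau> - {j}) * q))" for q :: 'k
        unfolding 5 4 by (simp only: mult_ac)
      then show "eps \<tau> * (sgn_shuffle {j} ({1..a} - \<tau>) *
           Poly_Mapping.lookup (kcoeff w (insert j ({1..a} - \<tau>))) (indicator_exp \<tau> - vexp j)) =
          sgn_shuffle {j} \<tau> * h (\<tau> - {j})"
        unfolding 1 2 h_def by (simp only: sgn_shuffle_sq mult_1)
    qed
    also have "\<dots> = orient3 x y z * (H x y + H y z + H z x)"
      unfolding \<tau>_def by (rule sum_triangle[OF d]) (simp add: H_def)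
    finally have "top_eval (kdiff a w) x y z = (orient3 x y z * orient3 x y z) * (H x y + H y z + H z x)"
      unfolding top_eval_def \<tau>_def by (simp only: mult.assoc)
    then show "top_eval (kdiff a w) x y z = H x y + H y z + H z x" by (simp only: orient3_sq mult_1)
  qed
  also have "\<dots> = of_nat p * (\<Sum>j<n. H (V j) (V (j + 1)))"
  proof (rule fund_coboundary)
    fix x y :: nat assume "x \<noteq> y"
    then show "H y x = - H x y"
      unfolding H_def insert_commute[of y x "{}"] by (simp add: orient2_swap[of x y])
  qed
  finally show ?thesis using assms by simp
qed

lemma fund_knull:
  assumes "f - g \<in> knull K"
  shows "fund (top_eval f) = fund (top_eval g)"
proof (rule fund_cong)
  fix x y z assume f: "{x, y, z} \<in> facets"
  have "Poly_Mapping.lookup (kcoeff (f - g) L) (indicator_exp {x, y, z}) = 0" for L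
    using kspanD[OF assms[unfolded knull_def], of L "indicator_exp {x, y, z}"] facet_in(1)[OF f] by auto
  then show "top_eval f x y z = top_eval g x y z"
    by (simp add: top_eval_def kform_rep_eqs lookup_minus)
qed

text \<open>The product of a class of the full subcomplex on \<open>W\<close> and \<open>a\<close>, in which \<open>a\<close> is isolated, and
  the class of the empty triangle \<open>c, V 0, V p\<close>.\<close>

lemma not_golod:
  assumes "of_nat p = (0 :: 'k::comm_ring_1)"
  shows "\<not> golod TYPE('k) a K"
proof
  assume gol: "golod TYPE('k) a K"
  interpret sr_koszul a K "koszul_dga a K :: (nat set \<Rightarrow> 'k mpoly set) dga"
    by (rule sr_koszul.intro[OF simplicial_complex_K refl])
  define W where "W = {1..a} - {a, c, V 0, V p}"
  define e where "e = vexp (V 0) + vexp (V p)"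
  \<comment> \<open>\<open>x\<close> is the indicator of \<open>a\<close> on the vertices
    \<open>W\<close> and \<open>a\<close>, and \<open>y\<close> the cochain supported on the edge
    \<open>{V 0, V p}\<close> of the empty triangle. So their product is, up to sign, a single
    monomial, located at the facet \<open>{a, V 0, V p}\<close>.\<close>
  define x where "x = (kmon W (vexp a) :: 'k kform)"
  define y where "y = (kmon {c} e :: 'k kform)"
  have ins: "a \<in> {1..a}" "c \<in> {1..a}" "V j \<in> {1..a}" for j
    using V_in[of j] V_lt(3) by (auto simp: a_def c_def n_def)
  have finW: "finite W" and cW: "c \<notin> W" by (auto simp: W_def)
  have keys_vexp: "Poly_Mapping.keys (vexp i) = {i}" for i
    by (simp add: vexp_def)
  have xg: "x \<in> kgr a (2 + int (card W))"
    unfolding x_def kgr_eq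
    by (rule kspan_mono[OF kmon_kspan]) (use ins in \<open>auto simp: kind_def W_def keys_vexp pdeg_vexp\<close>)
  have yg: "y \<in> kgr a 5"
    unfolding y_def kgr_eq
    by (rule kspan_mono[OF kmon_kspan])
      (use ins in \<open>auto simp: kind_def e_def keys_vexp keys_add_nat pdeg_add pdeg_vexp\<close>)
  have dx: "kdiff a x \<in> knull K"
    unfolding x_def knull_def
  proof (rule kspan_kdiff[OF kmon_kspan])
    fix i L \<alpha> assume "i \<in> {1..a}" "i \<notin> L" "insert i L = W \<and> \<alpha> = vexp a"
    then have "i \<in> W" "\<alpha> = vexp a" by auto
    then show "Poly_Mapping.keys (\<alpha> + Poly_Mapping.single i 1) \<notin> K"
      using missing_edge[of i] by (simp add: keys_add_nat keys_vexp W_def insert_commute)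
  qed
  have dy: "kdiff a y \<in> knull K"
    unfolding y_def knull_def
  proof (rule kspan_kdiff[OF kmon_kspan])
    fix i L \<alpha> assume "i \<in> {1..a}" "i \<notin> L" "insert i L = {c} \<and> \<alpha> = e"
    then have "i = c" "\<alpha> = e" by auto
    then have "Poly_Mapping.keys (\<alpha> + Poly_Mapping.single i 1) = {c, V 0, V p}"
      by (auto simp: keys_add_nat keys_vexp e_def)
    then show "Poly_Mapping.keys (\<alpha> + Poly_Mapping.single i 1) \<notin> K"
      using missing_triangle by simp
  qed
  have "trivial_products (koszul_dga a K :: (nat set \<Rightarrow> 'k mpoly set) dga)"
    using gol by (simp add: golod_def)
  then have "\<exists>w\<in>kgr a (2 + int (card W) + 5 - 1). kdiff a w - x * y \<in> knull K"
    using xg yg dx dy unfolding trivial_products_iff by fastforce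
  then obtain w where "kdiff a w - x * y \<in> knull K" by blast
  then have zero: "fund (top_eval (x * y)) = 0"
    using fund_kdiff[OF assms, of w] fund_knull[of "kdiff a w" "x * y"] by simp
  define \<rho> where "\<rho> = {a, V 0, V p}"
  have finsub: "\<rho> \<subseteq> {1..a}" "finite \<rho>" using ins by (auto simp: \<rho>_def)
  have compl: "{1..a} - \<rho> = insert c W" using ins by (auto simp: \<rho>_def W_def)
  have term0: "sgn_shuffle I (L - I) * (kcoeff x I * kcoeff y (L - I)) = 0"
    if "I \<in> Pow L" "\<not> (I = W \<and> L = insert c W)" for I L
  proof (rule ccontr)
    assume *: "sgn_shuffle I (L - I) * (kcoeff x I * kcoeff y (L - I)) \<noteq> 0"
    then have "kcoeff x I \<noteq> 0" by auto
    then have "I = W" by (auto simp: x_def kcoeff_kmon split: if_splits)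
    moreover have "kcoeff y (L - I) \<noteq> 0" using * by auto
    then have "L - I = {c}" by (auto simp: y_def kcoeff_kmon split: if_splits)
    ultimately show False using that by blast
  qed
  have coeff0: "kcoeff (x * y) L = 0" if "L \<noteq> insert c W" for L
    unfolding times_kform.rep_eq by (rule sum.neutral) (use term0 that in blast)
  have coeff1: "kcoeff (x * y) (insert c W) = sgn_shuffle W {c} * Poly_Mapping.single (vexp a + e) 1"
  proof -
    have "kcoeff (x * y) (insert c W) =
       (\<Sum>I\<in>{W}. sgn_shuffle I (insert c W - I) * (kcoeff x I * kcoeff y (insert c W - I)))"
      unfolding times_kform.rep_eq
      by (rule sum.mono_neutral_right) (use finW term0[of _ "insert c W"] in auto)
    moreover have "insert c W - W = {c}" using cW by auto
    ultimately show ?thesis by (simp add: x_def y_def kcoeff_kmon mult_single)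
  qed
  define \<kappa> where "\<kappa> = (sgn_shuffle W {c} :: 'k)"
  have ind: "indicator_exp \<rho> = vexp a + e"
    using finsub V_p_neq(2) by (intro exp_eqI) (auto simp: lookup_indicator_exp lookup_add e_def lookup_vexp \<rho>_def)
  define g where "g u v z = (if {u, v, z} = \<rho> then orient3 u v z * (eps \<rho> * \<kappa>) else 0)" for u v z
  have "fund (top_eval (x * y)) = fund g"
  proof (rule fund_cong)
    fix u v z assume f: "{u, v, z} \<in> facets"
    show "top_eval (x * y) u v z = g u v z"
    proof (cases "{u, v, z} = \<rho>")
      case True
      show ?thesis
        unfolding top_eval_def True g_def compl coeff1 lookup_sgn_mult ind \<kappa>_def by simp
    next
      case False
      have "{1..a} - {u, v, z} \<noteq> {1..a} - \<rho>"
        using False facet_in(2)[OF f] finsub(1) by blast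
      then have "kcoeff (x * y) ({1..a} - {u, v, z}) = 0" unfolding compl by (rule coeff0)
      then show ?thesis using False by (simp add: top_eval_def g_def)
    qed
  qed
  also have "\<dots> = g a (V 0) (V p)"
  proof -
    have "g (V i) (V j) (V k) = 0" for i j k
    proof -
      have "a \<notin> {V i, V j, V k}" by simp
      then have "{V i, V j, V k} \<noteq> \<rho>" unfolding \<rho>_def by blast
      then show ?thesis by (simp add: g_def)
    qed
    moreover have "g c j k = 0" "g a c j = 0" "g a j c = 0" for j k
    proof -
      have c: "c \<notin> \<rho>" by (simp add: \<rho>_def)
      have "c \<in> {c, j, k}" "c \<in> {a, c, j}" "c \<in> {a, j, c}" by simp_all
      then show "g c j k = 0" "g a c j = 0" "g a j c = 0" unfolding g_def using c by metis+
    qed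
    ultimately show ?thesis unfolding fund_def by simp
  qed
  also have "\<dots> = orient3 a (V 0) (V p) * (eps \<rho> * \<kappa>)"
    by (simp add: g_def \<rho>_def)
  finally have z: "orient3 a (V 0) (V p) * (eps \<rho> * \<kappa>) = 0" using zero by simp
  \<comment> \<open>The value is a product of signs, hence a unit, and its square is 1. Being a unit
    is what counts, as the coefficients may have zero divisors.\<close>
  have "(1 :: 'k) = (orient3 a (V 0) (V p) * orient3 a (V 0) (V p)) * ((eps \<rho> * eps \<rho>) * (\<kappa> * \<kappa>))"
    unfolding orient3_sq eps_sq \<kappa>_def sgn_shuffle_sq by simp
  also have "\<dots> = (orient3 a (V 0) (V p) * (eps \<rho> * \<kappa>)) * (orient3 a (V 0) (V p) * (eps \<rho> * \<kappa>))"
    by (simp only: mult_ac)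
  also have "\<dots> = 0" unfolding z by simp
  finally show False by simp
qed

end

section \<open>Quotient spaces\<close>

lemma topspace_quotient_topology [simp]: "topspace (quotient_topology X r) = topspace X // r"
proof
  show "topspace (quotient_topology X r) \<subseteq> topspace X // r"
    using openin_topspace[of "quotient_topology X r"] unfolding openin_quotient_topology by blast
  have "{x \<in> topspace X. r `` {x} \<in> topspace X // r} = topspace X" by (auto intro: quotientI)
  then have "openin (quotient_topology X r) (topspace X // r)"
    unfolding openin_quotient_topology by simp
  then show "topspace X // r \<subseteq> topspace (quotient_topology X r)" by (rule openin_subset)
qed

lemma quotient_topology_homeomorphic:
  assumes q: "quotient_map X Y F"
    and r: "r = {(x, y). x \<in> topspace X \<and> y \<in> topspace X \<and> F x = F y}"
  shows "quotient_topology X r homeomorphic_space Y"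
proof -
  define g where "g y = {x \<in> topspace X. F x = y}" for y
  define h where "h S = F (SOME x. x \<in> S)" for S
  have surj: "F ` topspace X = topspace Y" using q by (simp add: quotient_map_def)
  have iff: "openin X {x \<in> topspace X. F x \<in> W} \<longleftrightarrow> openin Y W" if "W \<subseteq> topspace Y" for W
    using q that unfolding quotient_map_def by blast
  have cls: "r `` {x} = g (F x)" if "x \<in> topspace X" for x
    using that by (auto simp: r g_def)
  have Q: "topspace X // r = g ` topspace Y"
    unfolding surj[symmetric] by (auto simp: quotient_def cls)
  have hg: "h (g y) = y" if y: "y \<in> topspace Y" for y
  proof -
    have "y \<in> F ` topspace X" using y surj by simp
    then obtain x where "x \<in> g y" by (auto simp: g_def)
    then have "(SOME x. x \<in> g y) \<in> g y" by (rule someI)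
    then show ?thesis by (simp add: h_def g_def)
  qed
  have "homeomorphic_maps Y (quotient_topology X r) g h"
    unfolding homeomorphic_maps_def
  proof (intro conjI ballI)
    show "continuous_map Y (quotient_topology X r) g"
      unfolding continuous_map_def
    proof (intro conjI allI impI)
      show "g \<in> topspace Y \<rightarrow> topspace (quotient_topology X r)" using Q by auto
    next
      fix U assume "openin (quotient_topology X r) U"
      then have o: "openin X {x \<in> topspace X. r `` {x} \<in> U}" by (simp add: openin_quotient_topology)
      have eq: "{x \<in> topspace X. F x \<in> {y \<in> topspace Y. g y \<in> U}} = {x \<in> topspace X. r `` {x} \<in> U}"
        using cls surj by auto
      then show "openin Y {y \<in> topspace Y. g y \<in> U}"
        using iff[of "{y \<in> topspace Y. g y \<in> U}"] o unfolding eq by blast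
    qed
    show "continuous_map (quotient_topology X r) Y h"
      unfolding continuous_map_def
    proof (intro conjI allI impI)
      show "h \<in> topspace (quotient_topology X r) \<rightarrow> topspace Y" using hg by (auto simp: Q)
    next
      fix V assume V: "openin Y V"
      have sub: "V \<subseteq> topspace Y" using V by (rule openin_subset)
      let ?S = "{S \<in> topspace (quotient_topology X r). h S \<in> V}"
      have "{x \<in> topspace X. r `` {x} \<in> ?S} = {x \<in> topspace X. F x \<in> V}"
      proof (rule Collect_cong, rule conj_cong[OF refl])
        fix x assume x: "x \<in> topspace X"
        then have "F x \<in> topspace Y" using surj by blast
        then show "r `` {x} \<in> ?S \<longleftrightarrow> F x \<in> V" using cls[OF x] hg[of "F x"] by (auto simp: Q)
      qed
      moreover have "openin X {x \<in> topspace X. F x \<in> V}"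
        using iff[OF sub] V by simp
      ultimately show "openin (quotient_topology X r) ?S"
        unfolding openin_quotient_topology by auto
    qed
  next
    fix y assume "y \<in> topspace Y"
    then show "h (g y) = y" by (rule hg)
  next
    fix S assume "S \<in> topspace (quotient_topology X r)"
    then obtain y where "y \<in> topspace Y" "S = g y" by (auto simp: Q)
    then show "g (h S) = S" by (simp add: hg)
  qed
  then show ?thesis
    using homeomorphic_space_sym homeomorphic_space_def by blast
qed

lemma topspace_disc_plus_circle:
  "topspace disc_plus_circle = Pair True ` cball 0 1 \<union> Pair False ` sphere 0 1"
proof -
  have "topspace disc_plus_circle = (SIGMA b:UNIV. if b then cball 0 1 else sphere (0::complex) 1)"
    unfolding disc_plus_circle_def topspace_sum_topology by (rule Sigma_cong) auto
  then show ?thesis by (auto split: if_splits)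
qed

lemma continuous_map_disc_plus_circle:
  assumes "continuous_map (top_of_set (cball 0 1)) Y (\<lambda>z. F (True, z))"
    and "continuous_map (top_of_set (sphere 0 1)) Y (\<lambda>z. F (False, z))"
  shows "continuous_map disc_plus_circle Y F"
  unfolding continuous_map_def
proof (intro conjI allI impI)
  show "F \<in> topspace disc_plus_circle \<rightarrow> topspace Y"
    using assms unfolding topspace_disc_plus_circle by (auto simp: continuous_map_def)
next
  fix U assume U: "openin Y U"
  define X where "X b = (if b then top_of_set (cball 0 1) else top_of_set (sphere (0::complex) 1))" for b
  have X: "disc_plus_circle = sum_topology X UNIV" unfolding disc_plus_circle_def X_def ..
  have "openin (X b) {x \<in> topspace (X b). F (b, x) \<in> U}" for b
    using assms U unfolding continuous_map_def by (cases b) (auto simp: X_def)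
  moreover have "{x. (b, x) \<in> {x \<in> topspace disc_plus_circle. F x \<in> U}} = {x \<in> topspace (X b). F (b, x) \<in> U}" for b
    unfolding X by auto
  ultimately show "openin disc_plus_circle {x \<in> topspace disc_plus_circle. F x \<in> U}"
    unfolding X openin_sum_topology by auto
qed

lemma compact_disc_plus_circle: "compact_space disc_plus_circle"
proof -
  define X where "X b = (if b then top_of_set (cball 0 1) else top_of_set (sphere (0::complex) 1))" for b
  have X: "disc_plus_circle = sum_topology X UNIV" unfolding disc_plus_circle_def X_def ..
  have "compactin disc_plus_circle (Pair b ` topspace (X b))" for b
  proof (rule image_compactin)
    show "compactin (X b) (topspace (X b))"
      unfolding compact_space_def[symmetric] X_def by (cases b) (simp_all add: compact_space_subtopology)
    show "continuous_map (X b) disc_plus_circle (Pair b)"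
      unfolding X by (rule continuous_map_component_injection) simp
  qed
  then have "compactin disc_plus_circle (Pair True ` topspace (X True) \<union> Pair False ` topspace (X False))"
    by (intro compactin_Un) auto
  then show ?thesis
    unfolding compact_space_def topspace_disc_plus_circle by (simp add: X_def)
qed

section \<open>Polar coordinates\<close>

lemma cis_eq_imp:
  assumes "0 < N" "s \<in> {0..N}" "t \<in> {0..N}" "cis (2 * pi * s / N) = cis (2 * pi * t / N)"
  shows "s = t \<or> s = 0 \<and> t = N \<or> s = N \<and> t = 0"
proof -
  have "sin (2 * pi * s / N) = sin (2 * pi * t / N)" "cos (2 * pi * s / N) = cos (2 * pi * t / N)"
    using arg_cong[OF assms(4), of Im] arg_cong[OF assms(4), of Re] by simp_all
  then obtain k :: int where "2 * pi * s / N = 2 * pi * t / N + 2 * pi * of_int k"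
    using sin_cos_eq_iff[of "2 * pi * s / N" "2 * pi * t / N"] by blast
  then have "2 * pi * s = 2 * pi * t + 2 * pi * (of_int k * N)"
    using assms(1) by (simp add: field_simps)
  then have "2 * pi * s = 2 * pi * (t + of_int k * N)" by (simp add: algebra_simps)
  then have s: "s = t + of_int k * N" by simp
  have "of_int k * N \<le> 1 * N" "- 1 * N \<le> of_int k * N" using s assms(2,3) by auto
  then have "k \<le> 1" "- 1 \<le> k" using assms(1) by (simp_all only: mult_le_cancel_right) auto
  then consider "k = 0" | "k = 1" | "k = - 1" by linarith
  then show ?thesis using s assms(2,3) by cases auto
qed

lemma polar_surj:
  assumes "0 < N" "z \<in> cball 0 1"
  obtains r t where "r \<in> {0..1}" "t \<in> {0..N}" "z = of_real r * cis (2 * pi * t / N)" "r = norm z"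
proof
  show "norm z \<in> {0..1}" using assms by simp
  have A: "0 \<le> Arg2pi z" "Arg2pi z < 2 * pi" "is_Arg z (Arg2pi z)" using Arg2pi[of z] by auto
  have "N * Arg2pi z \<le> N * (2 * pi)" using A assms(1) by (intro mult_left_mono) auto
  then show "N * Arg2pi z / (2 * pi) \<in> {0..N}"
    using A assms(1) by (simp add: field_simps)
  have "2 * pi * (N * Arg2pi z / (2 * pi)) / N = Arg2pi z" using assms(1) by simp
  then show "z = of_real (norm z) * cis (2 * pi * (N * Arg2pi z / (2 * pi)) / N)"
    using A(3) by (simp add: is_Arg_def cis_conv_exp)
  show "norm z = norm z" ..
qed

text \<open>Polar coordinates map the compact rectangle onto the disc, hence form a quotient map,
  and a map out of the rectangle that respects its identifications descends. Angles are measured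
  with full turn \<open>N\<close>, so that the vertices of a polygon sit at integers.\<close>

lemma polar_extension:
  fixes G :: "real \<times> real \<Rightarrow> 'b"
  assumes N: "0 < N" and cont: "continuous_map (top_of_set ({0..1} \<times> {0..N})) Y G"
    and ends: "\<And>r. r \<in> {0..1} \<Longrightarrow> G (r, 0) = G (r, N)"
    and centre: "\<And>t. t \<in> {0..N} \<Longrightarrow> G (0, t) = G (0, 0)"
  obtains f where "continuous_map (top_of_set (cball 0 1)) Y f"
    "\<And>r t. r \<in> {0..1} \<Longrightarrow> t \<in> {0..N} \<Longrightarrow> f (of_real r * cis (2 * pi * t / N)) = G (r, t)"
proof
  define S :: "(real \<times> real) set" where "S = {0..1} \<times> {0..N}"
  define P where "P v = of_real (fst v) * cis (2 * pi * snd v / N)" for v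
  have "continuous_on S P"
    unfolding P_def cis_conv_exp by (intro continuous_intros) (use N in auto)
  moreover have img: "P ` S = cball 0 1"
  proof
    show "P ` S \<subseteq> cball 0 1" by (auto simp: P_def S_def norm_mult)
    show "cball 0 1 \<subseteq> P ` S"
    proof
      fix z :: complex assume "z \<in> cball 0 1"
      then obtain r t where "r \<in> {0..1}" "t \<in> {0..N}" "z = of_real r * cis (2 * pi * t / N)"
        using polar_surj[OF N] by blast
      then show "z \<in> P ` S" by (intro image_eqI[of _ _ "(r, t)"]) (auto simp: P_def S_def)
    qed
  qed
  ultimately have "continuous_map (top_of_set S) (top_of_set (cball 0 1)) P"
    by (auto simp: continuous_map_in_subtopology)
  then have quot: "quotient_map (top_of_set S) (top_of_set (cball 0 1)) P"
  proof (rule continuous_imp_quotient_map)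
    show "compact_space (top_of_set S)"
      unfolding S_def by (intro compact_space_subtopology) (simp add: compact_Times)
    show "Hausdorff_space (top_of_set (cball (0::complex) 1))"
      by (simp add: Hausdorff_space_subtopology)
  qed (simp add: img)
  have GP: "G v = G w" if vw: "v \<in> S" "w \<in> S" "P v = P w" for v w
  proof -
    obtain r s where v: "v = (r, s)" "r \<in> {0..1}" "s \<in> {0..N}" using vw(1) by (auto simp: S_def)
    obtain r' t where w: "w = (r', t)" "r' \<in> {0..1}" "t \<in> {0..N}" using vw(2) by (auto simp: S_def)
    have "norm (P v) = r" "norm (P w) = r'" using v w by (auto simp: P_def norm_mult)
    then have r: "r' = r" using vw(3) by simp
    show ?thesis
    proof (cases "r = 0")
      case True
      then show ?thesis using centre[OF v(3)] centre[OF w(3)] v w r by simp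
    next
      case False
      then have "cis (2 * pi * s / N) = cis (2 * pi * t / N)"
        using vw(3) v w r by (simp add: P_def)
      then show ?thesis using cis_eq_imp[OF N v(3) w(3)] ends[OF v(2)] v w r by auto
    qed
  qed
  define f where "f z = G (SOME v. v \<in> S \<and> P v = z)" for z
  have fP: "f (P v) = G v" if "v \<in> S" for v
  proof -
    have "\<exists>w. w \<in> S \<and> P w = P v" using that by blast
    then have "(SOME w. w \<in> S \<and> P w = P v) \<in> S \<and> P (SOME w. w \<in> S \<and> P w = P v) = P v"
      by (rule someI_ex)
    then show ?thesis unfolding f_def using GP that by blast
  qed
  have "continuous_map (top_of_set S) Y (f \<circ> P)"
    by (rule continuous_map_eq[OF cont[folded S_def]]) (simp add: fP)
  then show "continuous_map (top_of_set (cball 0 1)) Y f"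
    by (rule continuous_compose_quotient_map[OF quot])
  show "f (of_real r * cis (2 * pi * t / N)) = G (r, t)" if "r \<in> {0..1}" "t \<in> {0..N}" for r t
    using fP[of "(r, t)"] that by (simp add: S_def P_def)
qed

section \<open>Bistellar moves on geometric realizations\<close>

definition points :: "nat \<Rightarrow> nat set set \<Rightarrow> (nat \<Rightarrow> real) set" where
  "points m D = {x. (\<forall>i. 0 \<le> x i) \<and> {i. x i \<noteq> 0} \<in> D \<and> (\<Sum>i\<in>{1..m}. x i) = 1}"

lemma geometric_realization_eq:
  "geometric_realization m D = subtopology (powertop_real UNIV) (points m D)"
  by (simp add: geometric_realization_def points_def)

lemma topspace_realization [simp]: "topspace (geometric_realization m D) = points m D"
  by (simp add: geometric_realization_eq)

lemma Hausdorff_realization: "Hausdorff_space (geometric_realization m D)"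
  unfolding geometric_realization_eq
  by (intro Hausdorff_space_subtopology) (simp add: Hausdorff_space_product_topology)

lemma continuous_map_coord: "continuous_map (geometric_realization m D) euclideanreal (\<lambda>x. x i)"
  unfolding geometric_realization_eq
  by (intro continuous_map_from_subtopology continuous_map_product_coordinates) simp

lemma continuous_map_realizationI:
  assumes "\<And>i. continuous_map X euclideanreal (\<lambda>x. f x i)"
    and "\<And>x. x \<in> topspace X \<Longrightarrow> f x \<in> points m D"
  shows "continuous_map X (geometric_realization m D) f"
  unfolding geometric_realization_eq
  by (rule continuous_map_into_subtopology) (use assms in \<open>auto simp: continuous_map_componentwise_UNIV\<close>)

lemma points_support: "x \<in> points m D \<Longrightarrow> {i. x i \<noteq> 0} \<in> D"
  and points_nonneg: "x \<in> points m D \<Longrightarrow> 0 \<le> x i"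
  and points_sum: "x \<in> points m D \<Longrightarrow> (\<Sum>i\<in>{1..m}. x i) = 1"
  by (simp_all add: points_def)

text \<open>The piecewise linear exchange of the diagonal \<open>a c\<close> of a quadrilateral
  \<open>a b c d\<close> for \<open>b d\<close>: the midpoints of the diagonals are identified, so
  equal weights on \<open>a\<close> and \<open>c\<close> are traded for equal weights on
  \<open>b\<close> and \<open>d\<close>.\<close>

definition flip :: "nat \<Rightarrow> nat \<Rightarrow> nat \<Rightarrow> nat \<Rightarrow> (nat \<Rightarrow> real) \<Rightarrow> nat \<Rightarrow> real" where
  "flip a b c d x = (\<lambda>i. x i + min (x a) (x c) *
     (of_bool (i = b) + of_bool (i = d) - of_bool (i = a) - of_bool (i = c)))"

lemma flip_id: "min (x a) (x c) = 0 \<Longrightarrow> flip a b c d x = x"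
  by (simp add: flip_def)

lemma continuous_map_flip_coord:
  "continuous_map (geometric_realization m D) euclideanreal (\<lambda>x. flip a b c d x i)"
  unfolding flip_def
  by (intro continuous_map_add continuous_map_real_mult_right continuous_map_real_min continuous_map_coord)

text \<open>\<open>D1\<close> to \<open>D4\<close> say that the edge \<open>a c\<close> lies in at
  most the two triangles of the quadrilateral and that \<open>b d\<close> becomes the new diagonal.
  One of \<open>x b\<close>, \<open>x d\<close> is 0, so the traded weight reappears as the minimum
  of the new coordinates and the reverse flip recovers \<open>x\<close>.\<close>

lemma flip_points:
  assumes D1: "\<And>\<sigma>. \<sigma> \<in> D \<Longrightarrow> a \<in> \<sigma> \<Longrightarrow> c \<in> \<sigma> \<Longrightarrow> \<sigma> \<subseteq> {a, b, c} \<or> \<sigma> \<subseteq> {a, c, d}"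
    and D2: "\<And>\<sigma>. \<sigma> \<in> D \<Longrightarrow> \<not> (b \<in> \<sigma> \<and> d \<in> \<sigma>)"
    and D3: "\<And>\<sigma>. \<sigma> \<in> D \<Longrightarrow> \<not> (a \<in> \<sigma> \<and> c \<in> \<sigma>) \<Longrightarrow> \<sigma> \<in> D'"
    and D4: "\<And>\<sigma>. \<sigma> \<subseteq> {a, b, d} \<or> \<sigma> \<subseteq> {b, c, d} \<Longrightarrow> \<sigma> \<in> D'"
    and dist: "distinct [a, b, c, d]" and m: "{a, b, c, d} \<subseteq> {1..m}"
    and x: "x \<in> points m D"
  shows "flip a b c d x \<in> points m D' \<and> flip b a d c (flip a b c d x) = x"
proof -
  define t where "t = min (x a) (x c)"
  define \<sigma> where "\<sigma> = {i. x i \<noteq> 0}"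
  have \<sigma>: "\<sigma> \<in> D" and nn: "\<And>i. 0 \<le> x i" and sum: "(\<Sum>i\<in>{1..m}. x i) = 1"
    using x by (simp_all add: points_def \<sigma>_def)
  have bd: "x b = 0 \<or> x d = 0" using D2[OF \<sigma>] by (auto simp: \<sigma>_def)
  have t0: "0 \<le> t" using nn by (simp add: t_def)
  show ?thesis
  proof (cases "t = 0")
    case True
    then have 1: "flip a b c d x = x" by (simp add: flip_id t_def)
    have "\<not> (a \<in> \<sigma> \<and> c \<in> \<sigma>)" using True nn[of a] nn[of c] by (auto simp: t_def \<sigma>_def min_def split: if_splits)
    then have "\<sigma> \<in> D'" using D3[OF \<sigma>] by blast
    moreover have "min (x b) (x d) = 0" using bd nn[of b] nn[of d] by auto
    ultimately show ?thesis unfolding 1 using nn sum by (simp add: points_def \<sigma>_def flip_id)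
  next
    case False
    define y where "y = flip a b c d x"
    have y: "y b = x b + t" "y d = x d + t" "y a = x a - t" "y c = x c - t"
      "\<And>i. i \<notin> {a, b, c, d} \<Longrightarrow> y i = x i"
      using dist by (auto simp: y_def flip_def t_def)
    have ac: "a \<in> \<sigma>" "c \<in> \<sigma>" using False nn[of a] nn[of c] by (auto simp: t_def \<sigma>_def min_def split: if_splits)
    then have sub: "\<sigma> \<subseteq> {a, b, c, d}" using D1[OF \<sigma>] by blast
    have ynn: "0 \<le> y i" for i
      using y nn[of i] t0 by (cases "i \<in> {a, b, c, d}") (auto simp: t_def)
    have "y a = 0 \<or> y c = 0" using y by (auto simp: t_def min_def)
    moreover have "{i. y i \<noteq> 0} \<subseteq> {a, b, c, d}"
    proof
      fix i assume "i \<in> {i. y i \<noteq> 0}"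
      then show "i \<in> {a, b, c, d}" using y(5)[of i] sub by (cases "i \<in> {a, b, c, d}") (auto simp: \<sigma>_def)
    qed
    ultimately have "{i. y i \<noteq> 0} \<subseteq> {a, b, d} \<or> {i. y i \<noteq> 0} \<subseteq> {b, c, d}" by auto
    then have "{i. y i \<noteq> 0} \<in> D'" by (rule D4)
    moreover have "(\<Sum>i\<in>{1..m}. y i) = 1"
    proof -
      have ob: "(\<Sum>i\<in>{1..m}. t * of_bool (i = k)) = t" if "k \<in> {1..m}" for k
      proof -
        have "(\<Sum>i\<in>{1..m}. t * of_bool (i = k)) = (\<Sum>i\<in>{1..m}. if i = k then t else 0)"
          by (rule sum.cong) auto
        then show ?thesis using that by simp
      qed
      have "(\<Sum>i\<in>{1..m}. y i) = (\<Sum>i\<in>{1..m}. x i + t * of_bool (i = b) + t * of_bool (i = d) - t * of_bool (i = a) - t * of_bool (i = c))"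
        unfolding y_def flip_def t_def by (simp only: algebra_simps)
      also have "\<dots> = (\<Sum>i\<in>{1..m}. x i) + t + t - t - t"
        unfolding sum.distrib sum_subtractf using m by (simp only: ob insert_subset)
      finally show ?thesis using sum by simp
    qed
    moreover have "flip b a d c y = x"
    proof
      fix i
      have "min (y b) (y d) = t" using y bd nn[of b] nn[of d] by auto
      then have "flip b a d c y i = x i + t * (of_bool (i = b) + of_bool (i = d) - of_bool (i = a) - of_bool (i = c))
          + t * (of_bool (i = a) + of_bool (i = c) - of_bool (i = b) - of_bool (i = d))"
        by (simp add: flip_def[of b a d c] y_def flip_def[of a b c d] t_def)
      then show "flip b a d c y i = x i" by (simp add: algebra_simps)
    qed
    ultimately show ?thesis unfolding y_def[symmetric] using ynn by (simp add: points_def)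
  qed
qed

text \<open>The minimum \<open>t\<close> of the three coordinates is moved to the barycentre
  \<open>a\<close>, which receives \<open>3 * t\<close>, and is moved back in equal shares. In
  \<open>D'\<close> one of the three coordinates vanishes, so after moving back their minimum is
  exactly the share.\<close>

lemma stellar_homeomorphic:
  assumes D1: "\<And>\<sigma>. \<sigma> \<in> D \<Longrightarrow> a \<notin> \<sigma>"
    and D2: "\<And>\<sigma>. \<sigma> \<in> D \<Longrightarrow> {u, v, w} \<subseteq> \<sigma> \<Longrightarrow> \<sigma> = {u, v, w}"
    and D3: "\<And>\<sigma>. \<sigma> \<in> D \<Longrightarrow> \<not> {u, v, w} \<subseteq> \<sigma> \<Longrightarrow> \<sigma> \<in> D'"
    and D4: "\<And>\<sigma>. \<sigma> \<subseteq> {u, v, w} \<Longrightarrow> \<sigma> \<in> D"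
    and D'1: "\<And>\<sigma>. \<sigma> \<subseteq> {a, u, v} \<or> \<sigma> \<subseteq> {a, u, w} \<or> \<sigma> \<subseteq> {a, v, w} \<Longrightarrow> \<sigma> \<in> D'"
    and D'2: "\<And>\<sigma>. \<sigma> \<in> D' \<Longrightarrow> a \<in> \<sigma> \<Longrightarrow> \<sigma> \<subseteq> {a, u, v} \<or> \<sigma> \<subseteq> {a, u, w} \<or> \<sigma> \<subseteq> {a, v, w}"
    and D'3: "\<And>\<sigma>. \<sigma> \<in> D' \<Longrightarrow> a \<notin> \<sigma> \<Longrightarrow> \<sigma> \<in> D"
    and D'4: "\<And>\<sigma>. \<sigma> \<in> D' \<Longrightarrow> \<not> {u, v, w} \<subseteq> \<sigma>"
    and dist: "distinct [a, u, v, w]" and m: "{a, u, v, w} \<subseteq> {1..m}"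
  shows "geometric_realization m D homeomorphic_space geometric_realization m D'"
proof -
  define t where "t x = min (x u) (min (x v) (x w))" for x :: "nat \<Rightarrow> real"
  define \<phi> where "\<phi> x = (\<lambda>i. x i + t x * (3 * of_bool (i = a) - of_bool (i = u) - of_bool (i = v) - of_bool (i = w)))"
    for x :: "nat \<Rightarrow> real"
  define \<psi> where "\<psi> y = (\<lambda>i. y i + y a * (of_bool (i = u) + of_bool (i = v) + of_bool (i = w) - 3 * of_bool (i = a)) * (1 / 3))"
    for y :: "nat \<Rightarrow> real"
  have ob: "(\<Sum>i\<in>{1..m}. r * of_bool (i = k)) = r" if "k \<in> {1..m}" for k and r :: real
  proof -
    have "(\<Sum>i\<in>{1..m}. r * of_bool (i = k)) = (\<Sum>i\<in>{1..m}. if i = k then r else 0)"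
      by (rule sum.cong) auto
    then show ?thesis using that by simp
  qed
  have sum\<phi>: "(\<Sum>i\<in>{1..m}. \<phi> x i) = (\<Sum>i\<in>{1..m}. x i)" for x
  proof -
    have "(\<Sum>i\<in>{1..m}. \<phi> x i) = (\<Sum>i\<in>{1..m}. x i + (3 * t x) * of_bool (i = a) - t x * of_bool (i = u) - t x * of_bool (i = v) - t x * of_bool (i = w))"
      unfolding \<phi>_def by (rule sum.cong[OF refl]) (simp add: algebra_simps)
    also have "\<dots> = (\<Sum>i\<in>{1..m}. x i) + 3 * t x - t x - t x - t x"
      unfolding sum.distrib sum_subtractf using m by (simp only: ob insert_subset)
    finally show ?thesis by simp
  qed
  have sum\<psi>: "(\<Sum>i\<in>{1..m}. \<psi> y i) = (\<Sum>i\<in>{1..m}. y i)" for y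
  proof -
    have "(\<Sum>i\<in>{1..m}. \<psi> y i) = (\<Sum>i\<in>{1..m}. y i + (y a / 3) * of_bool (i = u) + (y a / 3) * of_bool (i = v) + (y a / 3) * of_bool (i = w) - y a * of_bool (i = a))"
      unfolding \<psi>_def by (rule sum.cong[OF refl]) (simp add: algebra_simps)
    also have "\<dots> = (\<Sum>i\<in>{1..m}. y i) + y a / 3 + y a / 3 + y a / 3 - y a"
      unfolding sum.distrib sum_subtractf using m by (simp only: ob insert_subset)
    finally show ?thesis by simp
  qed
  have \<phi>: "\<phi> x \<in> points m D' \<and> \<psi> (\<phi> x) = x" if x: "x \<in> points m D" for x
  proof -
    define \<sigma> where "\<sigma> = {i. x i \<noteq> 0}"
    have \<sigma>: "\<sigma> \<in> D" and nn: "\<And>i. 0 \<le> x i" using x by (simp_all add: points_def \<sigma>_def)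
    have xa: "x a = 0" using D1[OF \<sigma>] by (simp add: \<sigma>_def)
    have y: "\<phi> x a = 3 * t x" "\<phi> x u = x u - t x" "\<phi> x v = x v - t x" "\<phi> x w = x w - t x"
      "\<And>i. i \<notin> {a, u, v, w} \<Longrightarrow> \<phi> x i = x i"
      using dist xa by (auto simp: \<phi>_def)
    have ynn: "0 \<le> \<phi> x i" for i
    proof -
      have "t x \<le> x u" "t x \<le> x v" "t x \<le> x w" "0 \<le> t x"
        unfolding t_def using nn by (simp_all add: min_le_iff_disj)
      then show ?thesis using y nn[of i] by (cases "i \<in> {a, u, v, w}") auto
    qed
    have "{i. \<phi> x i \<noteq> 0} \<in> D'"
    proof (cases "t x = 0")
      case True
      then have "\<phi> x = x" by (simp add: \<phi>_def)
      moreover have "\<not> {u, v, w} \<subseteq> \<sigma>" using True by (auto simp: t_def \<sigma>_def min_def split: if_splits)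
      ultimately show ?thesis using D3[OF \<sigma>] by (simp add: \<sigma>_def)
    next
      case False
      then have "0 < t x" using nn by (simp add: t_def less_le)
      then have "0 < x u" "0 < x v" "0 < x w" by (simp_all add: t_def)
      then have "{u, v, w} \<subseteq> \<sigma>" by (auto simp: \<sigma>_def)
      then have \<sigma>': "\<sigma> = {u, v, w}" by (rule D2[OF \<sigma>])
      have sub: "{i. \<phi> x i \<noteq> 0} \<subseteq> {a, u, v, w}"
      proof
        fix i assume "i \<in> {i. \<phi> x i \<noteq> 0}"
        then show "i \<in> {a, u, v, w}"
          using y(5)[of i] \<sigma>' by (cases "i \<in> {a, u, v, w}") (auto simp: \<sigma>_def)
      qed
      have "t x = x u \<or> t x = x v \<or> t x = x w" by (auto simp: t_def min_def)
      then have "\<phi> x u = 0 \<or> \<phi> x v = 0 \<or> \<phi> x w = 0" using y by auto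
      then show ?thesis using sub by (intro D'1) auto
    qed
    moreover have "\<psi> (\<phi> x) = x"
    proof
      fix i
      show "\<psi> (\<phi> x) i = x i"
        unfolding \<psi>_def y(1) unfolding \<phi>_def by (simp add: algebra_simps)
    qed
    ultimately show ?thesis using ynn sum\<phi>[of x] points_sum[OF x] by (simp add: points_def)
  qed
  have \<psi>: "\<psi> y \<in> points m D \<and> \<phi> (\<psi> y) = y" if y: "y \<in> points m D'" for y
  proof -
    define \<sigma> where "\<sigma> = {i. y i \<noteq> 0}"
    have \<sigma>: "\<sigma> \<in> D'" and nn: "\<And>i. 0 \<le> y i" using y by (simp_all add: points_def \<sigma>_def)
    have z: "\<psi> y a = 0" "\<psi> y u = y u + y a / 3" "\<psi> y v = y v + y a / 3" "\<psi> y w = y w + y a / 3"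
      "\<And>i. i \<notin> {a, u, v, w} \<Longrightarrow> \<psi> y i = y i"
      using dist by (auto simp: \<psi>_def)
    have znn: "0 \<le> \<psi> y i" for i
      using z nn by (cases "i \<in> {a, u, v, w}") auto
    have "y u = 0 \<or> y v = 0 \<or> y w = 0" using D'4[OF \<sigma>] by (auto simp: \<sigma>_def)
    then have t: "t (\<psi> y) = y a / 3" unfolding t_def z using nn[of u] nn[of v] nn[of w] by (auto simp: min_def)
    have "{i. \<psi> y i \<noteq> 0} \<in> D"
    proof (cases "y a = 0")
      case True
      then have "\<psi> y = y" by (simp add: \<psi>_def)
      then show ?thesis using D'3[OF \<sigma>] True by (simp add: \<sigma>_def)
    next
      case False
      then have sub: "\<sigma> \<subseteq> {a, u, v, w}" using D'2[OF \<sigma>] by (auto simp: \<sigma>_def)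
      have "{i. \<psi> y i \<noteq> 0} \<subseteq> {u, v, w}"
      proof
        fix i assume i: "i \<in> {i. \<psi> y i \<noteq> 0}"
        then have "i \<noteq> a" using z(1) by auto
        then show "i \<in> {u, v, w}"
          using i z(5)[of i] sub by (cases "i \<in> {a, u, v, w}") (auto simp: \<sigma>_def)
      qed
      then show ?thesis by (rule D4)
    qed
    moreover have "\<phi> (\<psi> y) = y"
    proof
      fix i
      show "\<phi> (\<psi> y) i = y i"
        unfolding \<phi>_def t unfolding \<psi>_def by (simp add: field_simps)
    qed
    ultimately show ?thesis using znn sum\<psi>[of y] points_sum[OF y] by (simp add: points_def)
  qed
  have "homeomorphic_maps (geometric_realization m D) (geometric_realization m D') \<phi> \<psi>"
    unfolding homeomorphic_maps_def
  proof (intro conjI)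
    show "continuous_map (geometric_realization m D) (geometric_realization m D') \<phi>"
    proof (rule continuous_map_realizationI)
      show "continuous_map (geometric_realization m D) euclideanreal (\<lambda>x. \<phi> x i)" for i
        unfolding \<phi>_def t_def
        by (intro continuous_map_add continuous_map_real_mult_right continuous_map_real_min continuous_map_coord)
    qed (use \<phi> in simp)
    show "continuous_map (geometric_realization m D') (geometric_realization m D) \<psi>"
    proof (rule continuous_map_realizationI)
      show "continuous_map (geometric_realization m D') euclideanreal (\<lambda>x. \<psi> x i)" for i
        unfolding \<psi>_def
        by (intro continuous_map_add continuous_map_real_mult_right continuous_map_coord)
    qed (use \<psi> in simp)
  qed (use \<phi> \<psi> in auto)
  then show ?thesis unfolding homeomorphic_space_def by blast
qed

section \<open>Triangulated discs\<close>

context moore_triangulation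
begin

text \<open>The disc is subdivided into \<open>n\<close> sectors. The vertices of the closed sector \<open>k\<close> are the centre
  \<open>M\<close> and the boundary vertices \<open>P k 0, \<dots>, P k p\<close>. The triangulation with parameter \<open>T\<close> is obtained
  from the cone over the boundary by \<open>T k - 1\<close> flips in sector \<open>k\<close>, which replace the edges from \<open>M\<close>
  to \<open>P k 1, P k 2, \<dots>\<close> by edges from \<open>P k 0\<close> to \<open>P k 2, P k 3, \<dots>\<close>.\<close>

definition N :: nat where "N = n * p"
definition M :: nat where "M = N + 1"
definition P :: "nat \<Rightarrow> nat \<Rightarrow> nat" where "P k i = (k * p + i) mod N + 1"

text \<open>\<open>t = 1\<close> gives the cone over the boundary path, \<open>t = p\<close> a
  single triangle at \<open>M\<close> and a fan at \<open>P k 0\<close>.\<close>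

definition sector :: "nat \<Rightarrow> nat \<Rightarrow> nat set set" where
  "sector k t = {{P k 0, P k i, P k (i + 1)} | i. 1 \<le> i \<and> i < t} \<union> {{M, P k 0, P k t}} \<union>
     {{M, P k i, P k (i + 1)} | i. t \<le> i \<and> i < p}"

definition disc :: "(nat \<Rightarrow> nat) \<Rightarrow> nat set set" where
  "disc T = {\<sigma>. \<exists>k<n. \<exists>\<tau>\<in>sector k (T k). \<sigma> \<subseteq> \<tau>}"

lemma N_pos: "0 < N" "5 \<le> N"
proof -
  have "5 * 1 \<le> n * p" by (rule mult_le_mono) (use p n_gt(5) in auto)
  then show "5 \<le> N" "0 < N" using p n_gt(3) by (simp_all add: N_def)
qed

lemma P_in: "P k i \<in> {1..N}"
  using mod_less_divisor[OF N_pos(1), of "k * p + i"] by (simp add: P_def Suc_leI)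

lemma P_M [simp]: "P k i \<noteq> M" "M \<noteq> P k i"
  using P_in[of k i] by (auto simp: M_def)

lemma P_in_M: "P k i \<in> {1..M}" "M \<in> {1..M}"
  using P_in[of k i] by (auto simp: M_def)

lemma P_lt:
  assumes "k < n" "i < p"
  shows "P k i = k * p + i + 1"
proof -
  have "k * p + i < k * p + p" using assms by simp
  also have "\<dots> = Suc k * p" by simp
  also have "\<dots> \<le> N" unfolding N_def using assms by (intro mult_le_mono1) simp
  finally show ?thesis by (simp add: P_def)
qed

lemma P_p: "k < n \<Longrightarrow> P k p = P (Suc k mod n) 0"
proof (cases "Suc k = n")
  case True
  then have "k * p + p = N" by (simp add: N_def flip: True)
  then show ?thesis using True by (simp add: P_def)
qed (simp add: P_def add.commute)

lemma P_inj_lt: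
  assumes "k < n" "k' < n" "i < p" "i' < p" "P k i = P k' i'"
  shows "k = k' \<and> i = i'"
proof -
  have "k * p + i = k' * p + i'" using assms by (simp add: P_lt)
  then have "(k * p + i) div p = (k' * p + i') div p" "(k * p + i) mod p = (k' * p + i') mod p" by simp_all
  then show ?thesis using assms by simp
qed

lemma Suc_mod_neq: "k < n \<Longrightarrow> Suc k mod n \<noteq> k" "k < n \<Longrightarrow> Suc (Suc k mod n) mod n \<noteq> k"
  using n_gt(5) by (auto simp: mod_Suc)

lemma Suc_mod_inj: "k < n \<Longrightarrow> k' < n \<Longrightarrow> Suc k mod n = Suc k' mod n \<Longrightarrow> k = k'"
  by (auto simp: mod_Suc split: if_splits)

lemma Suc_mod_lt: "Suc k mod n < n"
  using n_gt(3) by simp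

lemma P_inj:
  assumes "k < n" "k' < n" "i \<le> p" "i' \<le> p" "P k i = P k' i'"
  shows "k = k' \<and> i = i' \<or> i = p \<and> i' = 0 \<and> k' = Suc k mod n \<or> i = 0 \<and> i' = p \<and> k = Suc k' mod n"
proof -
  have p0: "0 < p" using p by simp
  consider "i < p" "i' < p" | "i = p" "i' < p" | "i < p" "i' = p" | "i = p" "i' = p"
    using assms by linarith
  then show ?thesis
  proof cases
    case 1
    then show ?thesis using P_inj_lt[of k k' i i'] assms by simp
  next
    case 2
    then have "P (Suc k mod n) 0 = P k' i'" using assms P_p by simp
    then show ?thesis using P_inj_lt[of "Suc k mod n" k' 0 i'] assms 2 p0 Suc_mod_lt by auto
  next
    case 3
    then have "P k i = P (Suc k' mod n) 0" using assms P_p by simp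
    then show ?thesis using P_inj_lt[of k "Suc k' mod n" i 0] assms 3 p0 Suc_mod_lt by auto
  next
    case 4
    then have "P (Suc k mod n) 0 = P (Suc k' mod n) 0" using assms P_p by simp
    then have "Suc k mod n = Suc k' mod n"
      using P_inj_lt[of "Suc k mod n" "Suc k' mod n" 0 0] p0 Suc_mod_lt by auto
    then have "k = k'" by (rule Suc_mod_inj[OF assms(1,2)])
    then show ?thesis using 4 by simp
  qed
qed

lemma P_interior:
  assumes "k < n" "k' < n" "0 < t" "t < p" "i \<le> p" "P k t = P k' i"
  shows "k' = k \<and> i = t"
  using P_inj[OF assms(1,2) less_imp_le[OF assms(4)] assms(5,6)] assms(3,4) by (metis less_irrefl)

text \<open>The corners of a sector are shared with its two neighbours, which differ as there are
  more than two sectors; so the two ends of a chord determine the sector.\<close>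

lemma P_chord:
  assumes "k < n" "k' < n" "2 \<le> s" "s \<le> p" "x \<le> p" "y \<le> p" "P k 0 = P k' x" "P k s = P k' y"
  shows "k' = k \<and> x = 0 \<and> y = s"
proof -
  have "k = k' \<and> x = 0 \<or> x = p \<and> k = Suc k' mod n"
    using P_inj[OF assms(1,2) _ assms(5,7)] p by (metis le0 not_numeral_le_zero)
  moreover have "k = k' \<and> y = s \<or> s = p \<and> y = 0 \<and> k' = Suc k mod n"
    using P_inj[OF assms(1,2,4,6,8)] assms(3) by (metis not_numeral_le_zero)
  ultimately show ?thesis
    using Suc_mod_neq[OF assms(1)] Suc_mod_neq[OF assms(2)] by metis
qed

lemma P_distinct:
  assumes "k < n" "1 \<le> t" "t < p"
  shows "distinct [M, P k 0, P k t, P k (t + 1)]"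
  using P_inj[of k k 0 t] P_inj[of k k 0 "t + 1"] P_inj[of k k t "t + 1"] assms
    Suc_mod_neq(1)[OF assms(1)] by auto

lemma sector_cases:
  assumes "\<tau> \<in> sector k t"
  obtains i where "1 \<le> i" "i < t" "\<tau> = {P k 0, P k i, P k (i + 1)}" | "\<tau> = {M, P k 0, P k t}"
    | i where "t \<le> i" "i < p" "\<tau> = {M, P k i, P k (i + 1)}"
  using assms unfolding sector_def by blast

lemma disc_I: "k < n \<Longrightarrow> \<tau> \<in> sector k (T k) \<Longrightarrow> \<sigma> \<subseteq> \<tau> \<Longrightarrow> \<sigma> \<in> disc T"
  unfolding disc_def by blast

lemma sector_I:
  "1 \<le> i \<Longrightarrow> i < t \<Longrightarrow> {P k 0, P k i, P k (i + 1)} \<in> sector k t"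
  "{M, P k 0, P k t} \<in> sector k t"
  "t \<le> i \<Longrightarrow> i < p \<Longrightarrow> {M, P k i, P k (i + 1)} \<in> sector k t"
  unfolding sector_def by blast+

text \<open>In the quadrilateral \<open>M, P k 0, P k s, P k (s + 1)\<close> the diagonal from
  \<open>M\<close> to \<open>P k s\<close> is exchanged for that from \<open>P k 0\<close> to
  \<open>P k (s + 1)\<close>. \<open>D1\<close> to \<open>D4\<close> and \<open>E1\<close> to
  \<open>E4\<close> below are the hypotheses of \<open>flip_points\<close> for this flip and its
  reverse.\<close>

lemma flip_disc:
  assumes T: "\<And>k. k < n \<Longrightarrow> 1 \<le> T k \<and> T k \<le> p" and k: "k < n" and t: "T k < p"
  defines "T' \<equiv> T(k := T k + 1)"
  shows "x \<in> points M (disc T) \<Longrightarrow> flip M (P k 0) (P k (T k)) (P k (T k + 1)) x \<in> points M (disc T') \<and>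
      flip (P k 0) M (P k (T k + 1)) (P k (T k)) (flip M (P k 0) (P k (T k)) (P k (T k + 1)) x) = x" (is "?A \<Longrightarrow> ?B")
    and "y \<in> points M (disc T') \<Longrightarrow> flip (P k 0) M (P k (T k + 1)) (P k (T k)) y \<in> points M (disc T) \<and>
      flip M (P k 0) (P k (T k)) (P k (T k + 1)) (flip (P k 0) M (P k (T k + 1)) (P k (T k)) y) = y" (is "?C \<Longrightarrow> ?D")
proof -
  define s where "s = T k"
  have s: "1 \<le> s" "s < p" using T[OF k] t by (auto simp: s_def)
  have T'k: "T' k = s + 1" and T'j: "\<And>j. j \<noteq> k \<Longrightarrow> T' j = T j" by (auto simp: T'_def s_def)
  have T': "1 \<le> T' j \<and> T' j \<le> p" if "j < n" for j
    using T[OF that] s by (cases "j = k") (auto simp: T'k T'j)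
  have dist: "distinct [M, P k 0, P k s, P k (s + 1)]" by (rule P_distinct[OF k s])
  have idx: "k' = k \<and> i = s" if "P k s = P k' i" "k' < n" "i \<le> p" for k' i
    using P_interior[OF k that(2) _ s(2) that(3,1)] s by simp
  have chord: "k' = k \<and> x = 0 \<and> y = s + 1" if "P k 0 = P k' x" "P k (s + 1) = P k' y" "k' < n" "x \<le> p" "y \<le> p" for k' x y
    using P_chord[OF k that(3) _ _ that(4,5,1,2)] s by simp
  have D1: "\<sigma> \<subseteq> {M, P k 0, P k s} \<or> \<sigma> \<subseteq> {M, P k s, P k (s + 1)}"
    if "\<sigma> \<in> disc T" "M \<in> \<sigma>" "P k s \<in> \<sigma>" for \<sigma>
  proof -
    from that(1) obtain k' \<tau> where k': "k' < n" "\<tau> \<in> sector k' (T k')" "\<sigma> \<subseteq> \<tau>" unfolding disc_def by blast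
    have \<tau>: "M \<in> \<tau>" "P k s \<in> \<tau>" using k'(3) \<open>M \<in> \<sigma>\<close> \<open>P k s \<in> \<sigma>\<close> by blast+
    from k'(2) have "\<tau> = {M, P k 0, P k s} \<or> \<tau> = {M, P k s, P k (s + 1)}"
    proof (cases rule: sector_cases)
      case (1 i)
      then show ?thesis using \<tau>(1) by simp
    next
      case 2
      then have "P k s = P k' 0 \<or> P k s = P k' (T k')" using \<tau>(2) by simp
      then have "k' = k" using idx[of k' 0] idx[of k' "T k'"] k'(1) T[of k'] by auto
      then show ?thesis using 2 by (simp add: s_def)
    next
      case (3 i)
      then have "P k s = P k' i \<or> P k s = P k' (i + 1)" using \<tau>(2) by simp
      then have "k' = k \<and> (i = s \<or> i + 1 = s)" using idx[of k' i] idx[of k' "i + 1"] k'(1) 3 by auto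
      then show ?thesis using 3 by (auto simp: s_def)
    qed
    then show ?thesis using k'(3) by blast
  qed
  have D2: "\<not> (P k 0 \<in> \<sigma> \<and> P k (s + 1) \<in> \<sigma>)" if "\<sigma> \<in> disc T" for \<sigma>
  proof
    assume both: "P k 0 \<in> \<sigma> \<and> P k (s + 1) \<in> \<sigma>"
    from that obtain k' \<tau> where k': "k' < n" "\<tau> \<in> sector k' (T k')" "\<sigma> \<subseteq> \<tau>" unfolding disc_def by blast
    have \<tau>: "P k 0 \<in> \<tau>" "P k (s + 1) \<in> \<tau>" using k'(3) both by blast+
    from k'(2) show False
    proof (cases rule: sector_cases)
      case (1 i)
      then have le: "i + 1 \<le> p" using T[of k'] k'(1) by auto
      obtain x where x: "P k 0 = P k' x" "x \<in> {0, i, i + 1}" using \<tau>(1) 1 by auto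
      obtain y where y: "P k (s + 1) = P k' y" "y \<in> {0, i, i + 1}" using \<tau>(2) 1 by auto
      have "k' = k \<and> y = s + 1" using chord[OF x(1) y(1) k'(1)] x(2) y(2) le by auto
      then show False using y(2) 1 by (auto simp: s_def)
    next
      case 2
      obtain x where x: "P k 0 = P k' x" "x \<in> {0, T k'}" using \<tau>(1) 2 by auto
      obtain y where y: "P k (s + 1) = P k' y" "y \<in> {0, T k'}" using \<tau>(2) 2 by auto
      have "k' = k \<and> y = s + 1" using chord[OF x(1) y(1) k'(1)] x(2) y(2) T[of k'] k'(1) by auto
      then show False using y(2) by (auto simp: s_def)
    next
      case (3 i)
      obtain x where x: "P k 0 = P k' x" "x \<in> {i, i + 1}" using \<tau>(1) 3 by auto
      obtain y where y: "P k (s + 1) = P k' y" "y \<in> {i, i + 1}" using \<tau>(2) 3 by auto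
      have "x = 0" using chord[OF x(1) y(1) k'(1)] x(2) y(2) 3 by auto
      then show False using x(2) 3 T[of k'] k'(1) by auto
    qed
  qed
  have D3: "\<sigma> \<in> disc T'" if "\<sigma> \<in> disc T" "\<not> (M \<in> \<sigma> \<and> P k s \<in> \<sigma>)" for \<sigma>
  proof -
    from that(1) obtain k' \<tau> where k': "k' < n" "\<tau> \<in> sector k' (T k')" "\<sigma> \<subseteq> \<tau>" unfolding disc_def by blast
    show ?thesis
    proof (cases "k' = k")
      case False
      then show ?thesis using k' T'j by (intro disc_I[of k' \<tau>]) auto
    next
      case True
      have new: "{P k 0, P k s, P k (s + 1)} \<in> sector k (T' k)" "{M, P k 0, P k (s + 1)} \<in> sector k (T' k)"
        unfolding T'k using s sector_I by auto
      have "\<exists>\<rho>\<in>sector k (T' k). \<sigma> \<subseteq> \<rho>"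
        using k'(2)
      proof (cases rule: sector_cases)
        case (1 i)
        then have "{P k 0, P k i, P k (i + 1)} \<in> sector k (T' k)"
          unfolding T'k using True by (intro sector_I) (auto simp: s_def)
        then show ?thesis using 1 k'(3) True by blast
      next
        case 2
        then have "\<sigma> \<subseteq> {P k 0, P k s, P k (s + 1)} \<or> \<sigma> \<subseteq> {M, P k 0, P k (s + 1)}"
          using k'(3) True \<open>\<not> (M \<in> \<sigma> \<and> P k s \<in> \<sigma>)\<close> s_def by blast
        then show ?thesis using new by blast
      next
        case (3 i)
        show ?thesis
        proof (cases "i = s")
          case True
          then have "\<sigma> \<subseteq> {P k 0, P k s, P k (s + 1)} \<or> \<sigma> \<subseteq> {M, P k 0, P k (s + 1)}"
            using k'(3) 3 \<open>k' = k\<close> \<open>\<not> (M \<in> \<sigma> \<and> P k s \<in> \<sigma>)\<close> by blast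
          then show ?thesis using new by blast
        next
          case False
          then have "{M, P k i, P k (i + 1)} \<in> sector k (T' k)"
            unfolding T'k using 3 \<open>k' = k\<close> by (intro sector_I) (auto simp: s_def)
          then show ?thesis using 3 k'(3) \<open>k' = k\<close> by blast
        qed
      qed
      then show ?thesis using k disc_I by blast
    qed
  qed
  have D4: "\<sigma> \<in> disc T'" if "\<sigma> \<subseteq> {M, P k 0, P k (s + 1)} \<or> \<sigma> \<subseteq> {P k 0, P k s, P k (s + 1)}" for \<sigma>
  proof -
    have "{P k 0, P k s, P k (s + 1)} \<in> sector k (T' k)" "{M, P k 0, P k (s + 1)} \<in> sector k (T' k)"
      unfolding T'k using s sector_I by auto
    then show ?thesis using that k disc_I by blast
  qed
  have E1: "\<sigma> \<subseteq> {P k 0, M, P k (s + 1)} \<or> \<sigma> \<subseteq> {P k 0, P k (s + 1), P k s}"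
    if "\<sigma> \<in> disc T'" "P k 0 \<in> \<sigma>" "P k (s + 1) \<in> \<sigma>" for \<sigma>
  proof -
    from that(1) obtain k' \<tau> where k': "k' < n" "\<tau> \<in> sector k' (T' k')" "\<sigma> \<subseteq> \<tau>" unfolding disc_def by blast
    have \<tau>: "P k 0 \<in> \<tau>" "P k (s + 1) \<in> \<tau>" using k'(3) \<open>P k 0 \<in> \<sigma>\<close> \<open>P k (s + 1) \<in> \<sigma>\<close> by blast+
    from k'(2) have "\<tau> = {P k 0, M, P k (s + 1)} \<or> \<tau> = {P k 0, P k (s + 1), P k s}"
    proof (cases rule: sector_cases)
      case (1 i)
      then have le: "i + 1 \<le> p" using T'[of k'] k'(1) by auto
      obtain x where x: "P k 0 = P k' x" "x \<in> {0, i, i + 1}" using \<tau>(1) 1 by auto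
      obtain y where y: "P k (s + 1) = P k' y" "y \<in> {0, i, i + 1}" using \<tau>(2) 1 by auto
      have "k' = k \<and> y = s + 1" using chord[OF x(1) y(1) k'(1)] x(2) y(2) le by auto
      then have "k' = k" "i = s" using y(2) 1 by (auto simp: T'k)
      then show ?thesis using 1 by (simp add: insert_commute)
    next
      case 2
      obtain x where x: "P k 0 = P k' x" "x \<in> {0, T' k'}" using \<tau>(1) 2 by auto
      obtain y where y: "P k (s + 1) = P k' y" "y \<in> {0, T' k'}" using \<tau>(2) 2 by auto
      have "k' = k" using chord[OF x(1) y(1) k'(1)] x(2) y(2) T'[of k'] k'(1) by auto
      then show ?thesis using 2 by (simp add: T'k insert_commute)
    next
      case (3 i)
      obtain x where x: "P k 0 = P k' x" "x \<in> {i, i + 1}" using \<tau>(1) 3 by auto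
      obtain y where y: "P k (s + 1) = P k' y" "y \<in> {i, i + 1}" using \<tau>(2) 3 by auto
      have "x = 0" using chord[OF x(1) y(1) k'(1)] x(2) y(2) 3 by auto
      then show ?thesis using x(2) 3 T'[of k'] k'(1) by auto
    qed
    then show ?thesis using k'(3) by blast
  qed
  have E2: "\<not> (M \<in> \<sigma> \<and> P k s \<in> \<sigma>)" if "\<sigma> \<in> disc T'" for \<sigma>
  proof
    assume both: "M \<in> \<sigma> \<and> P k s \<in> \<sigma>"
    from that obtain k' \<tau> where k': "k' < n" "\<tau> \<in> sector k' (T' k')" "\<sigma> \<subseteq> \<tau>" unfolding disc_def by blast
    have \<tau>: "M \<in> \<tau>" "P k s \<in> \<tau>" using k'(3) both by blast+
    from k'(2) show False
    proof (cases rule: sector_cases)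
      case (1 i)
      then show False using \<tau>(1) by simp
    next
      case 2
      then have "P k s = P k' 0 \<or> P k s = P k' (T' k')" using \<tau>(2) by simp
      then have "k' = k \<and> (s = 0 \<or> T' k' = s)" using idx[of k' 0] idx[of k' "T' k'"] k'(1) T'[of k'] by auto
      then show False using s T'k by auto
    next
      case (3 i)
      then have "P k s = P k' i \<or> P k s = P k' (i + 1)" using \<tau>(2) by simp
      then have "k' = k \<and> (i = s \<or> i + 1 = s)" using idx[of k' i] idx[of k' "i + 1"] k'(1) 3 by auto
      then show False using 3 by (auto simp: T'k)
    qed
  qed
  have E3: "\<sigma> \<in> disc T" if "\<sigma> \<in> disc T'" "\<not> (P k 0 \<in> \<sigma> \<and> P k (s + 1) \<in> \<sigma>)" for \<sigma>
  proof -
    from that(1) obtain k' \<tau> where k': "k' < n" "\<tau> \<in> sector k' (T' k')" "\<sigma> \<subseteq> \<tau>" unfolding disc_def by blast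
    show ?thesis
    proof (cases "k' = k")
      case False
      then show ?thesis using k' T'j by (intro disc_I[of k' \<tau>]) auto
    next
      case True
      have old: "{M, P k 0, P k s} \<in> sector k (T k)" "{M, P k s, P k (s + 1)} \<in> sector k (T k)"
        unfolding s_def[symmetric] using s sector_I by auto
      have "\<exists>\<rho>\<in>sector k (T k). \<sigma> \<subseteq> \<rho>"
        using k'(2)
      proof (cases rule: sector_cases)
        case (1 i)
        show ?thesis
        proof (cases "i = s")
          case True
          then have "\<sigma> \<subseteq> {M, P k 0, P k s} \<or> \<sigma> \<subseteq> {M, P k s, P k (s + 1)}"
            using k'(3) 1 \<open>k' = k\<close> \<open>\<not> (P k 0 \<in> \<sigma> \<and> P k (s + 1) \<in> \<sigma>)\<close> by blast
          then show ?thesis using old by blast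
        next
          case False
          then have "{P k 0, P k i, P k (i + 1)} \<in> sector k (T k)"
            using 1 \<open>k' = k\<close> by (intro sector_I) (auto simp: T'k s_def)
          then show ?thesis using 1 k'(3) \<open>k' = k\<close> by blast
        qed
      next
        case 2
        then have "\<sigma> \<subseteq> {M, P k 0, P k s} \<or> \<sigma> \<subseteq> {M, P k s, P k (s + 1)}"
          using k'(3) True \<open>\<not> (P k 0 \<in> \<sigma> \<and> P k (s + 1) \<in> \<sigma>)\<close> T'k by auto
        then show ?thesis using old by blast
      next
        case (3 i)
        then have "{M, P k i, P k (i + 1)} \<in> sector k (T k)"
          using True by (intro sector_I) (auto simp: T'k s_def)
        then show ?thesis using 3 k'(3) True by blast
      qed
      then show ?thesis using k disc_I by blast
    qed
  qed
  have E4: "\<sigma> \<in> disc T" if "\<sigma> \<subseteq> {P k 0, M, P k s} \<or> \<sigma> \<subseteq> {M, P k (s + 1), P k s}" for \<sigma>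
  proof -
    have "{M, P k 0, P k s} \<in> sector k (T k)" "{M, P k s, P k (s + 1)} \<in> sector k (T k)"
      unfolding s_def[symmetric] using s sector_I by auto
    moreover have "\<sigma> \<subseteq> {M, P k 0, P k s} \<or> \<sigma> \<subseteq> {M, P k s, P k (s + 1)}" using that by blast
    ultimately show ?thesis using k disc_I by blast
  qed
  have sub: "{M, P k 0, P k s, P k (s + 1)} \<subseteq> {1..M}" "{P k 0, M, P k (s + 1), P k s} \<subseteq> {1..M}"
    using P_in_M by blast+
  show "?A \<Longrightarrow> ?B"
    unfolding s_def[symmetric] by (rule flip_points[OF D1 D2 D3 D4 dist sub(1)])
  show "?C \<Longrightarrow> ?D"
    unfolding s_def[symmetric] by (rule flip_points[OF E1 E2 E3 E4 _ sub(2)]) (use dist in auto)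
qed

text \<open>Induction on the number of flips. A flip moves only points with positive coordinate at
  \<open>M\<close>, so the boundary of the disc is fixed pointwise and the attaching map is not
  disturbed.\<close>

lemma disc_transfer:
  assumes "\<And>k. k < n \<Longrightarrow> 1 \<le> T k \<and> T k \<le> p"
  shows "\<exists>f. continuous_map (geometric_realization M (disc (\<lambda>_. 1))) (geometric_realization M (disc T)) f \<and>
    inj_on f (points M (disc (\<lambda>_. 1))) \<and> f ` points M (disc (\<lambda>_. 1)) = points M (disc T) \<and>
    (\<forall>x\<in>points M (disc (\<lambda>_. 1)). x M = 0 \<longrightarrow> f x = x)"
  using assms
proof (induction "\<Sum>k<n. T k - 1" arbitrary: T)
  case 0
  then have "T k = 1" if "k < n" for k using that by force
  then have "disc T = disc (\<lambda>_. 1)" unfolding disc_def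
    by (intro Collect_cong ex_cong1 conj_cong refl) simp
  then show ?case by (intro exI[of _ "\<lambda>x. x"]) (auto simp: inj_on_def)
next
  case (Suc q)
  have "\<exists>k<n. T k - 1 \<noteq> 0"
  proof (rule ccontr)
    assume "\<not> ?thesis"
    then have "(\<Sum>k<n. T k - 1) = 0" by simp
    then show False using Suc(2) by simp
  qed
  then obtain k where k: "k < n" "1 < T k" by auto
  define S where "S = T(k := T k - 1)"
  have S: "1 \<le> S j \<and> S j \<le> p" if "j < n" for j
    using Suc.prems[OF that] k by (auto simp: S_def)
  have "(\<Sum>j<n. T j - 1) = (\<Sum>j<n. S j - 1) + 1"
  proof -
    have "(\<Sum>j<n. T j - 1) = (T k - 1) + (\<Sum>j\<in>{..<n} - {k}. T j - 1)"
      by (rule sum.remove) (use k in auto)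
    moreover have "(\<Sum>j<n. S j - 1) = (S k - 1) + (\<Sum>j\<in>{..<n} - {k}. S j - 1)"
      by (rule sum.remove) (use k in auto)
    moreover have "(\<Sum>j\<in>{..<n} - {k}. S j - 1) = (\<Sum>j\<in>{..<n} - {k}. T j - 1)"
      by (rule sum.cong) (auto simp: S_def)
    ultimately show ?thesis using k by (simp add: S_def)
  qed
  then have "q = (\<Sum>j<n. S j - 1)" using Suc(2) by simp
  then obtain f where f: "continuous_map (geometric_realization M (disc (\<lambda>_. 1))) (geometric_realization M (disc S)) f"
    "inj_on f (points M (disc (\<lambda>_. 1)))" "f ` points M (disc (\<lambda>_. 1)) = points M (disc S)"
    "\<And>x. x \<in> points M (disc (\<lambda>_. 1)) \<Longrightarrow> x M = 0 \<Longrightarrow> f x = x"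
    using Suc(1)[of S] S by blast
  have Sk: "S k < p" using Suc.prems[OF k(1)] k(2) by (simp add: S_def)
  have TS: "S(k := S k + 1) = T" using k by (auto simp: S_def)
  define g where "g = flip M (P k 0) (P k (S k)) (P k (S k + 1))"
  define h where "h = flip (P k 0) M (P k (S k + 1)) (P k (S k))"
  have g: "g x \<in> points M (disc T) \<and> h (g x) = x" if "x \<in> points M (disc S)" for x
    using flip_disc(1)[where T = S and k = k and x = x, OF S k(1) Sk that] unfolding TS g_def h_def .
  have h: "h y \<in> points M (disc S) \<and> g (h y) = y" if "y \<in> points M (disc T)" for y
    using flip_disc(2)[where T = S and k = k and y = y, OF S k(1) Sk] that unfolding TS g_def h_def by blast
  have "continuous_map (geometric_realization M (disc S)) (geometric_realization M (disc T)) g"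
    by (rule continuous_map_realizationI) (use g continuous_map_flip_coord in \<open>auto simp: g_def\<close>)
  then have "continuous_map (geometric_realization M (disc (\<lambda>_. 1))) (geometric_realization M (disc T)) (g \<circ> f)"
    using f(1) continuous_map_compose by blast
  moreover have "inj_on g (points M (disc S))" using g by (metis inj_onI)
  then have "inj_on (g \<circ> f) (points M (disc (\<lambda>_. 1)))"
    using f(2,3) by (intro comp_inj_on) auto
  moreover have "g ` points M (disc S) = points M (disc T)"
    using g h by (auto intro!: image_eqI)
  then have "(g \<circ> f) ` points M (disc (\<lambda>_. 1)) = points M (disc T)"
    unfolding image_comp[symmetric] f(3) .
  moreover have "(g \<circ> f) x = x" if "x \<in> points M (disc (\<lambda>_. 1))" "x M = 0" for x
  proof -
    have "min (x M) (x (P k (S k))) = 0" using that points_nonneg[OF that(1)] by (simp add: min_def)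
    then show ?thesis using f(4)[OF that] by (simp add: g_def flip_id)
  qed
  ultimately show ?case by blast
qed

end

section \<open>Polygonal circles\<close>

text \<open>The boundary of an \<open>L\<close>-gon with vertices \<open>1..L\<close>, every edge
  having length 1: on the interval from \<open>i\<close> to \<open>i + 1\<close> the point moves
  linearly from vertex \<open>i mod L + 1\<close> to the next.\<close>

definition circ :: "nat \<Rightarrow> real \<Rightarrow> nat \<Rightarrow> real" where
  "circ L t = (\<lambda>j. (1 - frac t) * of_bool (j = nat \<lfloor>t\<rfloor> mod L + 1) + frac t * of_bool (j = (nat \<lfloor>t\<rfloor> + 1) mod L + 1))"

text \<open>The formula also holds at the right end, where the floor has already jumped; continuity
  then follows by pasting closed intervals.\<close>

lemma circ_piece:
  assumes "real i \<le> t" "t \<le> real i + 1"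
  shows "circ L t j = (1 - (t - real i)) * of_bool (j = i mod L + 1) + (t - real i) * of_bool (j = (i + 1) mod L + 1)"
proof (cases "t = real i + 1")
  case True
  have "\<lfloor>t\<rfloor> = int (i + 1)" using True by (intro floor_unique) auto
  then have "nat \<lfloor>t\<rfloor> = i + 1" "frac t = 0" using True by (simp_all add: frac_def)
  then show ?thesis using True by (simp add: circ_def)
next
  case False
  then have "\<lfloor>t\<rfloor> = int i" using assms by (intro floor_unique) auto
  then show ?thesis by (simp add: circ_def frac_def)
qed

lemma continuous_on_circ: "continuous_on {0..real k} (\<lambda>t. circ L t j)"
proof (induction k)
  case (Suc k)
  have "continuous_on {real k..real k + 1} (\<lambda>t. circ L t j)"
  proof (rule continuous_on_eq)
    show "continuous_on {real k..real k + 1} (\<lambda>t. (1 - (t - real k)) * of_bool (j = k mod L + 1)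
        + (t - real k) * of_bool (j = (k + 1) mod L + 1))"
      by (intro continuous_intros)
    fix t assume "t \<in> {real k..real k + 1}"
    then show "(1 - (t - real k)) * of_bool (j = k mod L + 1) + (t - real k) * of_bool (j = (k + 1) mod L + 1) = circ L t j"
      by (intro circ_piece[symmetric]) auto
  qed
  then have "continuous_on ({0..real k} \<union> {real k..real k + 1}) (\<lambda>t. circ L t j)"
    using Suc by (intro continuous_on_closed_Un) auto
  moreover have "{0..real k} \<union> {real k..real k + 1} = {0..real (Suc k)}" by auto
  ultimately show ?case by simp
qed simp

lemma circ_shift:
  assumes "0 \<le> t"
  shows "circ L (t + real (L * q)) = circ L t"
proof -
  have fl: "\<lfloor>t + real (L * q)\<rfloor> = \<lfloor>t\<rfloor> + int (L * q)"
    using floor_add_int[of t "int (L * q)"] by simp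
  moreover have "frac (t + real (L * q)) = frac t"
    unfolding frac_def fl by simp
  moreover have "nat (\<lfloor>t\<rfloor> + int (L * q)) = nat \<lfloor>t\<rfloor> + L * q"
    using assms nat_add_distrib[of "\<lfloor>t\<rfloor>" "int (L * q)"] nat_int[of "L * q"] by (simp del: of_nat_mult)
  moreover have "(nat \<lfloor>t\<rfloor> + L * q + 1) mod L = (nat \<lfloor>t\<rfloor> + 1) mod L"
    by (metis add.commute add.left_commute mod_mult_self2)
  ultimately show ?thesis by (simp add: circ_def)
qed

lemma circ_nonneg: "0 \<le> circ L t j"
  using frac_lt_1[of t] by (simp add: circ_def frac_ge_0)

text \<open>If the edges differ, each starting vertex carries positive weight and must be the
  successor of the other, which would force \<open>L = 2\<close>.\<close>

lemma circ_inj: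
  assumes L: "3 \<le> L" and t: "0 \<le> t" "t < real L" and t': "0 \<le> t'" "t' < real L" and eq: "circ L t = circ L t'"
  shows "t = t'"
proof -
  define i i' where "i = nat \<lfloor>t\<rfloor>" and "i' = nat \<lfloor>t'\<rfloor>"
  have i: "i < L" "i' < L" using t t' by (simp_all add: i_def i'_def) linarith+
  have ti: "t = real i + frac t" "t' = real i' + frac t'" using t t' by (simp_all add: i_def i'_def frac_def)
  have c: "circ L t j = (1 - frac t) * of_bool (j = i + 1) + frac t * of_bool (j = (i + 1) mod L + 1)"
    "circ L t' j = (1 - frac t') * of_bool (j = i' + 1) + frac t' * of_bool (j = (i' + 1) mod L + 1)" for j
    using i by (simp_all add: circ_def i_def i'_def)
  have neq: "(i + 1) mod L \<noteq> i" "(i' + 1) mod L \<noteq> i'" using i L by (auto simp: mod_Suc)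
  have pos: "0 < 1 - frac t" "0 < 1 - frac t'" using frac_lt_1 by simp_all
  have "i = i'"
  proof (rule ccontr)
    assume ne: "i \<noteq> i'"
    have "circ L t' (i + 1) = 1 - frac t" using c(1)[of "i + 1"] neq eq by auto
    then have 1: "i = (i' + 1) mod L" using pos ne c(2)[of "i + 1"] by (auto simp: of_bool_def split: if_splits)
    have "circ L t (i' + 1) = 1 - frac t'" using c(2)[of "i' + 1"] neq eq by auto
    then have "i' = (i + 1) mod L" using pos ne c(1)[of "i' + 1"] by (auto simp: of_bool_def split: if_splits)
    then show False using 1 i L by (auto simp: mod_Suc split: if_splits)
  qed
  moreover have "frac t = circ L t ((i + 1) mod L + 1)" using c(1)[of "(i + 1) mod L + 1"] neq by auto
  moreover have "frac t' = circ L t' ((i' + 1) mod L + 1)" using c(2)[of "(i' + 1) mod L + 1"] neq by auto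
  ultimately show ?thesis using ti eq by simp
qed

lemma circ_end: "0 < L \<Longrightarrow> circ L (real L) = circ L 0"
  using circ_shift[of 0 L 1] by simp

lemma circ_eq_imp_cis:
  assumes L: "3 \<le> L" and t: "t \<in> {0..real L}" "t' \<in> {0..real L}" and eq: "circ L t = circ L t'"
  shows "cis (2 * pi * t / real L) = cis (2 * pi * t' / real L)"
proof -
  define s where "s u = (if u = real L then 0 else u)" for u
  have s: "0 \<le> s u" "s u < real L" "circ L (s u) = circ L u" "cis (2 * pi * s u / real L) = cis (2 * pi * u / real L)"
    if "u \<in> {0..real L}" for u
    using that L circ_end[of L] by (auto simp: s_def)
  have "s t = s t'"
    by (rule circ_inj[OF L s(1,2)[OF t(1)] s(1,2)[OF t(2)]]) (use s(3)[OF t(1)] s(3)[OF t(2)] eq in simp)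
  then show ?thesis using s(4)[OF t(1)] s(4)[OF t(2)] by simp
qed

section \<open>The realization is a Moore space\<close>

context moore_triangulation
begin

section \<open>The cone over the \<open>N\<close>-gon\<close>

definition cone :: "real \<times> real \<Rightarrow> nat \<Rightarrow> real" where
  "cone = (\<lambda>(r, t) j. if j = M then 1 - r else r * circ N t j)"

lemma circ_N_M: "circ N t M = 0"
proof -
  have "q mod N + 1 \<noteq> M" for q using mod_less_divisor[OF N_pos(1), of q] by (auto simp: M_def)
  then show ?thesis by (simp add: circ_def) (metis M_def Suc_eq_plus1)
qed

lemma disc_1: "\<sigma> \<in> disc (\<lambda>_. 1) \<longleftrightarrow> (\<exists>q<N. \<sigma> \<subseteq> {M, q + 1, (q + 1) mod N + 1})"
proof
  assume "\<sigma> \<in> disc (\<lambda>_. 1)"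
  then obtain k \<tau> where k: "k < n" "\<tau> \<in> sector k 1" "\<sigma> \<subseteq> \<tau>" unfolding disc_def by blast
  have "\<exists>i<p. \<tau> = {M, P k i, P k (i + 1)}"
    using k(2)
  proof (cases rule: sector_cases)
    case 2
    then show ?thesis using p by (intro exI[of _ 0]) auto
  qed auto
  then obtain i where i: "i < p" "\<tau> = {M, P k i, P k (i + 1)}" by blast
  have "P k i = (k * p + i) + 1" using P_lt[OF k(1) i(1)] .
  moreover have "P k (i + 1) = (k * p + i + 1) mod N + 1" by (simp add: P_def)
  moreover have "k * p + i < N" using P_in[of k i] P_lt[OF k(1) i(1)] by simp
  ultimately show "\<exists>q<N. \<sigma> \<subseteq> {M, q + 1, (q + 1) mod N + 1}" using k(3) i(2) by metis
next
  assume "\<exists>q<N. \<sigma> \<subseteq> {M, q + 1, (q + 1) mod N + 1}"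
  then obtain q where q: "q < N" "\<sigma> \<subseteq> {M, q + 1, (q + 1) mod N + 1}" by blast
  define k i where "k = q div p" and "i = q mod p"
  have ki: "k < n" "i < p" "q = k * p + i"
    using q(1) p by (simp_all add: k_def i_def N_def less_mult_imp_div_less)
  have "{M, q + 1, (q + 1) mod N + 1} = {M, P k i, P k (i + 1)}"
    using P_lt[OF ki(1,2)] ki(3) by (simp add: P_def)
  moreover have "{M, P k i, P k (i + 1)} \<in> sector k 1"
    using sector_I(2)[of k 1] sector_I(3)[of 1 i k] ki(2) by (cases "i = 0") auto
  ultimately show "\<sigma> \<in> disc (\<lambda>_. 1)" using disc_I[OF ki(1), of _ "\<lambda>_. 1"] q(2) by simp
qed

lemma sum_circ: "(\<Sum>j\<in>{1..N}. circ N t j) = 1"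
proof -
  have S: "(\<Sum>j\<in>{1..N}. r * of_bool (j = q mod N + 1)) = r" for r :: real and q
  proof -
    have "q mod N + 1 \<in> {1..N}" using mod_less_divisor[OF N_pos(1), of q] by simp
    moreover have "(\<Sum>j\<in>{1..N}. r * of_bool (j = q mod N + 1)) = (\<Sum>j\<in>{1..N}. if j = q mod N + 1 then r else 0)"
      by (rule sum.cong) auto
    ultimately show ?thesis by simp
  qed
  show ?thesis unfolding circ_def sum.distrib S by simp
qed

lemma sum_M: "(\<Sum>j\<in>{1..M}. f j) = (\<Sum>j\<in>{1..N}. f j) + (f M :: real)"
  unfolding M_def by (simp add: atLeastAtMostSuc_conv add.commute)

lemma cone_points:
  assumes "r \<in> {0..1}" "t \<in> {0..real N}"
  shows "cone (r, t) \<in> points M (disc (\<lambda>_. 1))"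
proof -
  define q where "q = nat \<lfloor>t\<rfloor> mod N"
  have q: "q < N" using N_pos by (simp add: q_def)
  have "(q + 1) mod N = (nat \<lfloor>t\<rfloor> + 1) mod N" by (simp add: q_def mod_Suc_eq)
  then have "{j. cone (r, t) j \<noteq> 0} \<subseteq> {M, q + 1, (q + 1) mod N + 1}"
    by (auto simp: cone_def circ_def q_def split: if_splits)
  then have "{j. cone (r, t) j \<noteq> 0} \<in> disc (\<lambda>_. 1)" using q disc_1 by blast
  moreover have "0 \<le> cone (r, t) j" for j
    using assms circ_nonneg by (auto simp: cone_def)
  moreover have "(\<Sum>j\<in>{1..M}. cone (r, t) j) = 1"
  proof -
    have "(\<Sum>j\<in>{1..N}. cone (r, t) j) = (\<Sum>j\<in>{1..N}. r * circ N t j)"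
      by (rule sum.cong) (auto simp: cone_def M_def)
    also have "\<dots> = r" unfolding sum_distrib_left[symmetric] sum_circ by simp
    finally show ?thesis unfolding sum_M by (simp add: cone_def)
  qed
  ultimately show ?thesis by (simp add: points_def)
qed

lemma cone_surj:
  assumes x: "x \<in> points M (disc (\<lambda>_. 1))"
  obtains t where "t \<in> {0..real N}" "x = cone (1 - x M, t)" "1 - x M \<in> {0..1}"
proof -
  obtain q where q: "q < N" "{j. x j \<noteq> 0} \<subseteq> {M, q + 1, (q + 1) mod N + 1}"
    using points_support[OF x] disc_1 by blast
  define u v where "u = q + 1" and "v = (q + 1) mod N + 1"
  have v: "v \<in> {1..N}" using mod_less_divisor[OF N_pos(1), of "q + 1"] by (simp add: v_def)
  have uv: "u \<noteq> v" "u \<noteq> M" "v \<noteq> M" "u \<in> {1..N}"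
    using q(1) N_pos v by (auto simp: u_def v_def M_def mod_Suc)
  have nn: "0 \<le> x j" for j using points_nonneg[OF x] .
  have zero: "x j = 0" if "j \<notin> {M, u, v}" for j using q(2) that by (auto simp: u_def v_def)
  have "(\<Sum>j\<in>{1..N}. x j) = (\<Sum>j\<in>{u, v}. x j)"
    by (rule sum.mono_neutral_right) (use uv v zero in \<open>auto simp: M_def\<close>)
  then have sum: "x u + x v + x M = 1"
    using points_sum[OF x] uv(1) unfolding sum_M by simp
  define r where "r = 1 - x M"
  have r: "r = x u + x v" using sum by (simp add: r_def)
  have r01: "r \<in> {0..1}" using nn[of u] nn[of v] nn[of M] r by (simp add: r_def)
  show thesis
  proof (cases "r = 0")
    case True
    then have "x u = 0" "x v = 0" using r nn[of u] nn[of v] by auto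
    then have "x = cone (r, 0)"
      using zero True by (auto simp: cone_def fun_eq_iff r_def)
    then show thesis using that[of 0] r01 by (simp add: r_def)
  next
    case False
    then have rpos: "0 < r" using r01 by simp
    \<comment> \<open>The ray from \<open>M\<close> through the point meets the edge from
      \<open>u\<close> to \<open>v\<close> in this proportion.\<close>
    define t where "t = real q + x v / r"
    have xv: "0 \<le> x v / r" "x v / r \<le> 1" using rpos r nn[of u] nn[of v] by (simp_all add: field_simps)
    have t: "real q \<le> t" "t \<le> real q + 1" using xv by (simp_all add: t_def)
    have "cone (r, t) j = x j" for j
    proof (cases "j = M")
      case True
      then show ?thesis by (simp add: cone_def r_def)
    next
      case False
      have c: "circ N t j = (1 - x v / r) * of_bool (j = u) + x v / r * of_bool (j = v)"
        unfolding circ_piece[OF t] using q(1) by (simp add: t_def u_def v_def)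
      have "r * (1 - x v / r) = x u" using rpos r by (simp add: field_simps)
      then show ?thesis
        using False zero[of j] rpos uv(1) unfolding cone_def by (simp add: c)
    qed
    then have "x = cone (r, t)" by (intro ext) simp
    moreover have "t \<in> {0..real N}" using t q(1) by auto
    ultimately show thesis using that[of t] r01 unfolding r_def by simp
  qed
qed

lemma cone_eq_imp:
  assumes "r \<in> {0..1}" "t \<in> {0..real N}" "r' \<in> {0..1}" "t' \<in> {0..real N}" "cone (r, t) = cone (r', t')"
  shows "r = r' \<and> of_real r * cis (2 * pi * t / real N) = of_real r' * cis (2 * pi * t' / real N)"
proof -
  have r: "r = r'" using fun_cong[OF assms(5), of M] by (simp add: cone_def)
  show ?thesis
  proof (cases "r = 0")
    case False
    have "circ N t j = circ N t' j" for j
      using fun_cong[OF assms(5), of j] r False circ_N_M by (cases "j = M") (auto simp: cone_def)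
    then have "circ N t = circ N t'" by (rule ext)
    then show ?thesis using circ_eq_imp_cis[of N t t'] assms N_pos r by simp
  qed (use r in simp)
qed

section \<open>The gluing map from the disc to \<open>K0\<close>\<close>

definition Lab :: "nat \<Rightarrow> nat" where "Lab j = (if j = M then c else V (j - 1))"

text \<open>The affine extension of the vertex labelling \<open>Lab\<close>: weights of vertices
  with equal labels add up.\<close>

definition glue :: "(nat \<Rightarrow> real) \<Rightarrow> nat \<Rightarrow> real" where
  "glue x = (\<lambda>l. \<Sum>j\<in>{1..M}. x j * of_bool (Lab j = l))"

lemma V_mod_N: "V (q mod N) = V q"
  by (simp add: V_def N_def mod_mod_cancel)

lemma Lab_P: "Lab (P k i) = V (k * p + i)"
  using V_mod_N[of "k * p + i"] by (simp add: Lab_def) (simp add: P_def)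

lemma Lab_M: "Lab M = c" by (simp add: Lab_def)

lemma Lab_eq_c: "Lab j = c \<longleftrightarrow> j = M" by (simp add: Lab_def)

lemma glue_Lab:
  assumes S: "inj_on Lab S" "S \<subseteq> {1..M}" "{j. x j \<noteq> 0} \<subseteq> S" and j: "j \<in> S"
  shows "glue x (Lab j) = x j"
proof -
  have "glue x (Lab j) = (\<Sum>i\<in>{1..M}. if i = j then x i else 0)"
    unfolding glue_def
  proof (rule sum.cong[OF refl])
    fix i
    show "x i * of_bool (Lab i = Lab j) = (if i = j then x i else 0)"
      using S(1,3) j by (cases "x i = 0") (auto simp: inj_on_def)
  qed
  then show ?thesis using S(2) j by auto
qed

lemma glue_support:
  assumes S: "inj_on Lab S" "S \<subseteq> {1..M}" "{j. x j \<noteq> 0} \<subseteq> S"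
  shows "{l. glue x l \<noteq> 0} = Lab ` {j. x j \<noteq> 0}"
proof
  show "{l. glue x l \<noteq> 0} \<subseteq> Lab ` {j. x j \<noteq> 0}"
  proof
    fix l assume "l \<in> {l. glue x l \<noteq> 0}"
    then have "(\<Sum>j\<in>{1..M}. x j * of_bool (Lab j = l)) \<noteq> 0" by (simp add: glue_def)
    then obtain j where "x j * of_bool (Lab j = l) \<noteq> 0" by (meson sum.not_neutral_contains_not_neutral)
    then show "l \<in> Lab ` {j. x j \<noteq> 0}" by (auto split: if_splits)
  qed
  show "Lab ` {j. x j \<noteq> 0} \<subseteq> {l. glue x l \<noteq> 0}"
    using glue_Lab[OF S] S(3) by auto
qed

lemma glue_eq_imp:
  assumes S: "inj_on Lab S" "S \<subseteq> {1..M}" "{j. x j \<noteq> 0} \<subseteq> S" "{j. y j \<noteq> 0} \<subseteq> S" and eq: "glue x = glue y"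
  shows "x = y"
proof
  fix j
  show "x j = y j"
  proof (cases "j \<in> S")
    case True
    then show ?thesis using glue_Lab[OF S(1,2,3)] glue_Lab[OF S(1,2,4)] eq by metis
  next
    case False
    then have "x j = 0" "y j = 0" using S(3,4) by blast+
    then show ?thesis by simp
  qed
qed

definition closed_sector :: "nat \<Rightarrow> nat set" where
  "closed_sector k = insert M (P k ` {0..p})"

text \<open>The labels of the boundary vertices of a sector are \<open>p + 1\<close> consecutive
  residues modulo \<open>n\<close>, and \<open>p + 1 \<le> n\<close>.\<close>

lemma inj_Lab_sector: "inj_on Lab (closed_sector k)"
proof -
  have "i = i'" if "i \<in> {0..p}" "i' \<in> {0..p}" "V (k * p + i) = V (k * p + i')" for i i'
    using V_add_neq[of i' i "k * p"] that n_gt(1) by (metis atLeastAtMost_iff le_less_trans)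
  then have "inj_on (\<lambda>i. V (k * p + i)) {0..p}" by (intro inj_onI)
  then have "inj_on Lab (P k ` {0..p})"
    by (auto simp: inj_on_def Lab_P)
  then show ?thesis
    unfolding closed_sector_def inj_on_insert by (auto simp: Lab_P Lab_M)
qed

lemma closed_sector_sub: "closed_sector k \<subseteq> {1..M}"
  unfolding closed_sector_def using P_in_M by blast

lemma sector_closed: "\<tau> \<in> sector k p \<Longrightarrow> \<tau> \<subseteq> closed_sector k"
  by (auto simp: closed_sector_def elim!: sector_cases)

lemma disc_p:
  assumes "x \<in> points M (disc (\<lambda>_. p))"
  obtains k \<tau> where "k < n" "\<tau> \<in> sector k p" "{j. x j \<noteq> 0} \<subseteq> \<tau>"
  using points_support[OF assms] unfolding disc_def by blast

lemma inj_mult_p: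
  assumes "k < n" "k' < n" "V (k * p) = V (k' * p)"
  shows "k = k'"
proof -
  have inv: "((n - 2) * ((i * p) mod n)) mod n = i" if "i < n" for i
    using inverse_p[of i] that by (metis mod_less mod_mult_right_eq mult.assoc)
  have "(k * p) mod n = (k' * p) mod n" using assms(3) by (simp add: V_eq_iff)
  then show ?thesis using inv[OF assms(1)] inv[OF assms(2)] by metis
qed

definition boundary :: "nat set \<Rightarrow> bool" where
  "boundary \<sigma> \<longleftrightarrow> (\<exists>q. \<sigma> \<subseteq> {q mod N + 1, (q + 1) mod N + 1})"

lemma boundary_P: "\<sigma> \<subseteq> {P k i, P k (i + 1)} \<Longrightarrow> boundary \<sigma>"
  unfolding boundary_def P_def by (metis add.assoc)

text \<open>If \<open>M\<close> carries weight, both points lie in central triangles, whose vertices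
  other than \<open>M\<close> are corners of sectors; the labels \<open>V (k * p)\<close> of the
  corners are distinct since \<open>p\<close> is a unit modulo \<open>n\<close>. Otherwise the
  support of \<open>x\<close> contains a chord of length \<open>s \<ge> 2\<close> from the corner of
  its sector. As \<open>2 * p < n\<close>, a label difference of \<open>s\<close> within a triangle
  of any sector occurs only from the corner. So \<open>x\<close> and \<open>y\<close> share the
  sector, on which labels are injective.\<close>

lemma glue_interior:
  assumes x: "x \<in> points M (disc (\<lambda>_. p))" and y: "y \<in> points M (disc (\<lambda>_. p))"
    and eq: "glue x = glue y" and nb: "\<not> boundary {j. x j \<noteq> 0}"
  shows "x = y"
proof -
  define \<sigma> \<sigma>' where "\<sigma> = {j. x j \<noteq> 0}" and "\<sigma>' = {j. y j \<noteq> 0}"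
  obtain k \<tau> where k: "k < n" "\<tau> \<in> sector k p" "\<sigma> \<subseteq> \<tau>" using disc_p[OF x] unfolding \<sigma>_def by blast
  obtain k' \<tau>' where k': "k' < n" "\<tau>' \<in> sector k' p" "\<sigma>' \<subseteq> \<tau>'" using disc_p[OF y] unfolding \<sigma>'_def by blast
  have sec: "\<sigma> \<subseteq> closed_sector k" "\<sigma>' \<subseteq> closed_sector k'"
    using k k' sector_closed by blast+
  have Lab: "Lab ` \<sigma> = Lab ` \<sigma>'"
    using glue_support[OF inj_Lab_sector closed_sector_sub, of x k] glue_support[OF inj_Lab_sector closed_sector_sub, of y k']
      sec eq unfolding \<sigma>_def \<sigma>'_def by simp
  have MM: "M \<in> \<sigma> \<longleftrightarrow> M \<in> \<sigma>'"
    using Lab Lab_eq_c by (metis imageE imageI)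
  show ?thesis
  proof (cases "M \<in> \<sigma>")
    case True
    define S where "S = insert M ((\<lambda>k. P k 0) ` {..<n})"
    have "Lab (P i 0) = V (i * p)" for i by (simp add: Lab_P)
    then have inj: "inj_on Lab S"
      unfolding S_def inj_on_def using inj_mult_p by (auto simp: Lab_M)
    have *: "\<rho> \<subseteq> S" if "i < n" "\<rho> \<in> sector i p" "M \<in> \<rho>" for i \<rho>
    proof -
      have "\<rho> = {M, P i 0, P i p}"
        using that(2,3) by (cases rule: sector_cases) auto
      then show ?thesis using P_p[OF that(1)] that(1) Suc_mod_lt by (auto simp: S_def)
    qed
    have "\<sigma> \<subseteq> S" using *[OF k(1,2)] k(3) True by blast
    moreover have "\<sigma>' \<subseteq> S" using *[OF k'(1,2)] k'(3) True MM by blast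
    moreover have "S \<subseteq> {1..M}" unfolding S_def using P_in_M by blast
    ultimately show ?thesis using glue_eq_imp[OF inj] eq unfolding \<sigma>_def \<sigma>'_def by blast
  next
    case False
    have nb': "\<not> \<sigma> \<subseteq> {P k i, P k (i + 1)}" for i using nb boundary_P unfolding \<sigma>_def by blast
    have "\<exists>s\<in>{2..p}. P k 0 \<in> \<sigma> \<and> P k s \<in> \<sigma>"
      using k(2)
    proof (cases rule: sector_cases)
      case (1 i)
      have "P k 0 \<in> \<sigma>" using nb'[of i] 1 k(3) by blast
      moreover have "P k i \<in> \<sigma> \<or> P k (i + 1) \<in> \<sigma>" using nb'[of 0] 1 k(3) by blast
      moreover have "P k 2 \<in> \<sigma>" if "i = 1" using nb'[of 0] 1 k(3) that by (auto simp: numeral_2_eq_2)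
      moreover have "i + 1 \<in> {2..p}" "i \<noteq> 1 \<Longrightarrow> i \<in> {2..p}" using 1 by auto
      ultimately show ?thesis using p by (cases "i = 1") force+
    next
      case 2
      then have sub: "\<sigma> \<subseteq> {P k 0, P k p}" using k(3) False by blast
      have "P k p \<in> \<sigma>" using nb'[of 0] sub by blast
      moreover have "P k 0 \<in> \<sigma>" using nb'[of p] sub by blast
      ultimately show ?thesis using p by auto
    qed auto
    then obtain s where s: "2 \<le> s" "s \<le> p" "P k 0 \<in> \<sigma>" "P k s \<in> \<sigma>" by auto
    have "\<exists>X. (X = {0, p} \<or> (\<exists>i. 1 \<le> i \<and> i < p \<and> X = {0, i, i + 1})) \<and> \<sigma>' \<subseteq> P k' ` X"
      using k'(2)
    proof (cases rule: sector_cases)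
      case (1 i)
      then show ?thesis using k'(3) by (intro exI[of _ "{0, i, i + 1}"]) auto
    next
      case 2
      then show ?thesis using k'(3) False MM by (intro exI[of _ "{0, p}"]) auto
    qed auto
    then obtain X where X: "X = {0, p} \<or> (\<exists>i. 1 \<le> i \<and> i < p \<and> X = {0, i, i + 1})" "\<sigma>' \<subseteq> P k' ` X" by blast
    have "V (k * p) \<in> Lab ` \<sigma>'" "V (k * p + s) \<in> Lab ` \<sigma>'"
      unfolding Lab[symmetric] using s Lab_P[of k 0] Lab_P[of k s] by (metis add_0_right imageI)+
    moreover have "\<exists>u\<in>X. l = V (k' * p + u)" if "l \<in> Lab ` \<sigma>'" for l
    proof -
      obtain j where "j \<in> \<sigma>'" "l = Lab j" using \<open>l \<in> Lab ` \<sigma>'\<close> by blast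
      moreover from this obtain u where "u \<in> X" "j = P k' u" using X(2) by blast
      ultimately show ?thesis using Lab_P[of k' u] by blast
    qed
    ultimately obtain u w where u: "u \<in> X" "V (k * p) = V (k' * p + u)"
      and w: "w \<in> X" "V (k * p + s) = V (k' * p + w)" by meson
    have uw: "u \<le> p" "w \<le> p" using u w X(1) by auto
    have "V (k * p + s) = V (k' * p + (u + s))"
      unfolding V_eq_iff add.assoc[symmetric] by (rule mod_add_cong) (use u(2) in \<open>simp_all add: V_eq_iff\<close>)
    then have "V (k' * p + w) = V (k' * p + (u + s))" using w(2) by simp
    moreover have "u + s < n" "w < n" using uw s n_gt(2) by linarith+
    ultimately have ws: "w = u + s" using V_add_neq by metis
    \<comment> \<open>The indices in \<open>X\<close> other than 0 are at most 1 apart, but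
      \<open>s \<ge> 2\<close>.\<close>
    then have "u = 0" using u w X(1) s by auto
    then have "k = k'" using inj_mult_p[OF k(1) k'(1)] u(2) by simp
    then show ?thesis
      using glue_eq_imp[OF inj_Lab_sector closed_sector_sub _ _ eq] sec unfolding \<sigma>_def \<sigma>'_def by blast
  qed
qed

lemma Lab_facet: "\<tau> \<in> sector k p \<Longrightarrow> Lab ` \<tau> \<in> facets0"
proof -
  have "{V (k * p), V (k * p + i), V (k * p + i + 1)} \<in> facets0" if "1 \<le> i" "i < p" for i
    unfolding facets0_def using that by blast
  moreover have "{c, V (k * p), V (k * p + p)} \<in> facets0"
    unfolding facets0_def by blast
  ultimately show "\<tau> \<in> sector k p \<Longrightarrow> Lab ` \<tau> \<in> facets0"
    by (auto simp: Lab_P Lab_M add.assoc elim!: sector_cases)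
qed

lemma glue_points:
  assumes x: "x \<in> points M (disc (\<lambda>_. p))"
  shows "glue x \<in> points c K0"
proof -
  obtain k \<tau> where k: "k < n" "\<tau> \<in> sector k p" "{j. x j \<noteq> 0} \<subseteq> \<tau>" using disc_p[OF x] by blast
  have "{l. glue x l \<noteq> 0} = Lab ` {j. x j \<noteq> 0}"
    by (rule glue_support[OF inj_Lab_sector closed_sector_sub]) (use k sector_closed in blast)
  also have "\<dots> \<subseteq> Lab ` \<tau>" using k(3) by blast
  finally have "{l. glue x l \<noteq> 0} \<in> K0"
    unfolding K0_def using Lab_facet[OF k(2)] by blast
  moreover have "0 \<le> glue x l" for l
    unfolding glue_def using points_nonneg[OF x] by (intro sum_nonneg) simp
  moreover have "(\<Sum>l\<in>{1..c}. glue x l) = 1"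
  proof -
    have "(\<Sum>l\<in>{1..c}. glue x l) = (\<Sum>j\<in>{1..M}. \<Sum>l\<in>{1..c}. x j * of_bool (Lab j = l))"
      unfolding glue_def by (rule sum.swap)
    also have "\<dots> = (\<Sum>j\<in>{1..M}. x j)"
    proof (rule sum.cong[OF refl])
      fix j
      have "Lab j \<in> {1..c}" using V_in[of "j - 1"] by (auto simp: Lab_def c_def n_def)
      moreover have "(\<Sum>l\<in>{1..c}. x j * of_bool (Lab j = l)) = (\<Sum>l\<in>{1..c}. if Lab j = l then x j else 0)"
        by (rule sum.cong) auto
      ultimately show "(\<Sum>l\<in>{1..c}. x j * of_bool (Lab j = l)) = x j" by simp
    qed
    finally show ?thesis using points_sum[OF x] by simp
  qed
  ultimately show ?thesis by (simp add: points_def)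
qed

lemma facets0_sub: "\<tau> \<in> facets0 \<Longrightarrow> \<tau> \<subseteq> {1..c}"
proof -
  have "V j \<in> {1..c}" for j using V_in[of j] by (auto simp: c_def n_def)
  moreover have "c \<in> {1..c}" by (simp add: c_def)
  ultimately show "\<tau> \<in> facets0 \<Longrightarrow> \<tau> \<subseteq> {1..c}" unfolding facets0_def by blast
qed

lemma facet_lift:
  assumes "\<rho> \<in> facets0"
  obtains k \<tau> where "k < n" "\<tau> \<in> sector k p" "Lab ` \<tau> = \<rho>"
proof -
  have lift: "\<exists>k<n. \<forall>i. V (k * p + i) = V (j + i)" for j
  \<comment> \<open>Sector \<open>k\<close> starts at label \<open>V (k * p)\<close>, so
    \<open>k\<close> is \<open>j\<close> divided by \<open>p\<close> modulo
    \<open>n\<close>.\<close>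
  proof (intro exI[of _ "((n - 2) * j) mod n"] conjI allI)
    show "((n - 2) * j) mod n < n" using n_gt(3) by simp
    fix i
    have "(((n - 2) * j) mod n * p) mod n = j mod n"
      unfolding mod_mult_left_eq by (rule inverse_p)
    then show "V (((n - 2) * j) mod n * p + i) = V (j + i)" by (metis V_mod(2))
  qed
  consider j t where "1 \<le> t" "t < p" "\<rho> = {V j, V (j + t), V (j + t + 1)}" | j where "\<rho> = {c, V j, V (j + p)}"
    using assms unfolding facets0_def by blast
  then show thesis
  proof cases
    case (1 j t)
    obtain k where k: "k < n" "\<And>i. V (k * p + i) = V (j + i)" using lift by blast
    have "Lab ` {P k 0, P k t, P k (t + 1)} = \<rho>"
      unfolding 1 using k(2)[of 0] k(2)[of t] k(2)[of "t + 1"] by (simp add: Lab_P)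
    then show thesis using that[OF k(1) sector_I(1)[OF 1(1,2)]] by blast
  next
    case (2 j)
    obtain k where k: "k < n" "\<And>i. V (k * p + i) = V (j + i)" using lift by blast
    have "Lab ` {M, P k 0, P k p} = \<rho>"
      unfolding 2 using k(2)[of 0] k(2)[of p] by (simp add: Lab_P Lab_M)
    then show thesis using that[OF k(1) sector_I(2)] by blast
  qed
qed

lemma glue_surj:
  assumes y: "y \<in> points c K0"
  shows "\<exists>x\<in>points M (disc (\<lambda>_. p)). glue x = y"
proof -
  obtain \<rho> where \<rho>: "\<rho> \<in> facets0" "{l. y l \<noteq> 0} \<subseteq> \<rho>" using points_support[OF y] unfolding K0_def by blast
  obtain k \<tau> where k: "k < n" "\<tau> \<in> sector k p" "Lab ` \<tau> = \<rho>" by (rule facet_lift[OF \<rho>(1)])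
  define x where "x j = (if j \<in> \<tau> then y (Lab j) else 0)" for j
  have inj: "inj_on Lab \<tau>" using inj_Lab_sector sector_closed[OF k(2)] by (rule inj_on_subset)
  have sub: "\<tau> \<subseteq> {1..M}" using sector_closed[OF k(2)] closed_sector_sub by blast
  have supp: "{j. x j \<noteq> 0} \<subseteq> \<tau>" by (auto simp: x_def)
  have "(\<Sum>j\<in>{1..M}. x j) = (\<Sum>j\<in>\<tau>. y (Lab j))"
    by (rule sum.mono_neutral_cong_right) (use sub in \<open>auto simp: x_def\<close>)
  also have "\<dots> = (\<Sum>l\<in>\<rho>. y l)" unfolding k(3)[symmetric] by (simp add: sum.reindex inj)
  also have "\<dots> = (\<Sum>l\<in>{1..c}. y l)"
    by (rule sum.mono_neutral_left) (use facets0_sub[OF \<rho>(1)] \<rho>(2) in auto)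
  finally have "(\<Sum>j\<in>{1..M}. x j) = 1" using points_sum[OF y] by simp
  moreover have "0 \<le> x j" for j using points_nonneg[OF y] by (simp add: x_def)
  moreover have "{j. x j \<noteq> 0} \<in> disc (\<lambda>_. p)" using disc_I[OF k(1), of \<tau> "\<lambda>_. p"] k(2) supp by simp
  ultimately have "x \<in> points M (disc (\<lambda>_. p))" by (simp add: points_def)
  moreover have "glue x = y"
  proof
    fix l
    show "glue x l = y l"
    proof (cases "l \<in> \<rho>")
      case True
      then obtain j where j: "j \<in> \<tau>" "l = Lab j" using k(3) by blast
      have "glue x l = x j" unfolding j(2) by (rule glue_Lab[OF inj sub supp j(1)])
      then show ?thesis using j by (simp add: x_def)
    next
      case False
      then have "l \<notin> Lab ` {j. x j \<noteq> 0}" using supp k(3) by blast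
      then have "glue x l = 0" using glue_support[OF inj sub supp] by blast
      then show ?thesis using False \<rho>(2) by auto
    qed
  qed
  ultimately show ?thesis by blast
qed

text \<open>Labels reduce vertex numbers from modulo \<open>N = n * p\<close> to modulo
  \<open>n\<close>, so the boundary \<open>N\<close>-gon wraps \<open>p\<close> times round the
  \<open>n\<close>-gon. This is the degree of the attaching map.\<close>

lemma glue_cone: "glue (cone (1, t)) = circ n t"
proof
  fix l
  have lab: "Lab (q mod N + 1) = V q" for q
  proof -
    have "q mod N + 1 \<noteq> M" using mod_less_divisor[OF N_pos(1), of q] by (auto simp: M_def)
    then show ?thesis by (simp add: Lab_def V_mod_N)
  qed
  have "(\<Sum>j\<in>{1..N}. r * of_bool (j = q mod N + 1) * of_bool (Lab j = l)) = r * of_bool (l = q mod n + 1)" for r :: real and q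
  proof -
    have "q mod N + 1 \<in> {1..N}" using mod_less_divisor[OF N_pos(1), of q] by simp
    moreover have "(\<Sum>j\<in>{1..N}. r * of_bool (j = q mod N + 1) * of_bool (Lab j = l)) =
        (\<Sum>j\<in>{1..N}. if j = q mod N + 1 then r * of_bool (V q = l) else 0)"
      by (rule sum.cong[OF refl]) (use lab[of q] in auto)
    ultimately have "(\<Sum>j\<in>{1..N}. r * of_bool (j = q mod N + 1) * of_bool (Lab j = l)) = r * of_bool (V q = l)"
      by simp
    then show ?thesis unfolding V_def eq_commute[of l] .
  qed
  then have "(\<Sum>j\<in>{1..N}. circ N t j * of_bool (Lab j = l)) = circ n t l"
    unfolding circ_def distrib_right sum.distrib by (simp only:)
  moreover have "(\<Sum>j\<in>{1..N}. cone (1, t) j * of_bool (Lab j = l)) = (\<Sum>j\<in>{1..N}. circ N t j * of_bool (Lab j = l))"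
    by (rule sum.cong) (auto simp: cone_def M_def)
  ultimately show "glue (cone (1, t)) l = circ n t l"
    unfolding glue_def sum_M by (simp add: cone_def)
qed

lemma boundary_cone:
  assumes "x \<in> points M (disc (\<lambda>_. p))" "boundary {j. x j \<noteq> 0}"
  shows "\<exists>t\<in>{0..real N}. x = cone (1, t)"
proof -
  obtain q where q: "{j. x j \<noteq> 0} \<subseteq> {q mod N + 1, (q + 1) mod N + 1}" using assms(2) unfolding boundary_def by blast
  have "q mod N < N" "(q + 1) mod N = (q mod N + 1) mod N" using N_pos by (simp_all add: mod_Suc_eq)
  then have "{j. x j \<noteq> 0} \<in> disc (\<lambda>_. 1)" using q disc_1 by (metis subset_insertI2)
  then have x: "x \<in> points M (disc (\<lambda>_. 1))" using assms(1) by (simp add: points_def)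
  have "M \<notin> {q mod N + 1, (q + 1) mod N + 1}"
    using mod_less_divisor[OF N_pos(1)] by (auto simp: M_def) (metis less_irrefl)+
  then have "x M = 0" using q by auto
  moreover obtain t where "t \<in> {0..real N}" "x = cone (1 - x M, t)" using cone_surj[OF x] by blast
  ultimately show ?thesis by auto
qed

section \<open>Comparison with the quotient of disc and circle\<close>

lemma continuous_cone:
  "continuous_map (top_of_set ({0..1} \<times> {0..real N})) (geometric_realization M (disc (\<lambda>_. 1))) cone"
proof (rule continuous_map_realizationI)
  fix j
  have "continuous_on ({0..1} \<times> {0..real N}) (\<lambda>v :: real \<times> real. circ N (snd v) j)"
    by (rule continuous_on_compose2[OF continuous_on_circ[of N N j] continuous_on_snd[OF continuous_on_id]]) auto
  then have "continuous_on ({0..1} \<times> {0..real N}) (\<lambda>v. if j = M then 1 - fst v else fst v * circ N (snd v) j)"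
    by (cases "j = M") (auto intro!: continuous_intros)
  moreover have "(\<lambda>v. cone v j) = (\<lambda>v. if j = M then 1 - fst v else fst v * circ N (snd v) j)"
    by (auto simp: cone_def fun_eq_iff)
  ultimately show "continuous_map (top_of_set ({0..1} \<times> {0..real N})) euclideanreal (\<lambda>v. cone v j)"
    by (simp only: continuous_map_iff_continuous)
next
  fix v :: "real \<times> real" assume "v \<in> topspace (top_of_set ({0..1} \<times> {0..real N}))"
  then show "cone v \<in> points M (disc (\<lambda>_. 1))"
    using cone_points[of "fst v" "snd v"] by auto
qed

lemma continuous_glue:
  "continuous_map (geometric_realization M (disc (\<lambda>_. p))) (geometric_realization c K0) glue"
proof (rule continuous_map_realizationI)
  show "continuous_map (geometric_realization M (disc (\<lambda>_. p))) euclideanreal (\<lambda>x. glue x l)" for l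
    unfolding glue_def
    by (intro continuous_map_sum continuous_map_real_mult_right continuous_map_coord) simp
qed (use glue_points in simp)

lemma cone_ends: "0 < N \<Longrightarrow> cone (r, 0) = cone (r, real N)" "cone (0, t) = cone (0, s)"
  by (auto simp: cone_def fun_eq_iff circ_end)

text \<open>A continuous surjection from the compact sum of disc and circle to a Hausdorff space is
  a quotient map, so it remains to show that its identifications are those of the attaching
  map.\<close>

lemma K0_homeomorphic: "geometric_realization c K0 homeomorphic_space moore_space p"
proof -
  have p0: "0 < p" using p by simp
  have Nn: "real N = real n * real p" by (simp add: N_def)
  have npos: "0 < real n" "0 < real N" using n_gt(3) N_pos by simp_all
  obtain f where f: "continuous_map (geometric_realization M (disc (\<lambda>_. 1))) (geometric_realization M (disc (\<lambda>_. p))) f"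
    and f_inj: "inj_on f (points M (disc (\<lambda>_. 1)))"
    and f_img: "f ` points M (disc (\<lambda>_. 1)) = points M (disc (\<lambda>_. p))"
    and f_id: "\<And>x. x \<in> points M (disc (\<lambda>_. 1)) \<Longrightarrow> x M = 0 \<Longrightarrow> f x = x"
    using disc_transfer[of "\<lambda>_. p"] p0 by auto
  define G where "G v = glue (f (cone v))" for v
  have contG: "continuous_map (top_of_set ({0..1} \<times> {0..real N})) (geometric_realization c K0) G"
    using continuous_map_compose[OF continuous_map_compose[OF continuous_cone f] continuous_glue]
    by (simp add: G_def[abs_def] o_def)
  have Gends: "G (r, 0) = G (r, real N)" "G (0, t) = G (0, s)" for r t s
    unfolding G_def using cone_ends N_pos by metis+
  obtain F1 where F1: "continuous_map (top_of_set (cball 0 1)) (geometric_realization c K0) F1"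
    and F1_eq: "\<And>r t. r \<in> {0..1} \<Longrightarrow> t \<in> {0..real N} \<Longrightarrow> F1 (of_real r * cis (2 * pi * t / real N)) = G (r, t)"
    using polar_extension[OF npos(2) contG Gends(1) Gends(2)] by blast
  \<comment> \<open>The circle parametrisation is extended radially to the disc so that
    \<open>polar_extension\<close> applies. The extension leaves the realization, whence the target
    \<open>powertop_real UNIV\<close>; afterwards it is restricted to the circle.\<close>
  define G2 :: "real \<times> real \<Rightarrow> nat \<Rightarrow> real" where "G2 v = (\<lambda>j. fst v * circ n (snd v) j)" for v
  have contG2: "continuous_map (top_of_set ({0..1} \<times> {0..real n})) (powertop_real UNIV) G2"
    unfolding continuous_map_componentwise_UNIV
  proof
    fix j
    have "continuous_on ({0..1} \<times> {0..real n}) (\<lambda>v :: real \<times> real. circ n (snd v) j)"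
      by (rule continuous_on_compose2[OF continuous_on_circ[of n n j] continuous_on_snd[OF continuous_on_id]]) auto
    then have "continuous_on ({0..1} \<times> {0..real n}) (\<lambda>v. G2 v j)"
      unfolding G2_def by (intro continuous_intros)
    then show "continuous_map (top_of_set ({0..1} \<times> {0..real n})) euclideanreal (\<lambda>v. G2 v j)"
      by (simp add: continuous_map_iff_continuous)
  qed
  have G2ends: "G2 (r, 0) = G2 (r, real n)" "G2 (0, t) = G2 (0, s)" for r t s
    using circ_end[OF n_gt(3)] by (simp_all add: G2_def)
  obtain F2 where F2: "continuous_map (top_of_set (cball 0 1)) (powertop_real UNIV) F2"
    and F2_G2: "\<And>r t. r \<in> {0..1} \<Longrightarrow> t \<in> {0..real n} \<Longrightarrow> F2 (of_real r * cis (2 * pi * t / real n)) = G2 (r, t)"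
    using polar_extension[OF npos(1) contG2 G2ends(1) G2ends(2)] by blast
  have F2_eq: "F2 (cis (2 * pi * t / real n)) = circ n t" if "t \<in> {0..real n}" for t
    using F2_G2[of 1 t] that by (simp add: G2_def)
  have f_cone: "f (cone (1, t)) = cone (1, t)" if "t \<in> {0..real N}" for t
    by (rule f_id[OF cone_points]) (use that in \<open>auto simp: cone_def\<close>)
  have F1_circle: "F1 (cis (2 * pi * t / real N)) = circ n t" if "t \<in> {0..real N}" for t
    using F1_eq[of 1 t] that f_cone[OF that] by (simp add: G_def glue_cone)
  have circle: "\<exists>t\<in>{0..L}. w = cis (2 * pi * t / L)" if "w \<in> sphere 0 1" "0 < L" for w and L :: real
  proof -
    have "w \<in> cball 0 1" using \<open>w \<in> sphere 0 1\<close> by simp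
    then obtain r t where "t \<in> {0..L}" "w = of_real r * cis (2 * pi * t / L)" "r = norm w"
      by (rule polar_surj[OF \<open>0 < L\<close>]) blast
    then show ?thesis using \<open>w \<in> sphere 0 1\<close> by auto
  qed
  have nN: "t \<in> {0..real N}" if "t \<in> {0..real n}" for t
  proof -
    have "real n * 1 \<le> real N" unfolding Nn using p0 by (intro mult_left_mono) auto
    then show ?thesis using that by simp
  qed
  have attach: "F1 z = F2 (z ^ p)" if z: "z \<in> sphere 0 1" for z
  proof -
    obtain t where t: "t \<in> {0..real N}" "z = cis (2 * pi * t / real N)" using circle[OF z npos(2)] by blast
    \<comment> \<open>The number of full turns round the \<open>n\<close>-gon before parameter
      \<open>t\<close>.\<close>
    define q where "q = nat \<lfloor>t / real n\<rfloor>"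
    have q: "real q = of_int \<lfloor>t / real n\<rfloor>" using t npos by (simp add: q_def)
    have "real q \<le> t / real n" "t / real n < real q + 1" unfolding q by linarith+
    then have t0: "0 \<le> t - real n * real q" "t - real n * real q \<le> real n"
      using npos by (simp_all add: field_simps)
    have "z ^ p = cis (real p * (2 * pi * t / real N))" unfolding t(2) by (rule Complex.DeMoivre)
    also have "real p * (2 * pi * t / real N) = 2 * pi * t / real n"
      unfolding Nn using p0 npos by (simp add: field_simps)
    also have "2 * pi * t / real n = 2 * pi * (t - real n * real q) / real n + 2 * pi * real q"
      using npos by (simp add: field_simps)
    also have "cis \<dots> = cis (2 * pi * (t - real n * real q) / real n) * cis (2 * pi * real q)"
      by (rule cis_mult[symmetric])
    also have "cis (2 * pi * real q) = 1" by (rule cis_multiple_2pi) simp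
    finally have "F2 (z ^ p) = circ n (t - real n * real q)" using F2_eq[of "t - real n * real q"] t0 by simp
    also have "\<dots> = circ n t" using circ_shift[OF t0(1), of n q] by simp
    also have "\<dots> = F1 z" using F1_circle[OF t(1)] t(2) by simp
    finally show ?thesis by simp
  qed
  have F1_in: "F1 z \<in> points c K0" if "z \<in> cball 0 1" for z
    using F1 that by (auto simp: continuous_map_def)
  have F2_as_F1: "\<exists>z'\<in>sphere 0 1. F2 w = F1 z'" if w: "w \<in> sphere 0 1" for w
  proof -
    obtain t where t: "t \<in> {0..real n}" "w = cis (2 * pi * t / real n)" using circle[OF w npos(1)] by blast
    then have "F2 w = F1 (cis (2 * pi * t / real N))" using F2_eq F1_circle nN by simp
    then show ?thesis by (intro bexI[of _ "cis (2 * pi * t / real N)"]) auto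
  qed
  \<comment> \<open>An interior point of the disc is not sent to the boundary by \<open>f\<close>,
    which is injective and fixes the boundary; off the boundary the gluing is injective.\<close>
  have I1: "z = z'" if z: "norm z < 1" and z': "z' \<in> cball 0 1" and eq: "F1 z = F1 z'" for z z'
  proof -
    have "z \<in> cball 0 1" using z by simp
    then obtain r t where rt: "r \<in> {0..1}" "t \<in> {0..real N}" "z = of_real r * cis (2 * pi * t / real N)" "r = norm z"
      by (rule polar_surj[OF npos(2)]) blast
    obtain r' t' where rt': "r' \<in> {0..1}" "t' \<in> {0..real N}" "z' = of_real r' * cis (2 * pi * t' / real N)" "r' = norm z'"
      by (rule polar_surj[OF npos(2) z']) blast
    have fin: "f (cone (r, t)) \<in> points M (disc (\<lambda>_. p))" "f (cone (r', t')) \<in> points M (disc (\<lambda>_. p))"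
      using cone_points[OF rt(1,2)] cone_points[OF rt'(1,2)] f_img by blast+
    have "\<not> boundary {j. f (cone (r, t)) j \<noteq> 0}"
    proof
      assume "boundary {j. f (cone (r, t)) j \<noteq> 0}"
      then obtain s where s: "s \<in> {0..real N}" "f (cone (r, t)) = cone (1, s)" using boundary_cone[OF fin(1)] by blast
      have "f (cone (r, t)) = f (cone (1, s))" using s f_cone by simp
      then have "cone (r, t) = cone (1, s)"
        using f_inj cone_points[OF rt(1,2)] cone_points[of 1 s] s(1) by (auto simp: inj_on_def)
      then have "r = 1" using cone_eq_imp[OF rt(1,2) _ s(1)] by auto
      then show False using rt(4) z by simp
    qed
    moreover have "glue (f (cone (r, t))) = glue (f (cone (r', t')))"
      using eq F1_eq[OF rt(1,2)] F1_eq[OF rt'(1,2)] rt(3) rt'(3) by (simp add: G_def)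
    ultimately have "f (cone (r, t)) = f (cone (r', t'))" using glue_interior[OF fin] by blast
    then have "cone (r, t) = cone (r', t')"
      using f_inj cone_points[OF rt(1,2)] cone_points[OF rt'(1,2)] by (auto simp: inj_on_def)
    then show ?thesis using cone_eq_imp[OF rt(1,2) rt'(1,2)] unfolding rt(3) rt'(3) by blast
  qed
  have I2: "F1 z \<noteq> F2 w" if z: "norm z < 1" and w: "w \<in> sphere 0 1" for z w
  proof
    assume "F1 z = F2 w"
    then obtain z' where "z' \<in> sphere 0 1" "F1 z = F1 z'" using F2_as_F1[OF w] by auto
    then have "z' \<in> sphere 0 1" "z = z'" using I1[OF z, of z'] by auto
    then show False using z by simp
  qed
  have I3: "w = w'" if w: "w \<in> sphere 0 1" and w': "w' \<in> sphere 0 1" and eq: "F2 w = F2 w'" for w w'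
  proof -
    obtain t where t: "t \<in> {0..real n}" "w = cis (2 * pi * t / real n)" using circle[OF w npos(1)] by blast
    obtain t' where t': "t' \<in> {0..real n}" "w' = cis (2 * pi * t' / real n)" using circle[OF w' npos(1)] by blast
    have "circ n t = circ n t'" using eq t t' F2_eq by simp
    then show ?thesis using circ_eq_imp_cis[OF _ t(1) t'(1)] n_gt(5) t(2) t'(2) by simp
  qed
  define F where "F x = (if fst x then F1 (snd x) else F2 (snd x))" for x
  have contF: "continuous_map disc_plus_circle (geometric_realization c K0) F"
  proof (rule continuous_map_disc_plus_circle)
    show "continuous_map (top_of_set (cball 0 1)) (geometric_realization c K0) (\<lambda>z. F (True, z))"
      using F1 by (simp add: F_def)
    have "continuous_map (subtopology (top_of_set (cball 0 1)) (sphere 0 1)) (powertop_real UNIV) F2"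
      using F2 by (rule continuous_map_from_subtopology)
    moreover have "subtopology (top_of_set (cball 0 1)) (sphere 0 1) = top_of_set (sphere (0::complex) 1)"
      by (simp add: subtopology_subtopology Int_absorb1 sphere_cball)
    ultimately have "continuous_map (top_of_set (sphere 0 1)) (powertop_real UNIV) F2" by simp
    moreover have "F2 w \<in> points c K0" if "w \<in> sphere 0 1" for w
      using F2_as_F1[OF that] F1_in by auto
    ultimately have "continuous_map (top_of_set (sphere 0 1)) (geometric_realization c K0) F2"
      unfolding geometric_realization_eq by (intro continuous_map_into_subtopology) auto
    then show "continuous_map (top_of_set (sphere 0 1)) (geometric_realization c K0) (\<lambda>z. F (False, z))"
      by (simp add: F_def)
  qed
  have surjF: "F ` topspace disc_plus_circle = topspace (geometric_realization c K0)"
  proof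
    show "F ` topspace disc_plus_circle \<subseteq> topspace (geometric_realization c K0)"
      using contF by (auto simp: continuous_map_def)
    show "topspace (geometric_realization c K0) \<subseteq> F ` topspace disc_plus_circle"
    proof
      fix y assume "y \<in> topspace (geometric_realization c K0)"
      then obtain x where x: "x \<in> points M (disc (\<lambda>_. p))" "glue x = y" using glue_surj by auto
      have "x \<in> f ` points M (disc (\<lambda>_. 1))" using x(1) unfolding f_img .
      then obtain u where u: "u \<in> points M (disc (\<lambda>_. 1))" "f u = x" by (elim imageE) simp
      obtain t where t: "t \<in> {0..real N}" "u = cone (1 - u M, t)" "1 - u M \<in> {0..1}" by (rule cone_surj[OF u(1)])
      define z where "z = of_real (1 - u M) * cis (2 * pi * t / real N)"
      have "F1 z = G (1 - u M, t)" unfolding z_def by (rule F1_eq[OF t(3,1)])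
      then have "F (True, z) = y" using t(2) u(2) x(2) by (simp add: F_def G_def)
      moreover have "norm z = \<bar>1 - u M\<bar>" unfolding z_def norm_mult norm_of_real by simp
      then have "z \<in> cball 0 1" using t(3) by simp
      ultimately show "y \<in> F ` topspace disc_plus_circle" unfolding topspace_disc_plus_circle by blast
    qed
  qed
  have quot: "quotient_map disc_plus_circle (geometric_realization c K0) F"
    using continuous_imp_quotient_map[OF contF compact_disc_plus_circle Hausdorff_realization surjF] .
  define R where "R = (\<lambda>x y :: bool \<times> complex. \<exists>z\<in>sphere 0 1. x = (True, z) \<and> y = (False, z ^ p))"
  \<comment> \<open>A normal form: boundary points of the disc are moved to the circle. Two points
    of the sum are equivalent, and have the same image under \<open>F\<close>, iff their normal
    forms agree.\<close>
  define rep where "rep x = (if fst x \<and> snd x \<in> sphere 0 1 then (False, snd x ^ p) else x)" for x :: "bool \<times> complex"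
  have F_rep: "F (rep x) = F x" for x using attach by (auto simp: rep_def F_def)
  have rep_top: "fst (rep x) \<and> norm (snd (rep x)) < 1 \<or> \<not> fst (rep x) \<and> snd (rep x) \<in> sphere 0 1"
    if "x \<in> topspace disc_plus_circle" for x
    using that unfolding topspace_disc_plus_circle by (auto simp: rep_def norm_power)
  have F_iff: "F x = F y \<longleftrightarrow> rep x = rep y" if xy: "x \<in> topspace disc_plus_circle" "y \<in> topspace disc_plus_circle" for x y
  proof
    assume "F x = F y"
    then have eq: "F (rep x) = F (rep y)" by (simp add: F_rep)
    show "rep x = rep y"
      using rep_top[OF xy(1)] rep_top[OF xy(2)] eq I1[of "snd (rep x)" "snd (rep y)"]
        I2[of "snd (rep x)" "snd (rep y)"] I2[of "snd (rep y)" "snd (rep x)"] I3[of "snd (rep x)" "snd (rep y)"]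
      by (auto simp: F_def prod_eq_iff)
  next
    assume "rep x = rep y"
    then show "F x = F y" using F_rep by metis
  qed
  have R_rep: "rep x = rep y" if "R x y" for x y
    using that by (auto simp: R_def rep_def)
  have equiv_rep: "equivclp R x y \<longleftrightarrow> rep x = rep y" for x y
  proof
    assume "equivclp R x y"
    then show "rep x = rep y"
      by (induction rule: equivclp_induct) (use R_rep in metis)+
  next
    assume eq: "rep x = rep y"
    have *: "equivclp R u (rep u)" for u
    proof (cases "fst u \<and> snd u \<in> sphere 0 1")
      case True
      then have "R u (rep u)" unfolding R_def rep_def by (intro bexI[of _ "snd u"]) (auto simp: prod_eq_iff)
      then show ?thesis by (rule r_into_equivclp)
    next
      case False
      then have "rep u = u" unfolding rep_def by (rule if_not_P)
      then show ?thesis by simp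
    qed
    show "equivclp R x y"
      using *[of x] *[of y] unfolding eq by (meson equivclp_sym equivclp_trans)
  qed
  have "moore_space p = quotient_topology disc_plus_circle
      {(x, y). x \<in> topspace disc_plus_circle \<and> y \<in> topspace disc_plus_circle \<and> F x = F y}"
    unfolding moore_space_def R_def[symmetric]
    by (rule arg_cong[of _ _ "quotient_topology disc_plus_circle"]) (auto simp: equiv_rep F_iff)
  then show ?thesis
    using quotient_topology_homeomorphic[OF quot refl] homeomorphic_space_sym by metis
qed

section \<open>Subdividing one triangle of \<open>K0\<close>\<close>

lemma points_K0: "points c K0 = points a K0"
proof -
  have "x a = 0" if "{i. x i \<noteq> 0} \<in> K0" for x :: "nat \<Rightarrow> real"
  proof -
    have "{i. x i \<noteq> 0} \<subseteq> {1..c}" using that facets0_sub unfolding K0_def by blast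
    then show ?thesis using V_lt(3) by force
  qed
  moreover have "{1..a} = insert a {1..c}" "a \<notin> {1..c}" by (auto simp: a_def c_def)
  ultimately have "sum x {1..a} = sum x {1..c}" if "{i. x i \<noteq> 0} \<in> K0" for x :: "nat \<Rightarrow> real"
    using that by simp
  then show ?thesis unfolding points_def by (auto simp del: One_nat_def)
qed

lemma K0_K_homeomorphic: "geometric_realization a K0 homeomorphic_space geometric_realization a K"
proof (rule stellar_homeomorphic[where u = c and v = "V 0" and w = "V p"])
  have V0p: "V 0 \<noteq> V p" using V_add_neq0[of p 0] p n_gt(1) by simp
  have face: "{c, V 0, V p} \<in> facets0" unfolding facets0_def by (rule UnI2, rule CollectI, rule exI[of _ 0]) simp
  have fs: "{a, c, V 0} \<in> facets" "{a, V 0, V p} \<in> facets" "{a, V p, c} \<in> facets" unfolding facets_def by blast+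
  show dist: "distinct [a, c, V 0, V p]" using V0p by simp
  have "V j \<in> {1..a}" "c \<in> {1..a}" "a \<in> {1..a}" for j
    using V_in[of j] by (auto simp: a_def c_def n_def)
  then show "{a, c, V 0, V p} \<subseteq> {1..a}" by blast
  have cases: "\<tau> \<in> facets \<or> \<tau> = {c, V 0, V p}" if \<tau>: "\<tau> \<in> facets0" for \<tau>
  proof -
    consider j t where "1 \<le> t" "t < p" "\<tau> = {V j, V (j + t), V (j + t + 1)}" | j where "\<tau> = {c, V j, V (j + p)}"
      using \<tau> unfolding facets0_def by blast
    then show ?thesis
    proof cases
      case (1 j t)
      have "\<tau> \<in> facets"
        unfolding facets_def 1(3)
        by (rule UnI1, rule UnI1, rule CollectI, rule exI[of _ j], rule exI[of _ t]) (use 1 in simp)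
      then show ?thesis ..
    next
      case (2 j)
      show ?thesis
      proof (cases "j mod n = 0")
        case True
        then have "V j = V 0" "V (j + p) = V p"
          using V_mod(1)[of j] V_mod(2)[of j p] unfolding True by simp_all
        then show ?thesis using 2 by simp
      next
        case False
        have "\<tau> \<in> facets"
          unfolding facets_def 2 by (rule UnI1, rule UnI2, rule CollectI, rule exI[of _ j]) (use False in simp)
        then show ?thesis ..
      qed
    qed
  qed
  have cases': "\<tau> \<in> facets0 \<or> \<tau> = {a, c, V 0} \<or> \<tau> = {a, V 0, V p} \<or> \<tau> = {a, V p, c}" if \<tau>: "\<tau> \<in> facets" for \<tau>
    using \<tau> unfolding facets_def
  proof (elim UnE)
    assume "\<tau> \<in> {{V j, V (j + t), V (j + t + 1)} | j t. 1 \<le> t \<and> t < p}"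
    then have "\<tau> \<in> facets0" unfolding facets0_def by (rule UnI1)
    then show ?thesis ..
  next
    assume "\<tau> \<in> {{c, V j, V (j + p)} | j. j mod n \<noteq> 0}"
    then obtain j where j: "\<tau> = {c, V j, V (j + p)}" by (elim CollectE exE conjE)
    have "\<tau> \<in> facets0" unfolding facets0_def j by (rule UnI2, rule CollectI, rule exI[of _ j]) simp
    then show ?thesis ..
  next
    assume "\<tau> \<in> {{a, c, V 0}, {a, V 0, V p}, {a, V p, c}}"
    then show ?thesis unfolding insert_iff empty_iff by (elim disjE) simp_all
  qed
  have a0: "a \<notin> \<tau>" if "\<tau> \<in> facets0" for \<tau>
    using facets0_sub[OF that] V_lt(3) by force
  fix \<sigma>
  show "\<sigma> \<in> K0 \<Longrightarrow> a \<notin> \<sigma>" unfolding K0_def using a0 by blast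
  show "\<sigma> \<in> K0 \<Longrightarrow> {c, V 0, V p} \<subseteq> \<sigma> \<Longrightarrow> \<sigma> = {c, V 0, V p}"
  proof -
    assume "\<sigma> \<in> K0" and sub: "{c, V 0, V p} \<subseteq> \<sigma>"
    then obtain \<tau> where \<tau>: "\<tau> \<in> facets0" "\<sigma> \<subseteq> \<tau>" unfolding K0_def by blast
    have "finite \<tau>" "card \<tau> \<le> 3" using \<tau>(1) by (auto simp: facets0_def card_insert_if)
    moreover have "card {c, V 0, V p} = 3" using V0p by simp
    ultimately have "{c, V 0, V p} = \<tau>" using sub \<tau>(2) by (intro card_seteq) auto
    then show "\<sigma> = {c, V 0, V p}" using sub \<tau>(2) by blast
  qed
  show "\<sigma> \<in> K0 \<Longrightarrow> \<not> {c, V 0, V p} \<subseteq> \<sigma> \<Longrightarrow> \<sigma> \<in> K"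
  proof -
    assume "\<sigma> \<in> K0" and ns: "\<not> {c, V 0, V p} \<subseteq> \<sigma>"
    then obtain \<tau> where \<tau>: "\<tau> \<in> facets0" "\<sigma> \<subseteq> \<tau>" unfolding K0_def by blast
    from cases[OF \<tau>(1)] show "\<sigma> \<in> K"
    proof
      assume "\<tau> = {c, V 0, V p}"
      then have "\<sigma> \<subseteq> {a, c, V 0} \<or> \<sigma> \<subseteq> {a, V 0, V p} \<or> \<sigma> \<subseteq> {a, V p, c}" using \<tau>(2) ns by blast
      then show ?thesis using fs K_I by blast
    qed (use \<tau> K_I in blast)
  qed
  show "\<sigma> \<subseteq> {c, V 0, V p} \<Longrightarrow> \<sigma> \<in> K0" unfolding K0_def using face by blast
  show "\<sigma> \<subseteq> {a, c, V 0} \<or> \<sigma> \<subseteq> {a, c, V p} \<or> \<sigma> \<subseteq> {a, V 0, V p} \<Longrightarrow> \<sigma> \<in> K"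
    using fs K_I[of _ \<sigma>] by (metis insert_commute)
  show "\<sigma> \<in> K \<Longrightarrow> a \<in> \<sigma> \<Longrightarrow> \<sigma> \<subseteq> {a, c, V 0} \<or> \<sigma> \<subseteq> {a, c, V p} \<or> \<sigma> \<subseteq> {a, V 0, V p}"
  proof -
    assume "\<sigma> \<in> K" "a \<in> \<sigma>"
    then obtain \<tau> where \<tau>: "\<tau> \<in> facets" "\<sigma> \<subseteq> \<tau>" "a \<in> \<tau>" unfolding K_def by blast
    then show "\<sigma> \<subseteq> {a, c, V 0} \<or> \<sigma> \<subseteq> {a, c, V p} \<or> \<sigma> \<subseteq> {a, V 0, V p}"
      using cases'[OF \<tau>(1)] a0 by blast
  qed
  show "\<sigma> \<in> K \<Longrightarrow> a \<notin> \<sigma> \<Longrightarrow> \<sigma> \<in> K0"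
  proof -
    assume "\<sigma> \<in> K" and na: "a \<notin> \<sigma>"
    then obtain \<tau> where \<tau>: "\<tau> \<in> facets" "\<sigma> \<subseteq> \<tau>" unfolding K_def by blast
    have "\<tau> \<in> facets0 \<or> \<sigma> \<subseteq> {c, V 0, V p}" using cases'[OF \<tau>(1)] \<tau>(2) na by blast
    then show "\<sigma> \<in> K0" unfolding K0_def using face \<tau>(2) by blast
  qed
  show "\<sigma> \<in> K \<Longrightarrow> \<not> {c, V 0, V p} \<subseteq> \<sigma>" using missing_triangle K_subset by blast
qed

lemma K_homeomorphic: "geometric_realization a K homeomorphic_space moore_space p"
proof -
  have "geometric_realization c K0 = geometric_realization a K0"
    by (simp add: geometric_realization_eq points_K0)
  then show ?thesis
    using K0_homeomorphic K0_K_homeomorphic homeomorphic_space_sym homeomorphic_space_trans by metis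
qed

end

theorem theorem1p7:
  fixes p :: nat
  assumes "p \<ge> 2" and "CARD('p::nontriv) = p"
  shows "\<exists>m K. simplicial_complex_on m K
            \<and> geometric_realization m K homeomorphic_space moore_space p
            \<and> golod TYPE(rat) m K
            \<and> \<not> golod TYPE('p mod_ring) m K"
proof -
  interpret moore_triangulation p by unfold_locales (rule assms(1))
  have "of_nat p = (0 :: 'p mod_ring)" using of_nat_card_eq_0[where 'a = 'p] assms(2) by simp
  then show ?thesis
    using simplicial_complex_K K_homeomorphic golod_char_0 not_golod by blast
qed

end
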